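(* Let $l\geq 2$ and $D$ be positive integers with $D\equiv0$ or $3\pmod 4$. Let $S(-D)=\begin{bmatrix}D/4&0\\ 0&1\end{bmatrix}$ if $D\equiv0\pmod4$ and $S(-D)=\begin{bmatrix}(1+D)/4&1/2\\ 1/2&1\end{bmatrix}$ if $D\equiv3\pmod4$. Let $\tau$ be a generic, irreducible, admissible representation of $\mathrm{GL}_2(\mathbb R)$ with a vector $W^{(0)}$ of weight $l_1$ in its Whittaker model, let $l_2=l_1-2l$ if $l\le l_1$ and $l_2=-l_1$ if $l\ge l_1$, and let $B$, $W^\#(\cdot,s)$, $\eta$, $R(\mathbb R)$, $q$, $r$, $a^+$ be as in the context (with $S=S(-D)$). Then, for $\mathrm{Re}(6s+2l+l_2-q-1)>0$, the integral $Z(s,W^\#,B)=\int_{R(\mathbb R)\backslash\mathrm{GSp}_4(\mathbb R)}W^\#(\eta h,s)B(h)\,dh$ is given by $$Z(s,W^\#,B)=i^{l+l_2}a^+\pi D^{-3s-\frac l2+\frac q2}\,\frac{(4\pi)^{-3s+\frac32-l+q}}{6s+2l+l_2-q-1}\,\frac{\Gamma(3s+l-1+\frac{ir}2-\frac q2)\,\Gamma(3s+l-1-\frac{ir}2-\frac q2)}{\Gamma(3s+l-\frac{l_1}2-\frac12-\frac q2)}.$$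
   Context: Groups. $J=\begin{bmatrix}0&1_2\\ -1_2&0\end{bmatrix}$, $G(\mathbb R)=\{g\in\mathrm{GL}_4(\mathbb C):{}^t\bar gJg=\mu(g)J,\ \mu(g)\in\mathbb R^\times\}$, $H(\mathbb R)=\mathrm{GSp}_4(\mathbb R)=G(\mathbb R)\cap\mathrm{GL}_4(\mathbb R)$, $G^+(\mathbb R)$, $H^+(\mathbb R)$ the subgroups with $\mu>0$. For $g=\begin{bmatrix}A&B'\\ C&D'\end{bmatrix}\in G^+(\mathbb R)$ and $Z$ in $\mathbb H_2=\{Z\in M_2(\mathbb C): i({}^t\bar Z-Z)>0\}$ put $g\langle Z\rangle=(AZ+B')(CZ+D')^{-1}$ and $J(g,Z)=CZ+D'$. Let $I=i\cdot1_2$, $K_\infty=\{g\in G^+(\mathbb R):\mu(g)=1,\ g\langle I\rangle=I\}$, $K^H_\infty=K_\infty\cap H(\mathbb R)$. $M^{(1)}(\mathbb R)=\{\mathrm{diag}(\zeta,1,\bar\zeta^{-1},1):\zeta\in\mathbb C^\times\}$; $M^{(2)}(\mathbb R)=\{\begin{bmatrix}1\\ &a'&&b'\\ &&\mu\\ &c'&&d'\end{bmatrix}\}$ with $\begin{bmatrix}a'&b'\\ c'&d'\end{bmatrix}\in\mathrm{GU}(1,1)(\mathbb R)=\mathbb C^\times\mathrm{GL}_2(\mathbb R)$ and $\mu=\bar a'd'-b'\bar c'\in\mathbb R^\times$ (we identify $M^{(2)}(\mathbb R)$ with $\mathrm{GU}(1,1)(\mathbb R)$); $N(\mathbb R)$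 is the group of $\begin{bmatrix}1&z&&\\ &1&&\\ &&1&\\ &&-\bar z&1\end{bmatrix}\begin{bmatrix}1&&w&y\\ &1&\bar y&\\ &&1&\\ &&&1\end{bmatrix}$, $w\in\mathbb R$, $y,z\in\mathbb C$. One has $G(\mathbb R)=M^{(1)}(\mathbb R)M^{(2)}(\mathbb R)N(\mathbb R)K_\infty$, and $\delta_P(m_1m_2)=|\zeta\bar\zeta\mu^{-1}|^3$. Write $S=S(-D)=\begin{bmatrix}a&b/2\\ b/2&c\end{bmatrix}$ (so $c=1$, $4ac-b^2=D$). $T(\mathbb R)=\{g\in\mathrm{GL}_2(\mathbb R):{}^tgSg=\det(g)S\}$, embedded in $H(\mathbb R)$ by $g\mapsto\begin{bmatrix}g&\\ &\det(g){}^tg^{-1}\end{bmatrix}$; $U(\mathbb R)=\{\begin{bmatrix}1&X\\ &1\end{bmatrix}:{}^tX=X\}$; $R(\mathbb R)=T(\mathbb R)U(\mathbb R)$. $\psi(x)=e^{-2\pi ix}$. $\alpha=\frac{b+\sqrt{-D}}{2c}$ and $\eta=\begin{bmatrix}1\\ \alpha&1\\ &&1&-\bar\alpha\\ &&&1\end{bmatrix}$. Bessel function: $B(h)=\mu(h)^l\,\overline{\det(J(h,I))^{-l}}\,e^{-2\pi i\,\mathrm{tr}(S\overline{h\langle I\rangle})}$ for $h\in H^+(\mathbb R)$ and $B(h)=0$ for $h\in H(\mathbb R)\setminus H^+(\mathbb R)$. Whittaker data: $\tau$ is realized in its Whittaker model with respect to $x\mapsto\psi(-cx)$; $W^{(0)}$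 is a vector in this model with $W^{(0)}(g\begin{bmatrix}\cos\theta&\sin\theta\\ -\sin\theta&\cos\theta\end{bmatrix})=e^{il_1\theta}W^{(0)}(g)$. The number $q\in\mathbb C$ is defined by $\omega_\tau(y)=y^q$ for $y>0$, where $\omega_\tau$ is the central character of $\tau$. The element $\Delta=\frac14(H_0^2+2R_0L_0+2L_0R_0)$ of the universal enveloping algebra of $\mathfrak{gl}(2,\mathbb R)$, with $R_0=\begin{bmatrix}0&1\\ 0&0\end{bmatrix}$, $L_0=\begin{bmatrix}0&0\\ 1&0\end{bmatrix}$, $H_0=\begin{bmatrix}1&0\\ 0&-1\end{bmatrix}$, acts on $\tau$ by the scalar $-(\frac14+(\frac r2)^2)$, $r\in\mathbb C$. The constant $a^+\in\mathbb C$ is defined by $W^{(0)}(\begin{bmatrix}t&0\\ 0&1\end{bmatrix})=a^+\omega_\tau((4\pi ct)^{1/2})W_{\frac{l_1}2,\frac{ir}2}(4\pi ct)$ for $t>0$, where $W_{\kappa,\mu}$ is the classical Whittaker function. Section: $\chi_0$ is the character of $\mathbb C^\times$ with $\chi_0|_{\mathbb R^\times}=\omega_\tau$ and $\chi_0(\zeta)=\zeta^{l_2}$ for $|\zeta|=1$; $\chi(\zeta)=\chi_0(\bar\zeta)^{-1}$; $W^{(0)}$ is extended to $M^{(2)}(\mathbb R)$ by $W^{(0)}(\zeta g)=\chi_0(\zeta)W^{(0)}(g)$, $\zeta\in\mathbb C^\times$, $g\in\mathrm{GL}_2(\mathbb R)$. For $g\in K_\infty$ write $J(g\,{}^tg,I)=\begin{bmatrix}\hat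 a(g)&\hat b(g)\\ \hat c(g)&\hat d(g)\end{bmatrix}$, and put $f(g)=\hat b(g)^{l_1-l}\det(J(g,I))^{-l}$ if $l\le l_1$, $f(g)=\hat c(g)^{l-l_1}\det(J(g,I))^{-l}$ if $l\ge l_1$. Then $W^\#(m_1m_2nk,s)=\delta_P^{s+1/2}(m_1m_2)\chi(m_1)W^{(0)}(m_2)f(k)$ for $m_i\in M^{(i)}(\mathbb R)$, $n\in N(\mathbb R)$, $k\in K_\infty$ (well-defined), where $\chi(\mathrm{diag}(\zeta,1,\bar\zeta^{-1},1))=\chi(\zeta)$. Measure: let $t_0\in\mathrm{SL}_2(\mathbb R)$ with $T(\mathbb R)\cap\mathrm{SL}_2(\mathbb R)=t_0\mathrm{SO}(2)t_0^{-1}$ (for $D\equiv0\bmod4$ one may take $t_0=\mathrm{diag}(2^{1/2}D^{-1/4},2^{-1/2}D^{1/4})$). The invariant measure on $R(\mathbb R)\backslash H(\mathbb R)$ is normalized so that for left $R(\mathbb R)$-invariant and right $K^H_\infty$-invariant $F$, $$\int_{R(\mathbb R)\backslash H(\mathbb R)}F(h)\,dh=\pi\int_{\mathbb R^\times}\int_1^\infty F\left(\begin{bmatrix}\lambda t_0\begin{bmatrix}\zeta&\\ &\zeta^{-1}\end{bmatrix}&\\ &{}^tt_0^{-1}\begin{bmatrix}\zeta^{-1}&\\ &\zeta\end{bmatrix}\end{bmatrix}\right)(\zeta-\zeta^{-3})\lambda^{-4}\,d\zeta\,d\lambda.$$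
   Formalization: The condition Re(6s+2l+l_2-q-1)>0 alone does not ensure convergence of the integral; the formula is asserted where Z converges absolutely (shown when both numerator Gamma arguments have positive real part, or one in the polynomial case), and as a limit in s at poles of numerator Gammas. *)

theory Defs
  imports "HOL-Analysis.Analysis"
begin

section \<open>Matrices\<close>

lemma vector_4 [simp]:
  "(vector [x,y,z,w] :: ('a::zero)^4) $ 1 = x"
  "(vector [x,y,z,w] :: ('a::zero)^4) $ 2 = y"
  "(vector [x,y,z,w] :: ('a::zero)^4) $ 3 = z"
  "(vector [x,y,z,w] :: ('a::zero)^4) $ 4 = w"
  unfolding vector_def by simp_all

definition mat2 :: "'a::zero \<Rightarrow> 'a \<Rightarrow> 'a \<Rightarrow> 'a \<Rightarrow> 'a^2^2" where
  "mat2 a b c d = vector [vector [a, b], vector [c, d]]"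

definition blk :: "complex^2^2 \<Rightarrow> complex^2^2 \<Rightarrow> complex^2^2 \<Rightarrow> complex^2^2 \<Rightarrow> complex^4^4" where
  "blk A B C D = vector
     [vector [A$1$1, A$1$2, B$1$1, B$1$2],
      vector [A$2$1, A$2$2, B$2$1, B$2$2],
      vector [C$1$1, C$1$2, D$1$1, D$1$2],
      vector [C$2$1, C$2$2, D$2$1, D$2$2]]"

definition blkA :: "complex^4^4 \<Rightarrow> complex^2^2" where
  "blkA g = mat2 (g$1$1) (g$1$2) (g$2$1) (g$2$2)"
definition blkB :: "complex^4^4 \<Rightarrow> complex^2^2" where
  "blkB g = mat2 (g$1$3) (g$1$4) (g$2$3) (g$2$4)"
definition blkC :: "complex^4^4 \<Rightarrow> complex^2^2" where
  "blkC g = mat2 (g$3$1) (g$3$2) (g$4$1) (g$4$2)"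
definition blkD :: "complex^4^4 \<Rightarrow> complex^2^2" where
  "blkD g = mat2 (g$3$3) (g$3$4) (g$4$3) (g$4$4)"

definition cmat :: "real^2^2 \<Rightarrow> complex^2^2" where
  "cmat = map_matrix complex_of_real"

definition rot :: "real \<Rightarrow> real^2^2" where
  "rot \<theta> = mat2 (cos \<theta>) (sin \<theta>) (- sin \<theta>) (cos \<theta>)"

section \<open>The groups\<close>

definition Jsymp :: "complex^4^4" where
  "Jsymp = blk 0 (mat 1) (- mat 1) 0"

definition has_similitude :: "complex^4^4 \<Rightarrow> real \<Rightarrow> bool" where
  "has_similitude g \<mu> \<longleftrightarrow> map_matrix cnj (transpose g) ** Jsymp ** g = \<mu> *\<^sub>R Jsymp"

definition similitude :: "complex^4^4 \<Rightarrow> real" where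
  "similitude g = (THE \<mu>. has_similitude g \<mu>)"

definition grpG :: "(complex^4^4) set" where
  "grpG = {g. invertible g \<and> (\<exists>\<mu>. \<mu> \<noteq> 0 \<and> has_similitude g \<mu>)}"

definition grpGplus :: "(complex^4^4) set" where
  "grpGplus = {g \<in> grpG. similitude g > 0}"

text \<open>All subgroups of \<open>GSp\<^sub>4(\<real>)\<close> are kept inside the complex matrices, as
  \<open>GSp\<^sub>4(\<real>) = G(\<real>) \<inter> GL\<^sub>4(\<real>)\<close>.\<close>

definition grpH :: "(complex^4^4) set" where
  "grpH = {g \<in> grpG. \<forall>i j. g $ i $ j \<in> \<real>}"

definition grpHplus :: "(complex^4^4) set" where
  "grpHplus = grpH \<inter> grpGplus"

definition moebius :: "complex^4^4 \<Rightarrow> complex^2^2 \<Rightarrow> complex^2^2" where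
  "moebius g Z = (blkA g ** Z + blkB g) ** matrix_inv (blkC g ** Z + blkD g)"

definition Jfac :: "complex^4^4 \<Rightarrow> complex^2^2 \<Rightarrow> complex^2^2" where
  "Jfac g Z = blkC g ** Z + blkD g"

definition basept :: "complex^2^2" where
  "basept = mat \<i>"

definition Kinf :: "(complex^4^4) set" where
  "Kinf = {g \<in> grpGplus. similitude g = 1 \<and> moebius g basept = basept}"

definition KinfH :: "(complex^4^4) set" where
  "KinfH = Kinf \<inter> grpH"

definition m1 :: "complex \<Rightarrow> complex^4^4" where
  "m1 \<zeta> = vector
     [vector [\<zeta>, 0, 0, 0],
      vector [0, 1, 0, 0],
      vector [0, 0, inverse (cnj \<zeta>), 0],
      vector [0, 0, 0, 1]]"

definition GU11 :: "(complex^2^2) set" where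
  "GU11 = {mat \<zeta> ** cmat g | \<zeta> g. \<zeta> \<noteq> 0 \<and> invertible g}"

definition mu11 :: "complex^2^2 \<Rightarrow> complex" where
  "mu11 m = cnj (m$1$1) * m$2$2 - m$1$2 * cnj (m$2$1)"

definition m2 :: "complex^2^2 \<Rightarrow> complex^4^4" where
  "m2 m = vector
     [vector [1, 0, 0, 0],
      vector [0, m$1$1, 0, m$1$2],
      vector [0, 0, mu11 m, 0],
      vector [0, m$2$1, 0, m$2$2]]"

definition nP :: "complex \<Rightarrow> real \<Rightarrow> complex \<Rightarrow> complex^4^4" where
  "nP z w y =
     (vector
       [vector [1, z, 0, 0],
        vector [0, 1, 0, 0],
        vector [0, 0, 1, 0],
        vector [0, 0, - cnj z, 1]] :: complex^4^4) **
     vector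
       [vector [1, 0, of_real w, y],
        vector [0, 1, cnj y, 0],
        vector [0, 0, 1, 0],
        vector [0, 0, 0, 1]]"

definition deltaP :: "complex \<Rightarrow> complex^2^2 \<Rightarrow> real" where
  "deltaP \<zeta> m = cmod (\<zeta> * cnj \<zeta> * inverse (mu11 m)) ^ 3"

section \<open>Bessel data\<close>

definition Smat :: "nat \<Rightarrow> real^2^2" where
  "Smat D = (if D mod 4 = 0 then mat2 (real D / 4) 0 0 1
             else mat2 ((1 + real D) / 4) (1/2) (1/2) 1)"

definition grpT :: "real^2^2 \<Rightarrow> (real^2^2) set" where
  "grpT S = {g. invertible g \<and> transpose g ** S ** g = det g *\<^sub>R S}"

definition embT :: "real^2^2 \<Rightarrow> complex^4^4" where
  "embT g = blk (cmat g) 0 0 (cmat (det g *\<^sub>R matrix_inv (transpose g)))"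

definition grpU :: "(complex^4^4) set" where
  "grpU = {blk (mat 1) (cmat X) 0 (mat 1) | X. transpose X = X}"

definition grpR :: "real^2^2 \<Rightarrow> (complex^4^4) set" where
  "grpR S = {embT g ** u | g u. g \<in> grpT S \<and> u \<in> grpU}"

definition psi :: "real \<Rightarrow> complex" where
  "psi x = exp (- 2 * of_real pi * \<i> * of_real x)"

text \<open>With \<open>S = (a, b/2; b/2, c)\<close> and \<open>4ac - b\<^sup>2 = D\<close>: \<open>\<alpha> = (b + sqrt(-D)) / (2c)\<close>.\<close>

definition alpha :: "real^2^2 \<Rightarrow> complex" where
  "alpha S = (let a = S$1$1; b = 2 * S$1$2; c = S$2$2 in
     (of_real b + \<i> * of_real (sqrt (4*a*c - b^2))) / of_real (2*c))"

definition eta :: "real^2^2 \<Rightarrow> complex^4^4" where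
  "eta S = vector
     [vector [1, 0, 0, 0],
      vector [alpha S, 1, 0, 0],
      vector [0, 0, 1, - cnj (alpha S)],
      vector [0, 0, 0, 1]]"

definition Bessel_fun :: "real^2^2 \<Rightarrow> nat \<Rightarrow> complex^4^4 \<Rightarrow> complex" where
  "Bessel_fun S l h = (if h \<in> grpHplus then
       of_real (similitude h) ^ l * cnj (det (Jfac h basept) powi (- int l)) *
       exp (- 2 * of_real pi * \<i> * trace (cmat S ** map_matrix cnj (moebius h basept)))
     else 0)"

section \<open>Whittaker models of \<open>GL\<^sub>2(\<real>)\<close>\<close>

text \<open>
  Representations of \<open>GL\<^sub>2(\<real>)\<close> are \<open>(gl\<^sub>2, O(2))\<close>-modules. Functions on \<open>GL\<^sub>2(\<real>)\<close> are
  functions on all matrices that vanish at the singular ones. The action of a Lie algebra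
  element \<open>X\<close> is the derivative of \<open>t \<mapsto> W(g exp(tX))\<close> at \<open>t = 0\<close>, that is the total
  derivative of \<open>W\<close> at \<open>g\<close> in the direction \<open>gX\<close>.\<close>

definition lie_act :: "real^2^2 \<Rightarrow> (real^2^2 \<Rightarrow> complex) \<Rightarrow> real^2^2 \<Rightarrow> complex" where
  "lie_act X W g = (if invertible g then frechet_derivative W (at g) (g ** X) else 0)"

definition casimir :: "(real^2^2 \<Rightarrow> complex) \<Rightarrow> real^2^2 \<Rightarrow> complex" where
  "casimir W g = (let R\<^sub>0 = mat2 0 1 0 0; L\<^sub>0 = mat2 0 0 1 0; H\<^sub>0 = mat2 1 0 0 (-1) in
     1/4 * (lie_act H\<^sub>0 (lie_act H\<^sub>0 W) g + 2 * lie_act R\<^sub>0 (lie_act L\<^sub>0 W) g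
            + 2 * lie_act L\<^sub>0 (lie_act R\<^sub>0 W) g))"

definition right_transl :: "real^2^2 \<Rightarrow> (real^2^2 \<Rightarrow> complex) \<Rightarrow> real^2^2 \<Rightarrow> complex" where
  "right_transl k W g = W (g ** k)"

definition fin_dim :: "(real^2^2 \<Rightarrow> complex) set \<Rightarrow> bool" where
  "fin_dim V \<longleftrightarrow> (\<exists>(n::nat) b. \<forall>W\<in>V. \<exists>c. \<forall>g. W g = (\<Sum>i<n. c i * b i g))"

definition has_weight :: "int \<Rightarrow> (real^2^2 \<Rightarrow> complex) \<Rightarrow> bool" where
  "has_weight k W \<longleftrightarrow> (\<forall>g \<theta>. W (g ** rot \<theta>) = exp (\<i> * of_int k * of_real \<theta>) * W g)"

definition gK_stable :: "(real^2^2 \<Rightarrow> complex) set \<Rightarrow> bool" where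
  "gK_stable V \<longleftrightarrow>
     (\<lambda>g. 0) \<in> V \<and>
     (\<forall>W\<in>V. \<forall>W'\<in>V. (\<lambda>g. W g + W' g) \<in> V) \<and>
     (\<forall>c. \<forall>W\<in>V. (\<lambda>g. c * W g) \<in> V) \<and>
     (\<forall>k. orthogonal_matrix k \<longrightarrow> (\<forall>W\<in>V. right_transl k W \<in> V)) \<and>
     (\<forall>X. \<forall>W\<in>V. lie_act X W \<in> V)"

definition irreducible_admissible :: "(real^2^2 \<Rightarrow> complex) set \<Rightarrow> bool" where
  "irreducible_admissible V \<longleftrightarrow>
     gK_stable V \<and> V \<noteq> {\<lambda>g. 0} \<and>
     (\<forall>U. U \<subseteq> V \<longrightarrow> gK_stable U \<longrightarrow> U = {\<lambda>g. 0} \<or> U = V) \<and>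
     (\<forall>k. fin_dim {W\<in>V. has_weight k W})"

text \<open>The Whittaker model of a generic irreducible admissible representation with respect to
  the additive character \<open>\<theta>\<close>. As \<open>V\<close> is stable under the Lie algebra, differentiability of all
  its members amounts to smoothness of all its members.\<close>

definition whittaker_model :: "(real \<Rightarrow> complex) \<Rightarrow> (real^2^2 \<Rightarrow> complex) set \<Rightarrow> bool" where
  "whittaker_model \<theta> V \<longleftrightarrow>
     irreducible_admissible V \<and>
     (\<forall>W\<in>V.
        (\<forall>g. \<not> invertible g \<longrightarrow> W g = 0) \<and>
        W differentiable_on {g. invertible g} \<and>
        (\<forall>x g. W (mat2 1 x 0 1 ** g) = \<theta> x * W g) \<and>
        fin_dim {right_transl k W | k. orthogonal_matrix k} \<and>
        (\<exists>C (N::nat). \<forall>g. invertible g \<longrightarrow>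
            cmod (W g) \<le> C * (norm g + inverse \<bar>det g\<bar>) ^ N))"

definition central_character :: "(real^2^2 \<Rightarrow> complex) set \<Rightarrow> (real \<Rightarrow> complex) \<Rightarrow> bool" where
  "central_character V \<omega> \<longleftrightarrow> (\<forall>z. z \<noteq> 0 \<longrightarrow> (\<forall>W\<in>V. \<forall>g. W (mat z ** g) = \<omega> z * W g))"

text \<open>The classical Whittaker function \<open>W\<^bsub>\<kappa>,\<mu>\<^esub>\<close> on the positive reals: the solution of
  Whittaker's differential equation that is asymptotic to \<open>exp(-x/2) x\<^sup>\<kappa>\<close> as \<open>x\<close> tends to
  infinity (every other solution that is not a multiple of it grows like \<open>exp(x/2) x\<^bsup>-\<kappa>\<^esup>\<close>,
  so these conditions determine it).\<close>

definition is_Whittaker_W :: "complex \<Rightarrow> complex \<Rightarrow> (real \<Rightarrow> complex) \<Rightarrow> bool" where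
  "is_Whittaker_W \<kappa> \<mu> w \<longleftrightarrow>
     (\<exists>w' w''. \<forall>x>0.
        (w has_vector_derivative w' x) (at x) \<and>
        (w' has_vector_derivative w'' x) (at x) \<and>
        w'' x + (- 1/4 + \<kappa> / of_real x + (1/4 - \<mu>^2) / of_real x ^ 2) * w x = 0) \<and>
     ((\<lambda>x. w x / (exp (- of_real x / 2) * of_real x powr \<kappa>)) \<longlongrightarrow> 1) at_top"

section \<open>The section\<close>

definition weight2 :: "nat \<Rightarrow> int \<Rightarrow> int" where
  "weight2 l l1 = (if int l \<le> l1 then l1 - 2 * int l else - l1)"

definition chi0_char :: "(real \<Rightarrow> complex) \<Rightarrow> int \<Rightarrow> (complex \<Rightarrow> complex) \<Rightarrow> bool" where
  "chi0_char \<omega> l2 \<chi>0 \<longleftrightarrow>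
     (\<forall>z w. z \<noteq> 0 \<longrightarrow> w \<noteq> 0 \<longrightarrow> \<chi>0 (z * w) = \<chi>0 z * \<chi>0 w) \<and>
     (\<forall>x::real. x \<noteq> 0 \<longrightarrow> \<chi>0 (of_real x) = \<omega> x) \<and>
     (\<forall>z. cmod z = 1 \<longrightarrow> \<chi>0 z = z powi l2)"

definition extends_to_GU11 ::
  "(complex \<Rightarrow> complex) \<Rightarrow> (real^2^2 \<Rightarrow> complex) \<Rightarrow> (complex^2^2 \<Rightarrow> complex) \<Rightarrow> bool" where
  "extends_to_GU11 \<chi>0 W0 W0x \<longleftrightarrow>
     (\<forall>\<zeta> g. \<zeta> \<noteq> 0 \<longrightarrow> invertible g \<longrightarrow> W0x (mat \<zeta> ** cmat g) = \<chi>0 \<zeta> * W0 g)"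

definition f_K :: "nat \<Rightarrow> int \<Rightarrow> complex^4^4 \<Rightarrow> complex" where
  "f_K l l1 g = (let M = Jfac (g ** transpose g) basept in
     (if int l \<le> l1 then (M$1$2) ^ nat (l1 - int l) else (M$2$1) ^ nat (int l - l1))
       * det (Jfac g basept) powi (- int l))"

definition is_section ::
  "nat \<Rightarrow> int \<Rightarrow> (complex \<Rightarrow> complex) \<Rightarrow> (complex^2^2 \<Rightarrow> complex) \<Rightarrow>
     (complex^4^4 \<Rightarrow> complex \<Rightarrow> complex) \<Rightarrow> bool" where
  "is_section l l1 \<chi>0 W0x Ws \<longleftrightarrow>
     (\<forall>\<zeta> m z w y k s. \<zeta> \<noteq> 0 \<longrightarrow> m \<in> GU11 \<longrightarrow> k \<in> Kinf \<longrightarrow>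
        Ws (m1 \<zeta> ** m2 m ** nP z w y ** k) s =
          of_real (deltaP \<zeta> m) powr (s + 1/2) * inverse (\<chi>0 (cnj \<zeta>)) * W0x m * f_K l l1 k)"

section \<open>The invariant measure on \<open>R(\<real>)\H(\<real>)\<close>\<close>

definition cosetR :: "real^2^2 \<Rightarrow> complex^4^4 \<Rightarrow> (complex^4^4) set" where
  "cosetR S h = (\<lambda>r. r ** h) ` grpR S"

definition quotRH :: "real^2^2 \<Rightarrow> (complex^4^4) set set" where
  "quotRH S = cosetR S ` grpH"

text \<open>The value on a coset of a left \<open>R(\<real>)\<close>-invariant function on \<open>H(\<real>)\<close>.\<close>

definition on_coset :: "(complex^4^4 \<Rightarrow> 'a) \<Rightarrow> (complex^4^4) set \<Rightarrow> 'a" where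
  "on_coset F X = F (SOME h. h \<in> X)"

definition conj_to_SO2 :: "real^2^2 \<Rightarrow> real^2^2 \<Rightarrow> bool" where
  "conj_to_SO2 S t0 \<longleftrightarrow> det t0 = 1 \<and>
     {g \<in> grpT S. det g = 1} = {t0 ** k ** matrix_inv t0 | k. rotation_matrix k}"

definition hrep :: "real^2^2 \<Rightarrow> real \<Rightarrow> real \<Rightarrow> complex^4^4" where
  "hrep t0 lam \<zeta> = blk
     (cmat (lam *\<^sub>R (t0 ** mat2 \<zeta> 0 0 (inverse \<zeta>)))) 0
     0 (cmat (matrix_inv (transpose t0) ** mat2 (inverse \<zeta>) 0 0 \<zeta>))"

text \<open>The sets of the measure space are the Borel sets of the quotient space. The
  normalization is stated for nonnegative Borel functions, which determines it for
  integrable ones.\<close>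

definition quot_measure :: "real^2^2 \<Rightarrow> real^2^2 \<Rightarrow> (complex^4^4) set measure \<Rightarrow> bool" where
  "quot_measure S t0 M \<longleftrightarrow>
     space M = quotRH S \<and>
     sets M = {A. A \<subseteq> quotRH S \<and> \<Union>A \<in> sets borel} \<and>
     (\<forall>h\<in>grpH. \<forall>A\<in>sets M. emeasure M ((\<lambda>X. (\<lambda>x. x ** h) ` X) ` A) = emeasure M A) \<and>
     (\<forall>F :: complex^4^4 \<Rightarrow> ennreal.
        F \<in> borel_measurable (restrict_space borel grpH) \<longrightarrow>
        (\<forall>r\<in>grpR S. \<forall>h\<in>grpH. F (r ** h) = F h) \<longrightarrow>
        (\<forall>h\<in>grpH. \<forall>k\<in>KinfH. F (h ** k) = F h) \<longrightarrow>
        (\<integral>\<^sup>+X. on_coset F X \<partial>M) =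
          ennreal pi *
          (\<integral>\<^sup>+lam\<in>-{0}. (\<integral>\<^sup>+\<zeta>\<in>{1..}.
             F (hrep t0 lam \<zeta>) * ennreal ((\<zeta> - inverse (\<zeta>^3)) * inverse (lam^4))
             \<partial>lborel) \<partial>lborel))"

end

theory Submission
  imports Defs "HOL-Complex_Analysis.Complex_Singularities" "HOL-Real_Asymp.Real_Asymp"
begin

text \<open>The integrand is left \<open>R(\<real>)\<close>-invariant and right \<open>K\<^sub>\<infinity>\<^sup>H\<close>-invariant, and
  \<open>H\<^sup>+(\<real>)\<close> is covered by the double cosets of \<open>hrep t0 lam \<zeta>\<close> with \<open>lam > 0\<close>, \<open>\<zeta> \<ge> 1\<close>. An explicit
  Iwasawa decomposition of \<open>\<eta> hrep t0 lam \<zeta>\<close> gives the integrand there as a function of \<open>lam\<close> and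
  \<open>X = (\<zeta>\<^sup>2 + \<zeta>\<^sup>-\<^sup>2) / 2\<close>. Substituting \<open>u = 4 \<pi> D\<^sup>1\<^sup>/\<^sup>2 X lam\<close> separates the integral into
  a power integral over \<open>X \<ge> 1\<close>, giving the factor \<open>1 / (6 s + 2 l + l\<^sub>2 - q - 1)\<close>, and the Mellin
  transform of \<open>exp(-u/2) W(u)\<close>. The differential equation of \<open>W\<close> makes the Mellin transform satisfy
  the first order recursion of the Gamma quotient. As the two have the same growth under integer
  shifts, by the asymptotics of \<open>W\<close> at infinity, they agree wherever the integral converges.\<close>

section \<open>The Mellin transform of the Whittaker function\<close>

text \<open>\<open>Wh\<close> is known only through its differential equation and its behaviour at
  infinity, so no connection formula at 0 is at hand. The recursion moves the Mellin transform to
  \<nu> + n, where for large n the mass of the integral lies far out and the leading asymptotics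
  alone decides. Reciprocal Gamma functions keep the resulting identity free of division. Near 0
  convergence has two sources: an energy estimate bounds every solution by each power below 1/2 -
  |Re \<mu>|, and when \<open>Wh\<close> is a polynomial times an elementary factor only one
  exponent occurs and the range is larger. The half plane in the hypothesis on \<open>s\<close> is
  that of the power integral and does not control the Mellin integral, so the conclusion separates
  conditions for integrability from the value under integrability. Where a numerator Gamma factor
  has a pole, the identity does not determine the integral; its value is then reached from the
  right. On the group side, the coordinates of a double coset are not chosen measurably;
  measurability comes from continuous functions of h that recover them.\<close>

locale whittaker_equation =
  fixes k :: real and \<mu> :: complex and w w1 :: "real \<Rightarrow> complex"
  assumes deriv: "x > 0 \<Longrightarrow> (w has_vector_derivative w1 x) (at x)"
    and deriv2: "x > 0 \<Longrightarrow> (w1 has_vector_derivative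
        (1/4 - of_real k / of_real x - (1/4 - \<mu>\<^sup>2) / of_real x ^ 2) * w x) (at x)"
begin

text \<open>The factor exp(-u/2) is the one that the Bessel function contributes to the
  integrand.\<close>

definition mell :: "complex \<Rightarrow> real \<Rightarrow> complex" where
  "mell \<nu> u = of_real u powr (\<nu> - 1) * exp (- (of_real u / 2)) * w u"

lemma continuous_on_w: "continuous_on {0<..} w"
  using deriv by (auto intro!: continuous_at_imp_continuous_on has_vector_derivative_continuous)

lemma continuous_on_mell: "continuous_on {0<..} (mell \<nu>)"
  unfolding mell_def
  by (intro continuous_intros continuous_on_w) (auto simp: complex_nonpos_Reals_iff)

lemma mell_plus: "u > 0 \<Longrightarrow> mell (\<nu> + d) u = of_real u powr d * mell \<nu> u"
  by (simp add: mell_def powr_add[symmetric] algebra_simps flip: powr_add)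

lemma mell_plus_1: "u > 0 \<Longrightarrow> mell (\<nu> + 1) u = of_real u * mell \<nu> u"
  by (simp add: mell_plus)

lemma set_borel_measurable_mell: "A \<in> sets borel \<Longrightarrow> A \<subseteq> {0<..} \<Longrightarrow> set_borel_measurable lborel A (mell \<nu>)"
  using borel_measurable_continuous_on_indicator[OF _ continuous_on_subset[OF continuous_on_mell]]
  by (simp add: set_borel_measurable_def)

abbreviation mell_ok :: "complex \<Rightarrow> bool" where
  "mell_ok \<nu> \<equiv> set_integrable lborel {0<..} (mell \<nu>)"

definition M :: "complex \<Rightarrow> complex" where
  "M \<nu> = (LBINT u:{0<..}. mell \<nu> u)"

text \<open>In the variable \<open>ln u\<close>, the function \<open>cut n\<close> and its derivative vanish at both ends of the interval
  from \<open>- n\<close> to \<open>n\<close>. The partial integrations behind the recursion therefore have no boundary terms, and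
  nothing has to be known about \<open>w\<close> near \<open>0\<close> beyond integrability.\<close>

definition cut :: "nat \<Rightarrow> real \<Rightarrow> real" where
  "cut n y = (1 - y\<^sup>2 / n\<^sup>2)\<^sup>2"
definition cut1 :: "nat \<Rightarrow> real \<Rightarrow> real" where
  "cut1 n y = - 4 * y / n\<^sup>2 * (1 - y\<^sup>2 / n\<^sup>2)"
definition cut2 :: "nat \<Rightarrow> real \<Rightarrow> real" where
  "cut2 n y = 12 * y\<^sup>2 / n^4 - 4 / n\<^sup>2"

lemma cut_deriv: "n > 0 \<Longrightarrow> (cut n has_real_derivative cut1 n y) (at y)"
  unfolding cut_def cut1_def
  by (auto intro!: derivative_eq_intros simp: field_simps power2_eq_square)

lemma cut1_deriv: "n > 0 \<Longrightarrow> (cut1 n has_real_derivative cut2 n y) (at y)"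
  unfolding cut1_def[abs_def] cut2_def
  by (auto intro!: derivative_eq_intros simp: field_simps power2_eq_square eval_nat_numeral)

text \<open>This bound and the two after it are uniform in n; they supply the constants of the
  dominating function in \<open>M_recursion\<close>.\<close>

lemma cut_le:
  assumes "n > 0" "\<bar>y\<bar> \<le> real n"
  shows "\<bar>cut n y\<bar> \<le> 1"
proof -
  have "y\<^sup>2 \<le> (real n)\<^sup>2" using assms abs_le_square_iff[of y "real n"] by simp
  then show ?thesis unfolding cut_def abs_power2 using assms
    by (intro power_le_one) auto
qed

lemma cut1_le:
  assumes "n > 0" "\<bar>y\<bar> \<le> real n"
  shows "\<bar>cut1 n y\<bar> \<le> 4"
proof -
  have a: "y\<^sup>2 \<le> (real n)\<^sup>2" using assms abs_le_square_iff[of y "real n"] by simp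
  have "\<bar>y\<bar> \<le> (real n)\<^sup>2" using assms
    by (metis le_square of_nat_le_iff of_nat_power order_trans power2_eq_square)
  then have "\<bar>- 4 * y / n\<^sup>2\<bar> \<le> 4" using assms by (simp add: abs_mult divide_simps)
  moreover have "\<bar>1 - y\<^sup>2 / n\<^sup>2\<bar> \<le> 1" using a assms by (simp add: abs_le_iff divide_simps)
  ultimately have "\<bar>- 4 * y / n\<^sup>2\<bar> * \<bar>1 - y\<^sup>2 / n\<^sup>2\<bar> \<le> 4 * 1"
    by (intro mult_mono) auto
  then show ?thesis by (simp add: cut1_def abs_mult)
qed

lemma cut2_le:
  assumes "n > 0" "\<bar>y\<bar> \<le> real n"
  shows "\<bar>cut2 n y\<bar> \<le> 16"
proof -
  have a: "y\<^sup>2 \<le> (real n)\<^sup>2" using assms abs_le_square_iff[of y "real n"] by simp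
  have n2: "(real n)\<^sup>2 \<ge> 1" using assms by simp
  have "(real n)\<^sup>2 * 1 \<le> (real n)\<^sup>2 * (real n)\<^sup>2" using n2 by (intro mult_left_mono) auto
  then have "y\<^sup>2 \<le> real n ^ 4" using a by (simp add: power_add[symmetric] eval_nat_numeral)
  then have "0 \<le> 12 * y\<^sup>2 / real n^4 \<and> 12 * y\<^sup>2 / real n^4 \<le> 12" using assms by (auto simp: divide_simps)
  moreover have "0 \<le> 4 / (real n)\<^sup>2 \<and> 4 / (real n)\<^sup>2 \<le> 4" using n2 assms by (auto simp: divide_simps)
  ultimately show ?thesis unfolding cut2_def abs_le_iff of_nat_power by linarith
qed

lemma cut_limits:
  "(\<lambda>n. cut n y) \<longlonglongrightarrow> 1" "(\<lambda>n. cut1 n y) \<longlonglongrightarrow> 0" "(\<lambda>n. cut2 n y) \<longlonglongrightarrow> 0"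
  unfolding cut_def cut1_def cut2_def by real_asymp+

text \<open>This is \<phi> w'' - \<phi>'' w for \<phi>(u) = \<open>cut n (ln u)\<close> u^(\<nu>+1)
  exp(-u/2), with w'' eliminated by the equation. For a constant cut-off 1 it becomes (\<nu> + 1 -
  k) \<open>mell (\<nu> + 1)\<close> - ((\<nu> + 1/2)^2 - \<mu>^2) \<open>mell \<nu>\<close>, whose
  vanishing integral is the recursion.\<close>

definition cut_int :: "complex \<Rightarrow> nat \<Rightarrow> real \<Rightarrow> complex" where
  "cut_int \<nu> n u =
     (of_real (cut n (ln u)) * ((\<nu> + 1 - of_real k) * of_real u - ((\<nu> + 1/2)\<^sup>2 - \<mu>\<^sup>2))
      + of_real (cut1 n (ln u)) * (of_real u - (2 * \<nu> + 1)) - of_real (cut2 n (ln u))) * mell \<nu> u"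

lemma e_deriv:
  assumes "u > 0"
  shows "((\<lambda>u. of_real u powr \<nu> * exp (- (of_real u / 2))) has_vector_derivative
     (\<nu> / of_real u - 1/2) * (of_real u powr \<nu> * exp (- (complex_of_real u / 2)))) (at u)"
proof -
  have "((\<lambda>z. z powr \<nu> * exp (- (z / 2))) has_field_derivative
     (\<nu> / of_real u - 1/2) * (of_real u powr \<nu> * exp (- (complex_of_real u / 2)))) (at (of_real u))"
    using assms
    by (auto intro!: derivative_eq_intros simp: powr_diff field_simps complex_nonpos_Reals_iff)
  then show ?thesis by (rule has_vector_derivative_real_field)
qed

text \<open>The Wronskian \<phi> w' - \<phi>' w with the \<phi> of \<open>cut_int\<close>, written
  out in terms of E = u^\<nu> exp(-u/2). It is therefore a primitive of \<open>cut_int\<close> and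
  vanishes where the cut-off and its derivative do.\<close>

definition prim :: "complex \<Rightarrow> nat \<Rightarrow> real \<Rightarrow> complex" where
  "prim \<nu> n u = (let E = of_real u powr \<nu> * exp (- (of_real u / 2)) in
     of_real (cut n (ln u)) * (of_real u * E * w1 u + (of_real u / 2 - (\<nu> + 1)) * (E * w u))
     - of_real (cut1 n (ln u)) * (E * w u))"

lemma prim_deriv:
  assumes u: "u > 0" and n: "n > 0"
  shows "(prim \<nu> n has_vector_derivative cut_int \<nu> n u) (at u)"
proof -
  define E where "E = (\<lambda>u. of_real u powr \<nu> * exp (- (complex_of_real u / 2)))"
  have E: "(E has_vector_derivative (\<nu> / of_real u - 1/2) * E u) (at u)"
    unfolding E_def using e_deriv[OF u] .
  have c: "((\<lambda>u. complex_of_real (cut n (ln u))) has_vector_derivative of_real (cut1 n (ln u) * (1 / u))) (at u)"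
    "((\<lambda>u. complex_of_real (cut1 n (ln u))) has_vector_derivative of_real (cut2 n (ln u) * (1 / u))) (at u)"
    using u n by (auto intro!: has_vector_derivative_of_real DERIV_chain2[OF cut_deriv]  DERIV_chain2[OF cut1_deriv]
      derivative_eq_intros simp: has_real_derivative_iff_has_vector_derivative[symmetric])
  have r: "(complex_of_real has_vector_derivative 1) (at u)"
    by (auto intro!: derivative_eq_intros)
  have r2: "((\<lambda>u. complex_of_real u / 2 - (\<nu> + 1)) has_vector_derivative 1/2) (at u)"
    by (auto intro!: derivative_eq_intros)
  note d = has_vector_derivative_diff[OF has_vector_derivative_mult[OF c(1)
     has_vector_derivative_add[OF has_vector_derivative_mult[OF has_vector_derivative_mult[OF r E] deriv2[OF u]]
       has_vector_derivative_mult[OF r2 has_vector_derivative_mult[OF E deriv[OF u]]]]]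
     has_vector_derivative_mult[OF c(2) has_vector_derivative_mult[OF E deriv[OF u]]]]
  have "E u = of_real u * (of_real u powr (\<nu> - 1) * exp (- (complex_of_real u / 2)))"
    using u by (simp add: E_def powr_diff)
  then have m: "mell \<nu> u = E u * w u / of_real u" using u by (simp add: mell_def)
  have p: "prim \<nu> n = (\<lambda>u. of_real (cut n (ln u)) * (of_real u * E u * w1 u + (of_real u / 2 - (\<nu> + 1)) * (E u * w u))
     - of_real (cut1 n (ln u)) * (E u * w u))"
    by (simp add: fun_eq_iff prim_def E_def Let_def)
  \<comment> \<open>The analytic quantities become free variables (x for E, y for w, z for w'), so
    that a rational identity in \<open>U\<close> remains.\<close>
  have alg: "a * (U * x * ((1/4 - K / U - (1/4 - \<mu>\<^sup>2) / U\<^sup>2) * y) + (U * ((\<nu> / U - 1/2) * x) + 1 * x) * z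
       + ((U / 2 - (\<nu> + 1)) * (x * z + (\<nu> / U - 1/2) * x * y) + 1/2 * (x * y)))
       + b / U * (U * x * z + (U / 2 - (\<nu> + 1)) * (x * y))
       - (b * (x * z + (\<nu> / U - 1/2) * x * y) + c / U * (x * y))
     = (a * ((\<nu> + 1 - K) * U - ((\<nu> + 1/2)\<^sup>2 - \<mu>\<^sup>2)) + b * (U - (2 * \<nu> + 1)) - c) * (x * y / U)"
    if "U \<noteq> 0" for a b c x y z U K :: complex
    using that by (simp add: divide_simps) algebra
  show ?thesis
    unfolding p
    apply (rule has_vector_derivative_eq_rhs[OF d])
    unfolding cut_int_def m
    apply (subst alg[symmetric])
    using u apply simp
    apply simp
    done
qed

lemma exp_ln_bounds:
  assumes "u \<in> {exp (- real n)..exp (real n)}"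
  shows "u > 0 \<and> \<bar>ln u\<bar> \<le> real n"
proof -
  have u: "u > 0" using assms exp_gt_zero[of "- real n"] by (auto simp del: exp_gt_zero)
  have "exp (- real n) \<le> exp (ln u)" "exp (ln u) \<le> exp (real n)" using assms u by auto
  then show ?thesis using u by (auto simp: abs_le_iff simp del: exp_ln)
qed

lemma integral_cut_int:
  assumes n: "n > 0"
  shows "(LBINT u:{exp (- real n)..exp (real n)}. cut_int \<nu> n u) = 0"
proof -
  have c0: "cut n (real n) = 0" "cut n (- real n) = 0" "cut1 n (real n) = 0" "cut1 n (- real n) = 0"
    using n by (auto simp: cut_def cut1_def)
  have pos: "u > 0" if "u \<in> {exp (- real n)..exp (real n)}" for u
    using that exp_ln_bounds by blast
  have "(LBINT u:{exp (- real n)..exp (real n)}. cut_int \<nu> n u) = prim \<nu> n (exp (real n)) - prim \<nu> n (exp (- real n))"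
    unfolding set_lebesgue_integral_def
  proof (rule integral_FTC_atLeastAtMost)
    fix x assume "exp (- real n) \<le> x" "x \<le> exp (real n)"
    then show "(prim \<nu> n has_vector_derivative cut_int \<nu> n x) (at x within {exp (- real n)..exp (real n)})"
      using prim_deriv[OF pos n] by (auto intro: has_vector_derivative_at_within)
  next
    have "continuous_on {exp (- real n)..exp (real n)} (mell \<nu>)"
      using continuous_on_mell by (rule continuous_on_subset) (use pos in auto)
    moreover have "\<forall>u\<in>{exp (- real n)..exp (real n)}. u \<noteq> 0" using pos by fastforce
    ultimately show "continuous_on {exp (- real n)..exp (real n)} (cut_int \<nu> n)"
      unfolding cut_int_def cut_def cut1_def cut2_def
      by (intro continuous_intros) (use n in auto)
  qed auto
  also have "\<dots> = 0" by (simp add: prim_def c0)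
  finally show ?thesis .
qed

lemma mell_ok_borel: "(\<lambda>u. indicator {0<..} u *\<^sub>R mell \<nu> u) \<in> borel_measurable borel"
  using set_borel_measurable_mell[of "{0<..}" \<nu>] by (simp add: set_borel_measurable_def)

text \<open>Each \<open>cut_int\<close> has integral 0, and as n grows it tends to the combination
  without cut-off. The coefficient of \<open>mell \<nu> u\<close> in it is at most linear in u,
  uniformly in n, so the integrands at \<nu> and \<nu> + 1 dominate.\<close>

lemma M_recursion:
  assumes ok: "mell_ok \<nu>" and ok1: "mell_ok (\<nu> + 1)"
  shows "((\<nu> + 1/2)\<^sup>2 - \<mu>\<^sup>2) * M \<nu> = (\<nu> + 1 - of_real k) * M (\<nu> + 1)"
proof -
  define A where "A = ((\<nu> + 1/2)\<^sup>2 - \<mu>\<^sup>2)"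
  \<comment> \<open>\<open>Suc n\<close> avoids the cut-off of index 0, in whose definition the
    division is by zero.\<close>
  define s where "s = (\<lambda>n u. indicator {exp (- real (Suc n))..exp (real (Suc n))} u *\<^sub>R cut_int \<nu> (Suc n) u)"
  define f where "f = (\<lambda>u. indicator {0<..} u *\<^sub>R ((\<nu> + 1 - of_real k) * mell (\<nu> + 1) u - A * mell \<nu> u))"
  define C1 where "C1 = norm (\<nu> + 1 - of_real k) + 4"
  define C2 where "C2 = norm A + 4 * norm (2 * \<nu> + 1) + 16"
  define W where "W = (\<lambda>u. C1 * norm (indicator {0<..} u *\<^sub>R mell (\<nu> + 1) u) + C2 * norm (indicator {0<..} u *\<^sub>R mell \<nu> u))"
  have "(\<lambda>n. integral\<^sup>L lborel (s n)) \<longlonglongrightarrow> integral\<^sup>L lborel f"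
  proof (rule integral_dominated_convergence[where w = W])
    show "f \<in> borel_measurable lborel" 
      unfolding f_def using mell_ok_borel[of \<nu>] mell_ok_borel[of "\<nu> + 1"]
      by (simp add: scaleR_diff_right flip: mult_scaleR_right) 
    show "integrable lborel W"
      using ok ok1 unfolding W_def set_integrable_def by (intro Bochner_Integration.integrable_add integrable_mult_right integrable_norm) auto
    fix n
    have "s n = (\<lambda>u. indicator {exp (- real (Suc n))..exp (real (Suc n))} u *\<^sub>R
        ((of_real (cut (Suc n) (ln u)) * ((\<nu> + 1 - of_real k) * of_real u - ((\<nu> + 1/2)\<^sup>2 - \<mu>\<^sup>2))
      + of_real (cut1 (Suc n) (ln u)) * (of_real u - (2 * \<nu> + 1)) - of_real (cut2 (Suc n) (ln u))) * (indicator {0<..} u *\<^sub>R mell \<nu> u)))"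
      using exp_ln_bounds[where n = "Suc n"] by (auto simp: s_def cut_int_def fun_eq_iff indicator_def simp del: of_nat_Suc)
    also have "\<dots> \<in> borel_measurable borel"
      unfolding cut_def cut1_def cut2_def using mell_ok_borel[of \<nu>] by measurable
    finally show "s n \<in> borel_measurable lborel" by simp
    show "AE x in lborel. norm (s n x) \<le> W x"
    proof (intro AE_I2)
      fix u
      show "norm (s n u) \<le> W u"
      proof (cases "u \<in> {exp (- real (Suc n))..exp (real (Suc n))}")
        case True
        then have u: "u > 0" and l: "\<bar>ln u\<bar> \<le> real (Suc n)" using exp_ln_bounds by blast+
        define a b c where "a = cut (Suc n) (ln u)" and "b = cut1 (Suc n) (ln u)" and "c = cut2 (Suc n) (ln u)"
        have abc: "\<bar>a\<bar> \<le> 1" "\<bar>b\<bar> \<le> 4" "\<bar>c\<bar> \<le> 16"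
          unfolding a_def b_def c_def using l by (auto intro!: cut_le cut1_le cut2_le)
        have "norm (of_real a * ((\<nu> + 1 - of_real k) * of_real u - A) + of_real b * (of_real u - (2 * \<nu> + 1)) - of_real c)
          \<le> \<bar>a\<bar> * (norm (\<nu> + 1 - of_real k) * u + norm A) + \<bar>b\<bar> * (u + norm (2 * \<nu> + 1)) + \<bar>c\<bar>"
          using u by (intro norm_triangle_le_diff norm_triangle_le add_mono)
           (auto simp: norm_mult intro!: mult_left_mono norm_triangle_le_diff)
        also have "\<dots> \<le> 1 * (norm (\<nu> + 1 - of_real k) * u + norm A) + 4 * (u + norm (2 * \<nu> + 1)) + 16"
          using u abc by (intro add_mono mult_right_mono) auto
        also have "\<dots> = C1 * u + C2" by (simp add: C1_def C2_def algebra_simps)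
        finally have "norm (of_real a * ((\<nu> + 1 - of_real k) * of_real u - A) + of_real b * (of_real u - (2 * \<nu> + 1)) - of_real c) * norm (mell \<nu> u)
           \<le> (C1 * u + C2) * norm (mell \<nu> u)" by (rule mult_right_mono) auto
        also have "(C1 * u + C2) * norm (mell \<nu> u) = W u"
          using u by (simp add: W_def mell_plus_1 norm_mult ring_distribs)
        finally show ?thesis using True
          by (simp only: s_def cut_int_def A_def a_def b_def c_def norm_mult indicator_simps scaleR_one)
      qed (auto simp: s_def W_def C1_def C2_def)
    qed
    show "AE x in lborel. (\<lambda>n. s n x) \<longlonglongrightarrow> f x"
    proof (intro AE_I2)
      fix u :: real
      show "(\<lambda>n. s n u) \<longlonglongrightarrow> f u"
      proof (cases "u > 0")
        case False
        then have "s n u = 0" for n using exp_ln_bounds[of u "Suc n"] by (auto simp: s_def indicator_def)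
        then show ?thesis using False by (simp add: f_def)
      next
        case True
        have "eventually (\<lambda>n. real n \<ge> \<bar>ln u\<bar>) sequentially" by real_asymp
        then have "eventually (\<lambda>n. cut_int \<nu> (Suc n) u = s n u) sequentially"
        proof eventually_elim
          case (elim n)
          then have "exp (- real (Suc n)) \<le> exp (ln u)" "exp (ln u) \<le> exp (real (Suc n))" by auto
          then show ?case using True by (simp add: s_def del: exp_le_cancel_iff)
        qed
        moreover have "(\<lambda>n. cut_int \<nu> (Suc n) u) \<longlonglongrightarrow>
          (of_real 1 * ((\<nu> + 1 - of_real k) * of_real u - ((\<nu> + 1/2)\<^sup>2 - \<mu>\<^sup>2))
      + of_real 0 * (of_real u - (2 * \<nu> + 1)) - of_real 0) * mell \<nu> u"
          unfolding cut_int_def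
          by (intro tendsto_intros LIMSEQ_Suc[OF cut_limits(1)] LIMSEQ_Suc[OF cut_limits(2)] LIMSEQ_Suc[OF cut_limits(3)])
        moreover have "(of_real 1 * ((\<nu> + 1 - of_real k) * of_real u - ((\<nu> + 1/2)\<^sup>2 - \<mu>\<^sup>2))
      + of_real 0 * (of_real u - (2 * \<nu> + 1)) - of_real 0) * mell \<nu> u = f u"
          unfolding f_def A_def using True mell_plus_1[OF True, of \<nu>] by (simp add: left_diff_distrib)
        ultimately show ?thesis
          by (auto intro: Lim_transform_eventually)
      qed
    qed
  qed
  moreover have "integral\<^sup>L lborel (s n) = 0" for n
    using integral_cut_int[of "Suc n" \<nu>] by (simp add: s_def set_lebesgue_integral_def)
  ultimately have "integral\<^sup>L lborel f = 0" by (simp add: LIMSEQ_const_iff)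
  moreover have "integral\<^sup>L lborel f = (\<nu> + 1 - of_real k) * M (\<nu> + 1) - A * M \<nu>"
    using ok ok1 unfolding f_def M_def set_lebesgue_integral_def[symmetric]
    by simp
  ultimately show ?thesis by (simp add: A_def)
qed

end

section \<open>Gamma under integer shifts and Euler's integral\<close>

lemma Gamma_Suc_asymp:
  fixes z :: complex
  shows "(\<lambda>n. Gamma (z + of_nat (Suc n)) / (fact n * of_nat n powr z)) \<longlonglongrightarrow> 1"
proof -
  \<comment> \<open>In the right half plane the claim is Gauss's limit for the reciprocal Gamma
    function, with the Pochhammer symbol rewritten as a quotient of Gamma values.\<close>
  have pos: "(\<lambda>n. Gamma (z + of_nat (Suc n)) / (fact n * of_nat n powr z)) \<longlonglongrightarrow> 1" if "Re z > 0" for z :: complex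
  proof -
    have nz: "z \<notin> \<int>\<^sub>\<le>\<^sub>0" using that by (auto elim!: nonpos_Ints_cases)
    then have g: "Gamma z \<noteq> 0" by (simp add: Gamma_eq_zero_iff)
    have "(\<lambda>n. Gamma z * rGamma_series z n) \<longlonglongrightarrow> Gamma z * rGamma z"
      by (intro tendsto_intros)
    also have "Gamma z * rGamma z = 1" using g by (simp add: rGamma_inverse_Gamma)
    finally have "(\<lambda>n. Gamma z * rGamma_series z n) \<longlonglongrightarrow> 1" .
    moreover have "eventually (\<lambda>n. Gamma z * rGamma_series z n = Gamma (z + of_nat (Suc n)) / (fact n * of_nat n powr z)) sequentially"
      using eventually_gt_at_top[of 0]
    proof eventually_elim
      case (elim n)
      have "of_nat n powr z = exp (z * of_real (ln (of_nat n)))"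
        using elim by (simp add: powr_def Ln_of_nat)
      moreover have "pochhammer z (Suc n) = Gamma (z + of_nat (Suc n)) / Gamma z"
        using nz by (rule pochhammer_Gamma)
      ultimately show ?case using g by (simp add: rGamma_series_def)
    qed
    ultimately show ?thesis by (rule Lim_transform_eventually)
  qed
  \<comment> \<open>The half plane is moved to the left by one unit at a time, by Gamma(y + 1) = y
    Gamma(y) and because n / (z + 1 + n) tends to 1. Poles cause no trouble, since y has positive
    real part for large n.\<close>
  have "Re (z + of_nat m) > 0 \<Longrightarrow> (\<lambda>n. Gamma (z + of_nat (Suc n)) / (fact n * of_nat n powr z)) \<longlonglongrightarrow> 1" for m
  proof (induction m arbitrary: z)
    case 0 then show ?case using pos by simp
  next
    case (Suc m)
    have *: "(\<lambda>n. Gamma (z + 1 + of_nat (Suc n)) / (fact n * of_nat n powr (z + 1))) \<longlonglongrightarrow> 1"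
      by (rule Suc.IH) (use Suc.prems in \<open>simp add: algebra_simps\<close>)
    have "(\<lambda>n. of_nat n / (z + 1 + of_nat n)) \<longlonglongrightarrow> 1"
    proof -
      have "(\<lambda>n. 1 / ((z + 1) * (1 / of_nat n) + 1)) \<longlonglongrightarrow> 1 / ((z + 1) * 0 + 1)"
        by (intro tendsto_intros lim_1_over_n) auto
      then have "(\<lambda>n. 1 / ((z + 1) * (1 / of_nat n) + 1)) \<longlonglongrightarrow> 1" by simp
      moreover have "eventually (\<lambda>n. 1 / ((z + 1) * (1 / of_nat n) + 1) = of_nat n / (z + 1 + of_nat n)) sequentially"
        using eventually_gt_at_top[of 0] by eventually_elim (simp add: divide_simps add_ac)
      ultimately show ?thesis by (rule Lim_transform_eventually)
    qed
    from tendsto_mult[OF * this]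
    have "(\<lambda>n. Gamma (z + 1 + of_nat (Suc n)) / (fact n * of_nat n powr (z + 1)) * (of_nat n / (z + 1 + of_nat n))) \<longlonglongrightarrow> 1"
      by simp
    moreover have "eventually (\<lambda>n. Re (z + 1 + of_nat n) > 0) sequentially"
      by simp real_asymp
    then have "eventually (\<lambda>n. Gamma (z + 1 + of_nat (Suc n)) / (fact n * of_nat n powr (z + 1)) * (of_nat n / (z + 1 + of_nat n))
        = Gamma (z + of_nat (Suc n)) / (fact n * of_nat n powr z)) sequentially"
      using eventually_gt_at_top[of 0]
    proof eventually_elim
      case (elim n)
      define y where "y = z + of_nat (Suc n)"
      have "Re y > 0" using elim(1) by (simp add: y_def add_ac)
      then have y: "y \<notin> \<int>\<^sub>\<le>\<^sub>0" "y \<noteq> 0" by (auto elim!: nonpos_Ints_cases)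
      have e: "z + 1 + of_nat (Suc n) = y + 1" "z + 1 + of_nat n = y" by (simp_all add: y_def)
      have "Gamma (y + 1) = y * Gamma y" using y by (simp add: Gamma_plus1)
      then show ?case using elim y unfolding e y_def[symmetric] by (simp add: powr_add)
    qed
    ultimately show ?case by (rule Lim_transform_eventually)
  qed
  moreover obtain m :: nat where "- Re z < real m" using reals_Archimedean2 by blast
  then have "Re (z + of_nat m) > 0" by simp
  ultimately show ?thesis by simp
qed

text \<open>The Gamma integral is first obtained for the completion of \<open>lborel\<close>. The
  integrand is continuous on the open half line, hence Borel, and so integrability descends to
  \<open>lborel\<close>.\<close>

lemma powr_exp_integrable:
  assumes "Re z > 0"
  shows "set_integrable lborel {0<..} (\<lambda>t. complex_of_real t powr (z - 1) * exp (- of_real t))"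
    "(LBINT t:{0<..}. complex_of_real t powr (z - 1) * exp (- of_real t)) = Gamma z"
proof -
  let ?f = "\<lambda>t. complex_of_real t powr (z - 1) / of_real (exp t)"
  have eq: "?f = (\<lambda>t. complex_of_real t powr (z - 1) * exp (- of_real t))"
    by (simp add: fun_eq_iff exp_minus divide_inverse exp_of_real of_real_inverse)
  have c: "continuous_on {0<..} ?f"
    by (intro continuous_intros) (auto simp: complex_nonpos_Reals_iff)
  have "integrable (completion lborel) (\<lambda>t. indicator {0<..} t *\<^sub>R ?f t)"
    using absolutely_integrable_Gamma_integral'[OF assms] by (simp add: set_integrable_def)
  moreover have "(\<lambda>t. indicator {0<..} t *\<^sub>R ?f t) \<in> borel_measurable lborel"
    using borel_measurable_continuous_on_indicator[OF _ c] by simp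
  ultimately have i: "set_integrable lborel {0<..} ?f"
    by (simp add: integrable_completion set_integrable_def)
  then show "set_integrable lborel {0<..} (\<lambda>t. complex_of_real t powr (z - 1) * exp (- of_real t))"
    by (simp add: eq)
  have "(LBINT t:{0<..}. ?f t) = Gamma z"
    using set_borel_integral_eq_integral(2)[OF i] Gamma_integral_complex'[OF assms]
    by (simp add: integral_unique)
  then show "(LBINT t:{0<..}. complex_of_real t powr (z - 1) * exp (- of_real t)) = Gamma z"
    by (simp add: eq)
qed

lemma integrable_of_real_iff:
  "integrable L (\<lambda>x. complex_of_real (f x)) \<longleftrightarrow> integrable L f"
  using integrable_Re[of L "\<lambda>x. complex_of_real (f x)"] integrable_of_real[of L f] by auto

lemma powr_exp_integrable_real:
  assumes "x > 0"
  shows "set_integrable lborel {0<..} (\<lambda>t. t powr (x - 1) * exp (- t) :: real)"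
    "(LBINT t:{0<..}. t powr (x - 1) * exp (- t)) = Gamma x"
proof -
  have eq: "indicator {0<..} t *\<^sub>R (complex_of_real t powr (of_real x - 1) * exp (- of_real t)) =
      of_real (indicator {0<..} t *\<^sub>R (t powr (x - 1) * exp (- t)))" for t
    by (auto simp: indicator_def powr_of_real[symmetric] exp_of_real[symmetric])
  have x: "Re (of_real x) > 0" using assms by simp
  show "set_integrable lborel {0<..} (\<lambda>t. t powr (x - 1) * exp (- t) :: real)"
    using powr_exp_integrable(1)[OF x] unfolding set_integrable_def eq by (simp only: integrable_of_real_iff)
  have "complex_of_real (LBINT t:{0<..}. t powr (x - 1) * exp (- t)) = of_real (Gamma x)"
    using powr_exp_integrable(2)[OF x] unfolding set_lebesgue_integral_def eq
    by (simp only: integral_complex_of_real Gamma_complex_of_real)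
  then show "(LBINT t:{0<..}. t powr (x - 1) * exp (- t)) = Gamma x" by (simp only: of_real_eq_iff)
qed

text \<open>The factor 2 splits the term into (2T)^n / n!, a term of an exponential series, and
  (1/2)^n / n^c, where the geometric decay beats any power of n.\<close>

lemma power_over_fact_powr_tendsto_0:
  fixes T c :: real
  assumes "T > 0"
  shows "(\<lambda>n. T ^ n / (fact n * real n powr c)) \<longlonglongrightarrow> 0"
proof -
  have "(\<lambda>n. (2 * T) ^ n / fact n) \<longlonglongrightarrow> 0"
    using summable_LIMSEQ_zero[OF summable_exp[of "2 * T"]] by (simp add: divide_inverse mult.commute)
  moreover have "(\<lambda>n. (1/2) ^ n / real n powr c) \<longlonglongrightarrow> 0" by real_asymp
  ultimately have "(\<lambda>n. (2 * T) ^ n / fact n * ((1/2) ^ n / real n powr c)) \<longlonglongrightarrow> 0 * 0" by (rule tendsto_mult)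
  moreover have "(2 * T) ^ n / fact n * ((1/2) ^ n / real n powr c) = T ^ n / (fact n * real n powr c)" for n
  proof -
    have "(2 * T) ^ n * (1/2) ^ n = (2 * T * (1/2)) ^ n" by (rule power_mult_distrib[symmetric])
    also have "2 * T * (1/2) = T" by simp
    finally show ?thesis by (simp only: times_divide_times_eq)
  qed
  ultimately show ?thesis by (simp only: mult_zero_left)
qed

locale whittaker_W = whittaker_equation +
  assumes asymp: "((\<lambda>x. w x / (exp (- of_real x / 2) * of_real x powr of_real k)) \<longlongrightarrow> 1) at_top"
begin

lemma asymp_bound:
  assumes "\<epsilon> > 0"
  shows "eventually (\<lambda>x. norm (w x - exp (- of_real x / 2) * of_real x powr of_real k) \<le> \<epsilon> * (exp (- x / 2) * x powr k)) at_top"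
  using tendstoD[OF asymp assms] eventually_gt_at_top[of 0]
proof eventually_elim
  case (elim x)
  define E where "E = exp (- complex_of_real x / 2) * of_real x powr of_real k"
  have nE: "norm E = exp (- x / 2) * x powr k" "E \<noteq> 0"
    using elim by (auto simp: E_def norm_mult norm_powr_real_powr)
  have "w x - E = (w x / E - 1) * E" using nE(2) by (simp add: field_simps)
  then have "norm (w x - E) = norm (w x / E - 1) * norm E" by (simp add: norm_mult)
  also have "\<dots> \<le> \<epsilon> * norm E" using elim(1) by (intro mult_right_mono) (auto simp: E_def dist_norm)
  finally show ?case unfolding nE(1) by (simp add: E_def)
qed

lemma norm_mell: "u > 0 \<Longrightarrow> norm (mell \<nu> u) = u powr (Re \<nu> - 1) * exp (- u / 2) * norm (w u)"
  by (simp add: mell_def norm_mult norm_powr_real_powr)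

lemma mell_bound_top:
  "\<exists>T>1. \<forall>u\<ge>T. norm (mell \<nu> u) \<le> 2 * (u powr (Re \<nu> + k - 1) * exp (- u))"
proof -
  obtain T where T: "\<forall>u\<ge>T. u > 1 \<and> norm (w u - exp (- of_real u / 2) * of_real u powr of_real k) \<le> 1 * (exp (- u / 2) * u powr k)"
    using eventually_conj[OF eventually_gt_at_top[of "1::real"] asymp_bound[of 1]]
    by (auto simp: eventually_at_top_linorder)
  show ?thesis
  proof (intro exI[of _ T] conjI allI impI)
    show "T > 1" using T by auto
    fix u assume "u \<ge> T"
    then have u: "u > 1" and b: "norm (w u - exp (- of_real u / 2) * of_real u powr of_real k) \<le> 1 * (exp (- u / 2) * u powr k)"
      using T by auto
    have "norm (w u) \<le> norm (w u - exp (- of_real u / 2) * of_real u powr of_real k) + norm (exp (- complex_of_real u / 2) * of_real u powr of_real k)"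
      using norm_triangle_ineq[of "w u - exp (- of_real u / 2) * of_real u powr of_real k" "exp (- of_real u / 2) * of_real u powr of_real k"] by simp
    also have "norm (exp (- complex_of_real u / 2) * of_real u powr of_real k) = exp (- u / 2) * u powr k"
      using u by (simp add: norm_mult norm_powr_real_powr)
    finally have "norm (w u) \<le> 2 * (exp (- u / 2) * u powr k)" using b by simp
    then have "norm (mell \<nu> u) \<le> u powr (Re \<nu> - 1) * exp (- u / 2) * (2 * (exp (- u / 2) * u powr k))"
      using u by (subst norm_mell) (auto intro!: mult_left_mono)
    also have "\<dots> = 2 * (u powr (Re \<nu> + k - 1) * exp (- u))"
      using u by (simp add: powr_add powr_diff exp_add[symmetric] mult_ac flip: exp_add)
    finally show "norm (mell \<nu> u) \<le> 2 * (u powr (Re \<nu> + k - 1) * exp (- u))" .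
  qed
qed

lemma mell_integrable_top: "\<exists>T>1. set_integrable lborel {T..} (mell \<nu>)"
proof -
  obtain T where T: "T > 1" "\<And>u. u \<ge> T \<Longrightarrow> norm (mell \<nu> u) \<le> 2 * (u powr (Re \<nu> + k - 1) * exp (- u))"
    using mell_bound_top by blast
  \<comment> \<open>Raising the exponent to at least 1 makes the comparison integrand integrable at
    0 as well, and on u > 1 it only enlarges it.\<close>
  define z where "z = max 1 (Re \<nu> + k)"
  have "set_integrable lborel {0<..} (\<lambda>t. 2 * (complex_of_real t powr (of_real z - 1) * exp (- of_real t)))"
    by (intro set_integrable_mult_right powr_exp_integrable(1)) (simp add: z_def)
  then have *: "set_integrable lborel {T..} (\<lambda>t. 2 * (complex_of_real t powr (of_real z - 1) * exp (- of_real t)))"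
    by (rule set_integrable_subset) (use T in auto)
  have "set_integrable lborel {T..} (mell \<nu>)"
  proof (rule set_integrable_bound[OF * set_borel_measurable_mell])
    show "AE x in lborel. x \<in> {T..} \<longrightarrow> norm (mell \<nu> x) \<le> norm (2 * (complex_of_real x powr (of_real z - 1) * exp (- of_real x)))"
    proof (intro AE_I2 impI)
      fix u assume "u \<in> {T..}"
      then have u: "u \<ge> T" "u > 1" using T by auto
      have "norm (mell \<nu> u) \<le> 2 * (u powr (Re \<nu> + k - 1) * exp (- u))" using T u by blast
      also have "\<dots> \<le> 2 * (u powr (z - 1) * exp (- u))"
        using u by (intro mult_left_mono mult_right_mono powr_mono) (auto simp: z_def)
      also have "\<dots> = norm (2 * (complex_of_real u powr (of_real z - 1) * exp (- of_real u)))"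
        using u by (simp add: norm_mult norm_powr_real_powr)
      finally show "norm (mell \<nu> u) \<le> norm (2 * (complex_of_real u powr (of_real z - 1) * exp (- of_real u)))" .
    qed
  qed (use T in auto)
  with T show ?thesis by blast
qed

lemma mell_ok_near_0:
  assumes "\<And>T. T > 1 \<Longrightarrow> set_integrable lborel {0<..T} (mell \<nu>)"
  shows "mell_ok \<nu>"
proof -
  obtain T where T: "T > 1" "set_integrable lborel {T..} (mell \<nu>)" using mell_integrable_top by blast
  have "set_integrable lborel ({0<..T} \<union> {T..}) (mell \<nu>)"
    using T assms by (intro set_integrable_Un) auto
  moreover have "{0<..T} \<union> {T..} = {0<..}" using T by auto
  ultimately show ?thesis by simp
qed

text \<open>Only the behaviour near 0 can obstruct integrability, and on (0, T] a larger real part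
  of the exponent costs no more than a constant factor.\<close>

lemma mell_ok_mono:
  assumes ok: "mell_ok \<nu>" and le: "Re \<nu> \<le> Re \<nu>'"
  shows "mell_ok \<nu>'"
proof (rule mell_ok_near_0)
  fix T :: real assume T: "T > 1"
  have "set_integrable lborel {0<..T} (mell \<nu>)"
    using ok by (rule set_integrable_subset) auto
  then have "set_integrable lborel {0<..T} (\<lambda>u. of_real (T powr (Re \<nu>' - Re \<nu>)) * mell \<nu> u)"
    by (rule set_integrable_mult_right)
  then show "set_integrable lborel {0<..T} (mell \<nu>')"
  proof (rule set_integrable_bound[OF _ set_borel_measurable_mell])
    show "AE x in lborel. x \<in> {0<..T} \<longrightarrow> norm (mell \<nu>' x) \<le> norm (of_real (T powr (Re \<nu>' - Re \<nu>)) * mell \<nu> x)"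
    proof (intro AE_I2 impI)
      fix u assume u: "u \<in> {0<..T}"
      have "mell \<nu>' u = of_real u powr (\<nu>' - \<nu>) * mell \<nu> u" using mell_plus[of u \<nu> "\<nu>' - \<nu>"] u by simp
      then have "norm (mell \<nu>' u) = u powr (Re \<nu>' - Re \<nu>) * norm (mell \<nu> u)"
        using u by (simp add: norm_mult norm_powr_real_powr)
      also have "\<dots> \<le> T powr (Re \<nu>' - Re \<nu>) * norm (mell \<nu> u)"
        using u le by (intro mult_right_mono powr_mono2) auto
      finally show "norm (mell \<nu>' u) \<le> norm (of_real (T powr (Re \<nu>' - Re \<nu>)) * mell \<nu> u)" by (simp add: norm_mult)
    qed
  qed auto
qed

lemma M_pochhammer:
  assumes ok: "mell_ok \<nu>"
  shows "pochhammer (\<nu> + 1/2 + \<mu>) n * pochhammer (\<nu> + 1/2 - \<mu>) n * M \<nu> = pochhammer (\<nu> + 1 - of_real k) n * M (\<nu> + of_nat n)"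
proof (induction n)
  case (Suc n)
  have "(((\<nu> + of_nat n) + 1/2)\<^sup>2 - \<mu>\<^sup>2) * M (\<nu> + of_nat n) = ((\<nu> + of_nat n) + 1 - of_real k) * M ((\<nu> + of_nat n) + 1)"
    by (rule M_recursion) (auto intro: mell_ok_mono[OF ok])
  then have "(\<nu> + 1/2 + \<mu> + of_nat n) * (\<nu> + 1/2 - \<mu> + of_nat n) * M (\<nu> + of_nat n) = (\<nu> + 1 - of_real k + of_nat n) * M (\<nu> + of_nat (Suc n))"
    by (simp add: power2_eq_square algebra_simps)
  note step = this
  have "pochhammer (\<nu> + 1/2 + \<mu>) (Suc n) * pochhammer (\<nu> + 1/2 - \<mu>) (Suc n) * M \<nu>
     = (\<nu> + 1/2 + \<mu> + of_nat n) * (\<nu> + 1/2 - \<mu> + of_nat n) * (pochhammer (\<nu> + 1/2 + \<mu>) n * pochhammer (\<nu> + 1/2 - \<mu>) n * M \<nu>)"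
    by (simp add: pochhammer_Suc mult_ac)
  also have "\<dots> = pochhammer (\<nu> + 1 - of_real k) n * ((\<nu> + 1/2 + \<mu> + of_nat n) * (\<nu> + 1/2 - \<mu> + of_nat n) * M (\<nu> + of_nat n))"
    unfolding Suc by (simp add: mult_ac)
  also have "\<dots> = pochhammer (\<nu> + 1 - of_real k) (Suc n) * M (\<nu> + of_nat (Suc n))"
    unfolding step by (simp add: pochhammer_Suc mult_ac)
  finally show ?case .
qed auto

text \<open>Replacing w by exp(-u/2) u^k turns the integral into Gamma(\<nu> + k + n + 1). The error
  is split at T: beyond T it is at most \<epsilon> times the Gamma integrand, and below T it grows
  no faster than T^n, which is negligible against n! n^(\<nu>+k).\<close>

lemma M_asymp:
  assumes ok: "mell_ok \<nu>"
  shows "(\<lambda>n. M (\<nu> + of_nat (Suc n)) / (fact n * of_nat n powr (\<nu> + of_real k))) \<longlonglongrightarrow> 1"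
proof -
  define a where "a = Re \<nu>"
  define g where "g = (\<lambda>n u. complex_of_real u powr (\<nu> + of_real k + of_nat (Suc n) - 1) * exp (- of_real u))"
  define d where "d = (\<lambda>n u. mell (\<nu> + of_nat (Suc n)) u - g n u)"
  define G where "G = (\<lambda>n. Gamma (\<nu> + of_real k + of_nat (Suc n)))"
  define q where "q = (\<lambda>n. fact n * complex_of_nat n powr (\<nu> + of_real k))"
  \<comment> \<open>From \<open>n0\<close> on the Gamma integral converges at 0; below
    \<open>T\<close> the error of index n is compared with that of index \<open>n0\<close>.\<close>
  obtain n0 :: nat where n0: "real n0 > - (a + k)" using reals_Archimedean2 by blast
  have gi: "set_integrable lborel {0<..} (g n)" "(LBINT u:{0<..}. g n u) = G n" if "n \<ge> n0" for n
  proof -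
    have "real n \<ge> real n0" using that by simp
    then have "Re (\<nu> + of_real k + of_nat (Suc n)) > 0" using n0 by (simp add: a_def)
    from powr_exp_integrable[OF this] show "set_integrable lborel {0<..} (g n)" "(LBINT u:{0<..}. g n u) = G n"
      by (simp_all add: g_def G_def)
  qed
  have mi: "mell_ok (\<nu> + of_nat (Suc n))" for n
    by (rule mell_ok_mono[OF ok]) simp
  have di: "set_integrable lborel {0<..} (d n)" "(LBINT u:{0<..}. d n u) = M (\<nu> + of_nat (Suc n)) - G n" if "n \<ge> n0" for n
    unfolding d_def M_def gi(2)[OF that, symmetric] by (rule set_integral_diff[OF mi gi(1)[OF that]])+
  have nd: "norm (d n u) = u powr (a + n) * exp (- u / 2) * norm (w u - exp (- of_real u / 2) * of_real u powr of_real k)" if "u > 0" for n u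
  proof -
    have e: "exp (- complex_of_real u) = exp (- (of_real u / 2)) * exp (- (of_real u / 2))"
      by (simp add: mult_exp_exp)
    have p: "complex_of_real u powr (\<nu> + of_real k + of_nat (Suc n) - 1) = of_real u powr (\<nu> + of_nat n) * of_real u powr of_real k"
    proof -
      have "\<nu> + of_real k + of_nat (Suc n) - 1 = (\<nu> + of_nat n) + of_real k" by simp
      then show ?thesis by (simp only: powr_add)
    qed
    have p1: "\<nu> + of_nat (Suc n) - 1 = \<nu> + of_nat n" by simp
    have "d n u = of_real u powr (\<nu> + of_nat n) * exp (- (of_real u / 2)) * (w u - exp (- (of_real u / 2)) * of_real u powr of_real k)"
      unfolding d_def g_def mell_def p p1 e by (simp only: right_diff_distrib mult_ac)
    then show ?thesis using that by (simp add: norm_mult norm_powr_real_powr a_def)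
  qed
  have nq: "norm (q n) = fact n * real n powr (a + k)" if "n > 0" for n
    using norm_powr_real_powr[of "complex_of_nat n" "\<nu> + of_real k"] by (simp add: q_def norm_mult a_def)
  have diff: "(\<lambda>n. (M (\<nu> + of_nat (Suc n)) - G n) / q n) \<longlonglongrightarrow> 0"
  proof (rule tendstoI)
    fix e :: real assume e: "e > 0"
    \<comment> \<open>Half of \<open>e\<close> is enough: the tail contributes \<epsilon> times a
      quotient that tends to 1, and the rest tends to 0.\<close>
    define \<epsilon> where "\<epsilon> = e / 2"
    have eps: "\<epsilon> > 0" using e by (simp add: \<epsilon>_def)
    obtain T where T: "T > 1" "\<forall>u\<ge>T. norm (w u - exp (- of_real u / 2) * of_real u powr of_real k) \<le> \<epsilon> * (exp (- u / 2) * u powr k)"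
      using eventually_conj[OF eventually_gt_at_top[of "1::real"] asymp_bound[OF eps]]
      by (auto simp: eventually_at_top_linorder)
    define C where "C = (LBINT u:{0<..}. norm (d n0 u))"
    have bound: "norm (M (\<nu> + of_nat (Suc n)) - G n) \<le> T ^ (n - n0) * C + \<epsilon> * Gamma (a + k + Suc n)" if n: "n \<ge> n0" for n
    proof -
      have pos: "a + k + Suc n > 0" using n0 n by linarith
      have i1: "set_integrable lborel {0<..} (\<lambda>u. T ^ (n - n0) * norm (d n0 u))"
        using di(1)[of n0] by (auto intro: set_integrable_norm)
      have i2: "set_integrable lborel {0<..} (\<lambda>u. \<epsilon> * (u powr (a + k + Suc n - 1) * exp (- u)))"
        by (intro set_integrable_mult_right powr_exp_integrable_real(1) pos)
      have "norm (M (\<nu> + of_nat (Suc n)) - G n) \<le> (LBINT u:{0<..}. norm (d n u))"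
        unfolding di(2)[OF n, symmetric] using di(1)[OF n] by (rule set_integral_norm_bound)
      also have "\<dots> \<le> (LBINT u:{0<..}. T ^ (n - n0) * norm (d n0 u) + \<epsilon> * (u powr (a + k + Suc n - 1) * exp (- u)))"
      proof (rule set_integral_mono)
        show "set_integrable lborel {0<..} (\<lambda>u. norm (d n u))" using di(1)[OF n] by (rule set_integrable_norm)
        show "set_integrable lborel {0<..} (\<lambda>u. T ^ (n - n0) * norm (d n0 u) + \<epsilon> * (u powr (a + k + Suc n - 1) * exp (- u)))"
          using i1 i2 by (rule set_integral_add)
        fix u :: real assume "u \<in> {0<..}"
        then have u: "u > 0" by simp
        show "norm (d n u) \<le> T ^ (n - n0) * norm (d n0 u) + \<epsilon> * (u powr (a + k + Suc n - 1) * exp (- u))"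
        proof (cases "u \<ge> T")
          case True
          have "norm (d n u) \<le> u powr (a + n) * exp (- u / 2) * (\<epsilon> * (exp (- u / 2) * u powr k))"
            unfolding nd[OF u] using T True by (intro mult_left_mono) auto
          also have "u powr (a + n) * exp (- u / 2) * (\<epsilon> * (exp (- u / 2) * u powr k)) =
             \<epsilon> * ((u powr (a + n) * u powr k) * (exp (- u / 2) * exp (- u / 2)))"
            by (simp only: mult_ac)
          also have "u powr (a + n) * u powr k = u powr (a + k + Suc n - 1)"
            by (simp add: powr_add[symmetric] add_ac)
          also have "exp (- u / 2) * exp (- u / 2) = exp (- u)"
            by (simp add: exp_add[symmetric])
          finally show ?thesis using T by (simp add: add_increasing)
        next
          case False
          have "u powr (a + n) = u powr (real (n - n0)) * u powr (a + n0)"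
            using n by (simp add: powr_add[symmetric] of_nat_diff add.commute)
          then have "norm (d n u) = u powr (real (n - n0)) * norm (d n0 u)"
            unfolding nd[OF u] by simp
          also have "u powr (real (n - n0)) = u ^ (n - n0)" using u by (rule powr_realpow)
          also have "\<dots> * norm (d n0 u) \<le> T ^ (n - n0) * norm (d n0 u)"
            using u False by (intro mult_right_mono power_mono) auto
          finally show ?thesis using eps by (simp add: add_increasing2)
        qed
      qed
      also have "\<dots> = T ^ (n - n0) * C + \<epsilon> * Gamma (a + k + Suc n)"
        using i1 i2 powr_exp_integrable_real[OF pos] by (subst set_integral_add) (auto simp: C_def)
      finally show ?thesis .
    qed
    have "(\<lambda>n. norm (Gamma (of_real (a + k) + of_nat (Suc n)) / (fact n * of_nat n powr complex_of_real (a + k)))) \<longlonglongrightarrow> norm (1::complex)"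
      by (intro tendsto_norm Gamma_Suc_asymp)
    moreover have "eventually (\<lambda>n. norm (Gamma (of_real (a + k) + of_nat (Suc n)) / (fact n * of_nat n powr complex_of_real (a + k)))
        = Gamma (a + k + Suc n) / (fact n * real n powr (a + k))) sequentially"
      using eventually_gt_at_top[of n0] 
    proof eventually_elim
      case (elim n)
      have "a + k + Suc n > 0" using elim n0 by linarith
      then have "Gamma (a + k + Suc n) > 0" by (rule Gamma_real_pos)
      moreover have "Gamma (of_real (a + k) + of_nat (Suc n)) = complex_of_real (Gamma (a + k + Suc n))"
        unfolding Gamma_complex_of_real[symmetric] by simp
      moreover have "norm (of_nat n powr complex_of_real (a + k)) = real n powr (a + k)"
        using elim norm_powr_real_powr[of "complex_of_nat n" "complex_of_real (a + k)"] by simp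
      ultimately show ?case by (simp only: norm_divide norm_mult norm_of_real norm_fact)
    qed
    ultimately have L2: "(\<lambda>n. Gamma (a + k + Suc n) / (fact n * real n powr (a + k))) \<longlonglongrightarrow> 1"
      unfolding norm_one by (rule Lim_transform_eventually)
    have L1: "(\<lambda>n. (C / T ^ n0) * (T ^ n / (fact n * real n powr (a + k)))) \<longlonglongrightarrow> (C / T ^ n0) * 0"
      using T by (intro tendsto_mult tendsto_const power_over_fact_powr_tendsto_0) auto
    have "(\<lambda>n. (C / T ^ n0) * (T ^ n / (fact n * real n powr (a + k))) + \<epsilon> * (Gamma (a + k + Suc n) / (fact n * real n powr (a + k)))) \<longlonglongrightarrow> (C / T ^ n0) * 0 + \<epsilon> * 1"
      by (intro tendsto_add tendsto_mult tendsto_const L1 L2)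
    then have "eventually (\<lambda>n. (C / T ^ n0) * (T ^ n / (fact n * real n powr (a + k))) + \<epsilon> * (Gamma (a + k + Suc n) / (fact n * real n powr (a + k))) < e) sequentially"
      by (rule order_tendstoD) (use e in \<open>simp add: \<epsilon>_def\<close>)
    then show "eventually (\<lambda>n. dist ((M (\<nu> + of_nat (Suc n)) - G n) / q n) 0 < e) sequentially"
      using eventually_gt_at_top[of n0]
    proof eventually_elim
      case (elim n)
      have "norm ((M (\<nu> + of_nat (Suc n)) - G n) / q n) \<le> (T ^ (n - n0) * C + \<epsilon> * Gamma (a + k + Suc n)) / (fact n * real n powr (a + k))"
        using elim by (simp only: norm_divide nq) (intro divide_right_mono bound; simp)
      also have "T ^ (n - n0) = T ^ n / T ^ n0" using elim T by (simp add: power_diff)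
      finally show ?case using elim(1) by (simp add: add_divide_distrib mult.commute[of C])
    qed
  qed
  have "(\<lambda>n. G n / q n) \<longlonglongrightarrow> 1"
    unfolding G_def q_def using Gamma_Suc_asymp[of "\<nu> + of_real k"] .
  from tendsto_add[OF diff this] have "(\<lambda>n. (M (\<nu> + of_nat (Suc n)) - G n) / q n + G n / q n) \<longlonglongrightarrow> 1"
    by (simp only: add_0_left)
  moreover have "(M (\<nu> + of_nat (Suc n)) - G n) / q n + G n / q n = M (\<nu> + of_nat (Suc n)) / q n" for n
    unfolding add_divide_distrib[symmetric] by simp
  ultimately have "(\<lambda>n. M (\<nu> + of_nat (Suc n)) / q n) \<longlonglongrightarrow> 1" by (simp only:)
  then show ?thesis unfolding q_def .
qed

text \<open>Gauss's sequence for the reciprocal Gamma function is used at all three arguments.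
  \<open>M_pochhammer\<close> trades the Pochhammer symbols of the first two for that of the third
  times M(\<nu> + n + 1), whose growth is \<open>M_asymp\<close>.\<close>

lemma M_rGamma:
  assumes ok: "mell_ok \<nu>"
  shows "rGamma (\<nu> + 1/2 + \<mu>) * rGamma (\<nu> + 1/2 - \<mu>) * M \<nu> = rGamma (\<nu> + 1 - of_real k)"
proof -
  let ?a = "\<nu> + 1/2 + \<mu>" and ?b = "\<nu> + 1/2 - \<mu>" and ?c = "\<nu> + 1 - of_real k"
  have 1: "(\<lambda>n. rGamma_series ?a n * rGamma_series ?b n * M \<nu>) \<longlonglongrightarrow> rGamma ?a * rGamma ?b * M \<nu>"
    by (intro tendsto_intros)
  have 2: "(\<lambda>n. rGamma_series ?c n * (M (\<nu> + of_nat (Suc n)) / (fact n * of_nat n powr (\<nu> + of_real k)))) \<longlonglongrightarrow> rGamma ?c * 1"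
    by (intro tendsto_mult rGamma_series_LIMSEQ M_asymp ok)
  have 3: "eventually (\<lambda>n. rGamma_series ?c n * (M (\<nu> + of_nat (Suc n)) / (fact n * of_nat n powr (\<nu> + of_real k)))
     = rGamma_series ?a n * rGamma_series ?b n * M \<nu>) sequentially"
    using eventually_gt_at_top[of 0]
  proof eventually_elim
    case (elim n)
    define L where "L = complex_of_real (ln (of_nat n))"
    have p: "of_nat n powr (\<nu> + of_real k) = exp ((\<nu> + of_real k) * L)"
      using elim by (simp add: powr_def Ln_of_nat L_def)
    \<comment> \<open>The exponentials match because ?a + ?b = ?c + (\<nu> + k).\<close>
    have e: "exp (?a * L) * exp (?b * L) = exp (?c * L) * exp ((\<nu> + of_real k) * L)"
      by (simp add: exp_add[symmetric] algebra_simps)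
    have "rGamma_series ?a n * rGamma_series ?b n * M \<nu> =
       pochhammer ?a (Suc n) * pochhammer ?b (Suc n) * M \<nu> / (fact n * fact n * (exp (?a * L) * exp (?b * L)))"
      by (simp add: rGamma_series_def L_def)
    also have "\<dots> = pochhammer ?c (Suc n) * M (\<nu> + of_nat (Suc n)) / (fact n * fact n * (exp (?c * L) * exp ((\<nu> + of_real k) * L)))"
      unfolding M_pochhammer[OF ok] e ..
    also have "\<dots> = rGamma_series ?c n * (M (\<nu> + of_nat (Suc n)) / (fact n * of_nat n powr (\<nu> + of_real k)))"
      unfolding p by (simp add: rGamma_series_def L_def)
    finally show ?case by simp
  qed
  have "rGamma ?c * 1 = rGamma ?a * rGamma ?b * M \<nu>"
    by (rule LIMSEQ_unique[OF Lim_transform_eventually[OF 2 3] 1])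
  then show ?thesis by simp
qed

text \<open>Where a factor on the left of \<open>M_rGamma\<close> vanishes, that identity leaves M
  \<nu> open; the value is then a limit from the right, the direction in which integrability is
  inherited. Since u^x \<le> 1 + u^r for 0 \<le> x \<le> r, the integrands at the two end points
  dominate.\<close>

lemma M_right_limit:
  assumes ok: "mell_ok \<nu>" and r: "r \<ge> (0::real)"
  shows "(\<lambda>n. M (\<nu> + of_real r / of_nat (Suc n))) \<longlonglongrightarrow> M \<nu>"
proof -
  define c where c: "c = complex_of_real r"
  have ok1: "mell_ok (\<nu> + of_real r)" by (rule mell_ok_mono[OF ok]) (use r in simp)
  show ?thesis unfolding c[symmetric] M_def set_lebesgue_integral_def
  proof (rule integral_dominated_convergence[where w = "\<lambda>u. norm (indicator {0<..} u *\<^sub>R mell \<nu> u) + norm (indicator {0<..} u *\<^sub>R mell (\<nu> + of_real r) u)"])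
    show "integrable lborel (\<lambda>u. norm (indicator {0<..} u *\<^sub>R mell \<nu> u) + norm (indicator {0<..} u *\<^sub>R mell (\<nu> + of_real r) u))"
      using ok ok1 unfolding set_integrable_def by (intro Bochner_Integration.integrable_add integrable_norm)
    show "(\<lambda>u. indicator {0<..} u *\<^sub>R mell \<nu> u) \<in> borel_measurable lborel" using mell_ok_borel by simp
    fix n
    show "(\<lambda>u. indicator {0<..} u *\<^sub>R mell (\<nu> + c / of_nat (Suc n)) u) \<in> borel_measurable lborel" using mell_ok_borel by simp
    show "AE x in lborel. norm (indicator {0<..} x *\<^sub>R mell (\<nu> + c / of_nat (Suc n)) x) \<le> 
       norm (indicator {0<..} x *\<^sub>R mell \<nu> x) + norm (indicator {0<..} x *\<^sub>R mell (\<nu> + of_real r) x)"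
    proof (intro AE_I2)
      fix u :: real
      have rn: "r / real (Suc n) \<le> r" "0 \<le> r / real (Suc n)" using r by (auto simp: divide_le_eq mult_le_cancel_left1)
      have "norm (mell (\<nu> + c / of_nat (Suc n)) u) \<le> norm (mell \<nu> u) + norm (mell (\<nu> + of_real r) u)" if u: "u > 0"
      proof -
        have m: "norm (mell (\<nu> + of_real x) u) = u powr x * norm (mell \<nu> u)" for x
          unfolding mell_plus[OF u] using u by (simp add: norm_mult norm_powr_real_powr)
        have "u powr (r / Suc n) \<le> 1 + u powr r"
        proof (cases "u \<le> 1")
          case True then show ?thesis using u rn powr_le1[of "r / Suc n" u] by (simp add: add_increasing2)
        next
          case False
          then have "u powr (r / Suc n) \<le> u powr r" using rn(1) by (intro powr_mono) auto
          then show ?thesis by simp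
        qed
        then have "u powr (r / Suc n) * norm (mell \<nu> u) \<le> (1 + u powr r) * norm (mell \<nu> u)" by (rule mult_right_mono) auto
        then show ?thesis using m[of "r / Suc n"] m[of r] by (simp add: c ring_distribs)
      qed
      then show "norm (indicator {0<..} u *\<^sub>R mell (\<nu> + c / of_nat (Suc n)) u) \<le> 
       norm (indicator {0<..} u *\<^sub>R mell \<nu> u) + norm (indicator {0<..} u *\<^sub>R mell (\<nu> + of_real r) u)"
        by (auto simp: indicator_def simp del: of_nat_Suc)
    qed
  next
    show "AE x in lborel. (\<lambda>n. indicator {0<..} x *\<^sub>R mell (\<nu> + c / of_nat (Suc n)) x) \<longlonglongrightarrow> indicator {0<..} x *\<^sub>R mell \<nu> x"
    proof (intro AE_I2)
      fix u :: real
      show "(\<lambda>n. indicator {0<..} u *\<^sub>R mell (\<nu> + c / of_nat (Suc n)) u) \<longlonglongrightarrow> indicator {0<..} u *\<^sub>R mell \<nu> u"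
      proof (cases "u > 0")
        case True
        have "(\<lambda>n. \<nu> + c * (1 / of_nat (Suc n))) \<longlonglongrightarrow> \<nu> + c * 0"
          by (intro tendsto_intros LIMSEQ_Suc[OF lim_1_over_n])
        then have L0: "(\<lambda>n. \<nu> + c / of_nat (Suc n)) \<longlonglongrightarrow> \<nu>" by (simp only: mult_zero_right add_0_right times_divide_eq_right mult_1_right)
        then have L: "(\<lambda>n. \<nu> + c / of_nat (Suc n) - 1) \<longlonglongrightarrow> \<nu> - 1" by (intro tendsto_diff tendsto_const)
        have P: "(\<lambda>n. of_real u powr (\<nu> + c / of_nat (Suc n) - 1)) \<longlonglongrightarrow> of_real u powr (\<nu> - 1)"
          by (rule tendsto_powr_complex[OF _ tendsto_const L]) (use True in \<open>simp add: complex_nonpos_Reals_iff\<close>)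
        show ?thesis unfolding mell_def by (intro tendsto_scaleR tendsto_mult tendsto_const P)
      qed simp
    qed
  qed
qed

end

section \<open>Solutions of Whittaker's equation near 0\<close>

lemma powr_integrable_near_0:
  assumes "x > 0"
  shows "set_integrable lborel {0<..b} (\<lambda>t. t powr (x - 1) :: real)"
proof -
  \<comment> \<open>On (0, b] the factor exp(b - t) is at least 1, which reduces the claim to
    Euler's integral.\<close>
  have "set_integrable lborel {0<..b} (\<lambda>t. exp b * (t powr (x - 1) * exp (- t)))"
    by (rule set_integrable_subset[OF set_integrable_mult_right[OF powr_exp_integrable_real(1)[OF assms]]]) auto
  then show ?thesis
  proof (rule set_integrable_bound)
    show "set_borel_measurable lborel {0<..b} (\<lambda>t. t powr (x - 1))"
      unfolding set_borel_measurable_def by measurable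
    show "AE t in lborel. t \<in> {0<..b} \<longrightarrow> norm (t powr (x - 1)) \<le> norm (exp b * (t powr (x - 1) * exp (- t)))"
    proof (intro AE_I2 impI)
      fix t assume t: "t \<in> {0<..b}"
      have "t powr (x - 1) * 1 \<le> t powr (x - 1) * exp (b - t)" using t by (intro mult_left_mono) auto
      then show "norm (t powr (x - 1)) \<le> norm (exp b * (t powr (x - 1) * exp (- t)))"
        by (simp add: exp_diff exp_minus field_simps)
    qed
  qed
qed

context whittaker_equation
begin

text \<open>With v = u^(-1/2) w and D = u d/du the equation reads (D - \<mu>)(D + \<mu>) v = (u^2/4
  - k u) v, and \<open>aa\<close> is (D + \<mu>) v. The pair satisfies a first order system with
  exponents -\<mu> and \<mu> at 0, perturbed by a term that vanishes there.\<close>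

definition vv :: "real \<Rightarrow> complex" where
  "vv u = of_real (u powr (-1/2)) * w u"
definition aa :: "real \<Rightarrow> complex" where
  "aa u = of_real (u powr (1/2)) * w1 u + (\<mu> - 1/2) * (of_real (u powr (-1/2)) * w u)"

lemma vv_deriv:
  assumes u: "u > 0"
  shows "(vv has_vector_derivative (aa u - \<mu> * vv u) / of_real u) (at u)"
proof -
  have c: "((\<lambda>u. complex_of_real (u powr (-1/2))) has_vector_derivative of_real (-1/2 * u powr (-1/2 - 1))) (at u)"
    using u by (intro has_vector_derivative_of_real)
      (auto intro!: derivative_eq_intros simp flip: has_real_derivative_iff_has_vector_derivative)
  have e: "u powr (-1/2 - 1) = u powr (-1/2) / u" "u powr (1/2) = u * u powr (-1/2)"
    unfolding powr_diff using u powr_add[of u "-1/2" 1] by simp_all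
  show ?thesis unfolding vv_def[abs_def]
    by (rule has_vector_derivative_eq_rhs[OF has_vector_derivative_mult[OF c deriv[OF u]]],
        unfold aa_def e) (use u in \<open>simp add: field_simps\<close>)
qed

lemma aa_deriv:
  assumes u: "u > 0"
  shows "(aa has_vector_derivative (\<mu> * aa u + of_real (u\<^sup>2 / 4 - k * u) * vv u) / of_real u) (at u)"
proof -
  have c: "((\<lambda>u. complex_of_real (u powr (1/2))) has_vector_derivative of_real (1/2 * u powr (1/2 - 1))) (at u)"
    using u by (intro has_vector_derivative_of_real)
      (auto intro!: derivative_eq_intros simp flip: has_real_derivative_iff_has_vector_derivative)
  define x where "x = complex_of_real (u powr (-1/2))"
  define U where "U = complex_of_real u"
  have U: "U \<noteq> 0" using u by (simp add: U_def)
  have "u powr (1/2 - 1) = u powr (-1/2)" "u powr (1/2) = u * u powr (-1/2)"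
    using u powr_add[of u "-1/2" 1] by (simp_all)
  then have e: "complex_of_real (1/2 * u powr (1/2 - 1)) = x / 2" "complex_of_real (u powr (1/2)) = U * x"
    by (simp_all add: x_def U_def)
  have alg: "U * x * ((1/4 - K / U - (1/4 - \<mu>\<^sup>2) / U\<^sup>2) * y) + x / 2 * z + (\<mu> - 1/2) * ((U * x * z + (\<mu> - 1/2) * (x * y) - \<mu> * (x * y)) / U)
     = (\<mu> * (U * x * z + (\<mu> - 1/2) * (x * y)) + (U\<^sup>2 / 4 - K * U) * (x * y)) / U" for y z K
    using U by (simp add: divide_simps) algebra
  have r: "complex_of_real (u\<^sup>2 / 4 - k * u) = U\<^sup>2 / 4 - of_real k * U" by (simp add: U_def)
  have a: "aa = (\<lambda>u. of_real (u powr (1/2)) * w1 u + (\<mu> - 1/2) * vv u)"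
    by (simp add: aa_def vv_def fun_eq_iff)
  show ?thesis unfolding a
    apply (rule has_vector_derivative_eq_rhs[OF has_vector_derivative_add[OF has_vector_derivative_mult[OF c deriv2[OF u]] 
       has_vector_derivative_mult[OF has_vector_derivative_const vv_deriv[OF u]]]])
    unfolding aa_def vv_def e x_def[symmetric] U_def[symmetric]
    unfolding r using alg[of "of_real k" "w u" "w1 u"] by (simp only: mult_zero_left add_0_right)
qed

text \<open>The weight 1/\<delta>^2 balances the two couplings of the system: the coefficient 1 in
  the equation of v and the coefficient u^2/4 - k u, of size at most \<delta>^2, in that of a then
  contribute equally.\<close>

definition energy :: "real \<Rightarrow> real \<Rightarrow> real" where
  "energy \<delta> u = vv u \<bullet> vv u + (aa u \<bullet> aa u) / \<delta>\<^sup>2"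

lemma inner_mult_self: "x \<bullet> (c * x) = Re c * (x \<bullet> x)" for x c :: complex
  by (simp add: inner_complex_def algebra_simps)

text \<open>The energy E satisfies u E' \<ge> -2 (|Re \<mu>| + \<delta>) E. Read from
  \<open>u1\<close> down to 0 this bounds v by a multiple of u^(-(|Re \<mu>| + \<delta>)) for every
  solution, with no information at 0.\<close>

lemma energy_growth:
  assumes d: "\<delta> > 0" and p: "\<And>u. 0 < u \<Longrightarrow> u \<le> u1 \<Longrightarrow> \<bar>u\<^sup>2 / 4 - k * u\<bar> \<le> \<delta>\<^sup>2"
    and u: "0 < u" "u \<le> u1"
  shows "energy \<delta> u * u powr (2 * (\<bar>Re \<mu>\<bar> + \<delta>)) \<le> energy \<delta> u1 * u1 powr (2 * (\<bar>Re \<mu>\<bar> + \<delta>))"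
proof -
  define c where "c = 2 * (\<bar>Re \<mu>\<bar> + \<delta>)"
  have "\<exists>y. ((\<lambda>u. energy \<delta> u * u powr c) has_real_derivative y) (at x) \<and> 0 \<le> y" if x: "u \<le> x" "x \<le> u1" for x
  proof -
    have x0: "x > 0" using x u by simp
    let ?p = "x\<^sup>2 / 4 - k * x"
    let ?v' = "(aa x - \<mu> * vv x) / of_real x" and ?a' = "(\<mu> * aa x + of_real ?p * vv x) / of_real x"
    define E' where "E' = 2 * (vv x \<bullet> ?v') + 2 * (aa x \<bullet> ?a') / \<delta>\<^sup>2"
    have "(energy \<delta> has_vector_derivative E') (at x)"
      unfolding energy_def[abs_def] E'_def
      by (rule has_vector_derivative_eq_rhs[OF has_vector_derivative_add[OF
           bounded_bilinear.has_vector_derivative[OF bounded_bilinear_inner vv_deriv[OF x0] vv_deriv[OF x0]]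
           has_vector_derivative_divide[OF bounded_bilinear.has_vector_derivative[OF bounded_bilinear_inner aa_deriv[OF x0] aa_deriv[OF x0]]]]])
         (simp add: inner_commute add_divide_distrib)
    then have Ed: "(energy \<delta> has_real_derivative E') (at x)"
      by (simp add: has_real_derivative_iff_has_vector_derivative)
    have D: "((\<lambda>u. energy \<delta> u * u powr c) has_real_derivative (E' * x powr c + (c * x powr (c - 1)) * energy \<delta> x)) (at x)"
      using x0 by (intro DERIV_mult[OF Ed] has_real_derivative_powr)
    define nv na where "nv = norm (vv x)" and "na = norm (aa x) / \<delta>"
    have energy: "energy \<delta> x = nv\<^sup>2 + na\<^sup>2" by (simp add: energy_def nv_def na_def dot_square_norm power_divide)
    have xv: "x * (vv x \<bullet> ?v') = vv x \<bullet> aa x - Re \<mu> * nv\<^sup>2"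
    proof -
      have "?v' = (1/x) *\<^sub>R (aa x - \<mu> * vv x)" by (simp add: scaleR_conv_of_real)
      then show ?thesis using x0 by (simp only: inner_scaleR_right inner_diff_right inner_mult_self nv_def dot_square_norm) simp
    qed
    have xa: "x * (aa x \<bullet> ?a') = Re \<mu> * (norm (aa x))\<^sup>2 + ?p * (aa x \<bullet> vv x)"
    proof -
      have "?a' = (1/x) *\<^sub>R (\<mu> * aa x + ?p *\<^sub>R vv x)" by (simp add: scaleR_conv_of_real)
      then show ?thesis using x0 by (simp only: inner_scaleR_right inner_add_right inner_mult_self dot_square_norm) simp
    qed
    \<comment> \<open>The factor \<delta> comes from the scaling of \<open>a\<close> in
      \<open>na\<close>; the term with the coefficient u^2/4 - k u obeys the same bound.\<close>
    have cs: "\<bar>vv x \<bullet> aa x\<bar> \<le> \<delta> * (nv * na)"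
      using Cauchy_Schwarz_ineq2[of "vv x" "aa x"] d by (simp add: nv_def na_def)
    have nn: "nv \<ge> 0" "na \<ge> 0" using d by (auto simp: nv_def na_def)
    have am: "2 * (nv * na) \<le> nv\<^sup>2 + na\<^sup>2" using sum_squares_bound[of nv na] by (simp add: mult_ac)
    define Q where "Q = (?p / \<delta>\<^sup>2) * (vv x \<bullet> aa x)"
    have "x * E' = 2 * (x * (vv x \<bullet> ?v')) + 2 * (x * (aa x \<bullet> ?a')) / \<delta>\<^sup>2"
      unfolding E'_def by (simp only: distrib_left mult.left_commute times_divide_eq_right)
    also have "\<dots> = 2 * (vv x \<bullet> aa x) - 2 * Re \<mu> * nv\<^sup>2 + 2 * Re \<mu> * na\<^sup>2 + 2 * ((?p / \<delta>\<^sup>2) * (vv x \<bullet> aa x))"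
      unfolding xv xa na_def power_divide inner_commute[of "aa x" "vv x"]
      by (simp add: distrib_left right_diff_distrib add_divide_distrib)
    finally have "x * E' = 2 * (vv x \<bullet> aa x) - 2 * Re \<mu> * nv\<^sup>2 + 2 * Re \<mu> * na\<^sup>2 + 2 * Q" by (simp only: Q_def)
    moreover have "\<bar>Q\<bar> \<le> 1 * (\<delta> * (nv * na))"
      unfolding Q_def abs_mult using p[of x] x0 x d by (intro mult_mono cs) (auto simp: divide_le_eq)
    moreover have "- \<bar>Re \<mu>\<bar> * nv\<^sup>2 \<le> - Re \<mu> * nv\<^sup>2" "- \<bar>Re \<mu>\<bar> * na\<^sup>2 \<le> Re \<mu> * na\<^sup>2"
      using mult_right_mono[of "- \<bar>Re \<mu>\<bar>" "- Re \<mu>" "nv\<^sup>2"] mult_right_mono[of "- \<bar>Re \<mu>\<bar>" "Re \<mu>" "na\<^sup>2"] by auto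
    moreover have "2 * \<delta> * (2 * (nv * na)) \<le> 2 * \<delta> * (nv\<^sup>2 + na\<^sup>2)" using am d by (intro mult_left_mono) auto
    ultimately have "x * E' \<ge> - c * energy \<delta> x"
      using cs unfolding energy c_def by (simp add: algebra_simps)
    then have "E' + c / x * energy \<delta> x \<ge> 0" using x0 by (simp add: field_simps)
    then have "(E' + c / x * energy \<delta> x) * x powr c \<ge> 0" by simp
    moreover have "(E' + c / x * energy \<delta> x) * x powr c = E' * x powr c + (c * x powr (c - 1)) * energy \<delta> x"
      using x0 by (simp add: powr_diff field_simps)
    ultimately show ?thesis using D by auto
  qed
  then show ?thesis unfolding c_def using DERIV_nonneg_imp_nondecreasing[OF u(2)] by auto
qed

text \<open>Backward uniqueness for zero initial data: the energy is 0 at \<open>u1\<close>, and its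
  monotone multiple then leaves no room below.\<close>

lemma zero_below:
  assumes "u1 > 0" "w u1 = 0" "w1 u1 = 0" "0 < u" "u \<le> u1"
  shows "w u = 0"
proof -
  \<comment> \<open>Chosen so that |x^2/4 - k x| \<le> \<delta> on (0, u1]; the summand 1 gives
    \<delta> \<ge> 1 and so \<delta> \<le> \<delta>^2.\<close>
  define \<delta> where "\<delta> = 1 + u1\<^sup>2 / 4 + \<bar>k\<bar> * u1"
  have d: "\<delta> \<ge> 1" using assms by (simp add: \<delta>_def)
  have "\<bar>x\<^sup>2 / 4 - k * x\<bar> \<le> \<delta>\<^sup>2" if "0 < x" "x \<le> u1" for x
  proof -
    have "x\<^sup>2 \<le> u1\<^sup>2" "\<bar>k\<bar> * x \<le> \<bar>k\<bar> * u1" using that by (auto intro: power_mono mult_left_mono)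
    moreover have "\<bar>x\<^sup>2 / 4\<bar> = x\<^sup>2 / 4" "\<bar>k * x\<bar> = \<bar>k\<bar> * x" using that by (auto simp: abs_mult)
    ultimately have "\<bar>x\<^sup>2 / 4\<bar> + \<bar>k * x\<bar> \<le> \<delta>" unfolding \<delta>_def by linarith
    also have "\<delta> \<le> \<delta>\<^sup>2" using d mult_left_mono[of 1 \<delta> \<delta>] by (simp add: power2_eq_square)
    finally show ?thesis by linarith
  qed
  then have "energy \<delta> u * u powr (2 * (\<bar>Re \<mu>\<bar> + \<delta>)) \<le> energy \<delta> u1 * u1 powr (2 * (\<bar>Re \<mu>\<bar> + \<delta>))"
    using d assms by (intro energy_growth) auto
  also have "energy \<delta> u1 = 0" using assms by (simp add: energy_def vv_def aa_def)
  finally have "energy \<delta> u \<le> 0" using assms by (simp add: mult_le_0_iff)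
  then have "vv u \<bullet> vv u \<le> 0" unfolding energy_def by (smt (verit) divide_nonneg_nonneg inner_ge_zero zero_le_power2)
  then have "vv u = 0" by (metis inner_eq_zero_iff inner_ge_zero order_antisym)
  then show ?thesis using assms by (simp add: vv_def)
qed

text \<open>Half of the gap between Re \<nu> + 1/2 and |Re \<mu>| is spent on the energy estimate,
  the other half survives in the integrable majorant u^(\<delta>-1).\<close>

lemma mell_integrable_near_0:
  assumes "Re \<nu> + 1/2 > \<bar>Re \<mu>\<bar>" and T: "T > 1"
  shows "set_integrable lborel {0<..T} (mell \<nu>)"
proof -
  define \<delta> where "\<delta> = (Re \<nu> + 1/2 - \<bar>Re \<mu>\<bar>) / 2"
  have d: "\<delta> > 0" using assms by (simp add: \<delta>_def)
  have "((\<lambda>x. x\<^sup>2 / 4 - k * x) \<longlongrightarrow> 0\<^sup>2 / 4 - k * 0) (at_right 0)" by (intro tendsto_intros) auto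
  then have "((\<lambda>x. x\<^sup>2 / 4 - k * x) \<longlongrightarrow> 0) (at_right 0)" by simp
  then have "eventually (\<lambda>x. dist (x\<^sup>2 / 4 - k * x) 0 < \<delta>\<^sup>2) (at_right 0)"
    by (rule tendstoD) (use d in simp)
  then obtain b where b: "b > 0" "\<And>x. 0 < x \<Longrightarrow> x < b \<Longrightarrow> \<bar>x\<^sup>2 / 4 - k * x\<bar> < \<delta>\<^sup>2"
    by (auto simp: eventually_at_right_field)
  define u1 where "u1 = min (b / 2) 1"
  have u1: "u1 > 0" "u1 \<le> 1" "u1 < b" using b by (auto simp: u1_def)
  define C where "C = sqrt (energy \<delta> u1 * u1 powr (2 * (\<bar>Re \<mu>\<bar> + \<delta>)))"
  have wb: "norm (w u) \<le> C * u powr (1/2 - (\<bar>Re \<mu>\<bar> + \<delta>))" if u: "0 < u" "u \<le> u1" for u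
  proof -
    have "energy \<delta> u * u powr (2 * (\<bar>Re \<mu>\<bar> + \<delta>)) \<le> energy \<delta> u1 * u1 powr (2 * (\<bar>Re \<mu>\<bar> + \<delta>))"
      using u u1 b d by (intro energy_growth) (auto intro!: less_imp_le)
    moreover have "vv u \<bullet> vv u \<le> energy \<delta> u" by (simp add: energy_def)
    ultimately have "(vv u \<bullet> vv u) * u powr (2 * (\<bar>Re \<mu>\<bar> + \<delta>)) \<le> energy \<delta> u1 * u1 powr (2 * (\<bar>Re \<mu>\<bar> + \<delta>))"
      by (meson mult_right_mono order_trans powr_ge_zero)
    moreover have "(vv u \<bullet> vv u) * u powr (2 * (\<bar>Re \<mu>\<bar> + \<delta>)) = (norm (vv u) * u powr (\<bar>Re \<mu>\<bar> + \<delta>))\<^sup>2"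
      by (simp only: mult_2 powr_add dot_square_norm power_mult_distrib power2_eq_square mult_ac)
    ultimately have "norm (vv u) * u powr (\<bar>Re \<mu>\<bar> + \<delta>) \<le> C"
      unfolding C_def by (simp add: real_le_rsqrt)
    moreover have "norm (vv u) = u powr (-1/2) * norm (w u)" by (simp add: vv_def norm_mult)
    ultimately have "u powr (-1/2) * u powr (\<bar>Re \<mu>\<bar> + \<delta>) * norm (w u) \<le> C" by (simp add: mult_ac)
    then have "u powr (1/2 - (\<bar>Re \<mu>\<bar> + \<delta>)) * (u powr (-1/2 + (\<bar>Re \<mu>\<bar> + \<delta>)) * norm (w u)) \<le> u powr (1/2 - (\<bar>Re \<mu>\<bar> + \<delta>)) * C"
      by (intro mult_left_mono) (simp_all add: powr_add[symmetric])
    moreover have "u powr (1/2 - (\<bar>Re \<mu>\<bar> + \<delta>)) * (u powr (-1/2 + (\<bar>Re \<mu>\<bar> + \<delta>)) * norm (w u)) = norm (w u)"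
      unfolding mult.assoc[symmetric] powr_add[symmetric] using u by simp
    ultimately show ?thesis by (simp only: mult.commute[of C])
  qed
  have "set_integrable lborel {0<..u1} (\<lambda>t. C * t powr (\<delta> - 1))"
    by (intro set_integrable_mult_right powr_integrable_near_0 d)
  then have 1: "set_integrable lborel {0<..u1} (mell \<nu>)"
  proof (rule set_integrable_bound[OF _ set_borel_measurable_mell])
    show "AE x in lborel. x \<in> {0<..u1} \<longrightarrow> norm (mell \<nu> x) \<le> norm (C * x powr (\<delta> - 1))"
    proof (intro AE_I2 impI)
      fix u assume "u \<in> {0<..u1}"
      then have u: "0 < u" "u \<le> u1" by auto
      have "norm (mell \<nu> u) = u powr (Re \<nu> - 1) * exp (- u / 2) * norm (w u)"
        using u by (simp add: mell_def norm_mult norm_powr_real_powr)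
      also have "\<dots> \<le> u powr (Re \<nu> - 1) * 1 * (C * u powr (1/2 - (\<bar>Re \<mu>\<bar> + \<delta>)))"
        using u by (intro mult_mono wb) auto
      also have "\<dots> = C * (u powr (Re \<nu> - 1) * u powr (1/2 - (\<bar>Re \<mu>\<bar> + \<delta>)))" by simp
      also have "u powr (Re \<nu> - 1) * u powr (1/2 - (\<bar>Re \<mu>\<bar> + \<delta>)) = u powr (\<delta> - 1)"
        unfolding powr_add[symmetric] by (rule arg_cong[where f = "\<lambda>x. u powr x"]) (simp add: \<delta>_def field_simps)
      finally show "norm (mell \<nu> u) \<le> norm (C * u powr (\<delta> - 1))" by simp
    qed
  qed auto
  have "set_integrable lborel {u1..T} (mell \<nu>)"
    by (intro borel_integrable_atLeastAtMost' continuous_on_subset[OF continuous_on_mell]) (use u1 in auto)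
  with 1 have "set_integrable lborel ({0<..u1} \<union> {u1..T}) (mell \<nu>)"
    by (rule set_integrable_Un) auto
  moreover have "{0<..u1} \<union> {u1..T} = {0<..T}" using u1 T by auto
  ultimately show ?thesis by simp
qed

end

lemma (in whittaker_W) mell_ok_Re: "Re \<nu> + 1/2 > \<bar>Re \<mu>\<bar> \<Longrightarrow> mell_ok \<nu>"
  by (intro mell_ok_near_0 mell_integrable_near_0)

section \<open>Uniqueness of the decaying solution\<close>

lemma whittaker_equation_diff:
  assumes "whittaker_equation k \<mu> f f1" "whittaker_equation k \<mu> g g1"
  shows "whittaker_equation k \<mu> (\<lambda>x. f x - g x) (\<lambda>x. f1 x - g1 x)"
proof
  fix x :: real assume x: "x > 0"
  show "((\<lambda>x. f x - g x) has_vector_derivative f1 x - g1 x) (at x)"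
    using assms x by (intro has_vector_derivative_diff) (auto simp: whittaker_equation_def)
  have "((\<lambda>x. f1 x - g1 x) has_vector_derivative 
     ((1/4 - of_real k / of_real x - (1/4 - \<mu>\<^sup>2) / of_real x ^ 2) * f x - (1/4 - of_real k / of_real x - (1/4 - \<mu>\<^sup>2) / of_real x ^ 2) * g x)) (at x)"
    using assms x by (intro has_vector_derivative_diff) (auto simp: whittaker_equation_def)
  then show "((\<lambda>x. f1 x - g1 x) has_vector_derivative (1/4 - of_real k / of_real x - (1/4 - \<mu>\<^sup>2) / of_real x ^ 2) * (f x - g x)) (at x)"
    by (simp only: right_diff_distrib)
qed

text \<open>For two solutions \<open>f\<close>, \<open>g\<close> the derivative of \<open>(f - g) / g\<close> is the Wronskian divided by
  \<open>g\<^sup>2\<close>; since \<open>g\<close> decays exponentially, a nonzero Wronskian would make the quotient unbounded.\<close>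

lemma whittaker_W_unique:
  assumes f: "whittaker_W k \<mu> f f1" and g: "whittaker_W k \<mu> g g1" and x: "x > 0"
  shows "f x = g x"
proof -
  interpret f: whittaker_W k \<mu> f f1 by fact
  interpret g: whittaker_W k \<mu> g g1 by fact
  interpret h: whittaker_equation k \<mu> "\<lambda>x. f x - g x" "\<lambda>x. f1 x - g1 x"
    by (rule whittaker_equation_diff) unfold_locales
  define h h1 where "h = (\<lambda>x. f x - g x)" and "h1 = (\<lambda>x. f1 x - g1 x)"
  define W where "W = (\<lambda>x. h1 x * g x - h x * g1 x)"
  define E where "E = (\<lambda>x::real. exp (- complex_of_real x / 2) * of_real x powr of_real k)"
  have W': "(W has_vector_derivative 0) (at x within {0<..})" if "x \<in> {0<..}" for x
  proof -
    have x: "x > 0" using that by simp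
    show ?thesis unfolding W_def h_def h1_def
      apply (rule has_vector_derivative_at_within)
      apply (rule has_vector_derivative_eq_rhs[OF has_vector_derivative_diff[OF
        has_vector_derivative_mult[OF h.deriv2[OF x] g.deriv[OF x]] has_vector_derivative_mult[OF h.deriv[OF x] g.deriv2[OF x]]]])
      apply (simp add: algebra_simps)
      done
  qed
  obtain c where c: "\<And>x. x \<in> {0<..} \<Longrightarrow> W x = c"
    using has_vector_derivative_zero_constant[OF convex_real_interval(3) W'] by blast
  have lim: "((\<lambda>x. g x / E x) \<longlongrightarrow> 1) at_top" "((\<lambda>x. f x / E x) \<longlongrightarrow> 1) at_top"
    using f.asymp g.asymp by (simp_all add: E_def)
  have nz: "eventually (\<lambda>x. g x / E x \<noteq> 0) at_top"
    using lim(1) by (rule tendsto_imp_eventually_ne) simp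
  have "((\<lambda>x. f x / E x / (g x / E x) - 1) \<longlongrightarrow> 1 / 1 - 1) at_top"
    by (intro tendsto_intros lim) simp
  moreover have "eventually (\<lambda>x. f x / E x / (g x / E x) - 1 = h x / g x) at_top"
    using nz
  proof eventually_elim
    case (elim x)
    then have "E x \<noteq> 0" "g x \<noteq> 0" by auto
    then show ?case by (simp add: h_def diff_divide_distrib)
  qed
  ultimately have hg: "((\<lambda>x. h x / g x) \<longlongrightarrow> 0) at_top"
    by (simp add: Lim_transform_eventually)
  have hg': "((\<lambda>x. h x / g x) has_vector_derivative c / (g x)\<^sup>2) (at x)" if "x > 0" "g x \<noteq> 0" for x
  proof -
    have hD: "(h has_vector_derivative h1 x) (at x)" and gD: "(g has_vector_derivative g1 x) (at x)"
      using h.deriv[OF that(1)] g.deriv[OF that(1)] by (simp_all add: h_def h1_def)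
    have "((\<lambda>x. h x / g x) has_vector_derivative (h1 x * g x - h x * g1 x) / (g x * g x)) (at x)"
      using hD gD unfolding has_vector_derivative_def
      by (rule has_derivative_eq_rhs[OF has_derivative_divide'])
         (use that in \<open>auto simp: fun_eq_iff scaleR_conv_of_real field_simps\<close>)
    then show ?thesis using c[of x] that by (simp add: W_def power2_eq_square)
  qed
  have c0: "c = 0"
  proof (rule ccontr)
    assume c0: "c \<noteq> 0"
    have "((\<lambda>x. Re (1 / (g x / E x)\<^sup>2)) \<longlongrightarrow> Re (1 / 1\<^sup>2)) at_top"
      by (intro tendsto_intros lim) simp
    then have e1: "eventually (\<lambda>x. Re (1 / (g x / E x)\<^sup>2) > 1/2) at_top"
      by (rule order_tendstoD) simp
    have e2: "eventually (\<lambda>x. 1 / (exp (- x / 2) * x powr k)\<^sup>2 \<ge> 2) at_top" by real_asymp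
    obtain X where X: "\<And>x. x \<ge> X \<Longrightarrow> Re (1 / (g x / E x)\<^sup>2) > 1/2 \<and> 1 / (exp (- x / 2) * x powr k)\<^sup>2 \<ge> 2 \<and> x > 0 \<and> g x / E x \<noteq> 0"
      using eventually_conj[OF e1 eventually_conj[OF e2 eventually_conj[OF eventually_gt_at_top[of 0] nz]]]
      by (auto simp: eventually_at_top_linorder)
    \<comment> \<open>After division by \<open>c\<close> the derivative is Re (1 / g^2). As g is
      asymptotic to the positive function \<open>E\<close>, which tends to 0, it exceeds 1 far out;
      so \<open>y\<close> grows at least linearly, against h / g \<rightarrow> 0.\<close>
    define y where "y = (\<lambda>x. Re (h x / g x / c))"
    have y': "\<exists>d. (y has_real_derivative d) (at x) \<and> d \<ge> 1" if "x \<ge> X" for x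
    proof -
      note X = X[OF that]
      have E: "E x = of_real (exp (- x / 2) * x powr k)" 
        using X by (simp add: E_def powr_of_real exp_of_real[symmetric])
      have Enz: "E x \<noteq> 0" using X by auto
      have "(y has_vector_derivative Re (c / (g x)\<^sup>2 / c)) (at x)"
        unfolding y_def using X
        by (intro bounded_linear.has_vector_derivative[OF bounded_linear_Re] has_vector_derivative_divide hg') auto
      moreover have "c / (g x)\<^sup>2 / c = of_real (1 / (exp (- x / 2) * x powr k)\<^sup>2) * (1 / (g x / E x)\<^sup>2)"
      proof -
        have "complex_of_real (1 / (exp (- x / 2) * x powr k)\<^sup>2) = 1 / (E x)\<^sup>2" unfolding E by simp
        then show ?thesis using c0 Enz by (simp only:) (simp add: power_divide)
      qed
      moreover have "1 \<le> Re \<dots>"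
      proof -
        have "2 * (1/2) \<le> 1 / (exp (- x / 2) * x powr k)\<^sup>2 * Re (1 / (g x / E x)\<^sup>2)"
          using X by (intro mult_mono) auto
        then show ?thesis
          unfolding times_complex.sel Re_complex_of_real Im_complex_of_real by simp
      qed
      ultimately show ?thesis by (auto simp: has_real_derivative_iff_has_vector_derivative)
    qed
    have "y x \<ge> y X + (x - X)" if x: "x \<ge> X" for x
    proof -
      have "\<exists>d. ((\<lambda>x. y x - x) has_real_derivative d) (at t) \<and> 0 \<le> d" if t: "X \<le> t" "t \<le> x" for t
      proof -
        obtain d where "(y has_real_derivative d) (at t)" "d \<ge> 1" using y'[OF t(1)] by blast
        then show ?thesis by (intro exI[of _ "d - 1"]) (auto intro!: derivative_eq_intros)
      qed
      from DERIV_nonneg_imp_nondecreasing[OF x this] show ?thesis by simp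
    qed
    then have "eventually (\<lambda>x. y x \<ge> 1) at_top"
      unfolding eventually_at_top_linorder
      by (intro exI[of _ "max X (X + 1 - y X)"]) (smt (verit, best))
    moreover have "(y \<longlongrightarrow> Re (0 / c)) at_top" unfolding y_def by (intro tendsto_intros hg c0)
    ultimately show False
      using tendsto_lowerbound[of y 0 at_top 1] by simp
  qed
  obtain X where X: "X > 0" "\<And>x. x \<ge> X \<Longrightarrow> g x \<noteq> 0"
    using eventually_conj[OF eventually_gt_at_top[of "0::real"] nz]
    by (auto simp: eventually_at_top_linorder)
  \<comment> \<open>With Wronskian 0 the quotient h / g is constant beyond the zeros of g, and its
    limit at infinity makes that constant 0.\<close>
  obtain d where d: "\<And>x. x \<in> {X..} \<Longrightarrow> h x / g x = d"
    using has_vector_derivative_zero_constant[of "{X..}" "\<lambda>x. h x / g x"] hg' X c0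
    by (metis (no_types, lifting) atLeast_iff convex_real_interval(1) div_0 has_vector_derivative_at_within less_le_trans)
  have "((\<lambda>x. h x / g x) \<longlongrightarrow> d) at_top"
    by (rule tendsto_eventually) (use d in \<open>auto simp: eventually_at_top_linorder\<close>)
  then have "d = 0" using hg by (rule tendsto_unique[OF trivial_limit_at_top_linorder])
  then have hX: "h x = 0" if "x \<ge> X" for x using d[of x] X that by auto
  \<comment> \<open>The shift by 1 leaves a neighbourhood on which h vanishes, so the derivative
    vanishes as well and \<open>zero_below\<close> carries h = 0 down to \<open>x\<close>.\<close>
  have "h1 (max x X + 1) = 0"
  proof -
    let ?t = "max x X + 1"
    have "(h has_vector_derivative h1 ?t) (at ?t)" using h.deriv[of ?t] x by (simp add: h_def h1_def)
    moreover have "(h has_vector_derivative 0) (at ?t)"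
      by (rule has_vector_derivative_transform_within_open[OF has_vector_derivative_const[of 0], of "{X<..}"]) (auto simp: hX)
    ultimately show ?thesis by (rule vector_derivative_unique_at)
  qed
  then have "h x = 0"
    using h.zero_below[of "max x X + 1" x] hX[of "max x X + 1"] x by (auto simp: h_def h1_def)
  then show ?thesis by (simp add: h_def)
qed

section \<open>Polynomial Whittaker functions\<close>

fun laguerre_coeff :: "nat \<Rightarrow> real \<Rightarrow> nat \<Rightarrow> real" where
  "laguerre_coeff n m 0 = 1"
| "laguerre_coeff n m (Suc i) = - (real (n - i) * (real (n - i) + 2 * m) / real (Suc i)) * laguerre_coeff n m i"

text \<open>The monic multiple of the generalized Laguerre polynomial of degree n with parameter 2
  m. Its coefficients are generated from the leading one downwards, dividing only by
  \<open>Suc i\<close>, so that negative integers 2 m are no exception.\<close>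

definition laguerre_poly :: "nat \<Rightarrow> real \<Rightarrow> real poly" where
  "laguerre_poly n m = Poly (map (\<lambda>j. laguerre_coeff n m (n - j)) [0..<Suc n])"

lemma coeff_laguerre_poly: "coeff (laguerre_poly n m) j = (if j \<le> n then laguerre_coeff n m (n - j) else 0)"
  by (auto simp: laguerre_poly_def nth_default_def less_Suc_eq_le simp del: upt_Suc)

lemma degree_laguerre_poly: "degree (laguerre_poly n m) = n"
  by (rule antisym, rule degree_le) (auto simp: coeff_laguerre_poly intro!: le_degree)

text \<open>The recursion in upward form, which is the Laguerre equation coefficient by coefficient.
  It extends to j \<ge> n because both sides vanish there.\<close>

lemma laguerre_poly_step: "real (Suc j) * (real (Suc j) + 2 * m) * coeff (laguerre_poly n m) (Suc j) = (real j - real n) * coeff (laguerre_poly n m) j"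
proof (cases "j < n")
  case True
  define i where "i = n - Suc j"
  have i: "n - j = Suc i" "n - i = Suc j" using True by (auto simp: i_def)
  have eq: "real j - real n = - real (Suc i)" using True by (simp add: i_def of_nat_diff)
  show ?thesis unfolding eq using True by (simp add: coeff_laguerre_poly i i_def[symmetric] del: of_nat_Suc)
qed (auto simp: coeff_laguerre_poly)

lemma laguerre_poly_ode:
  "x * poly (pderiv (pderiv (laguerre_poly n m))) x + (2 * m + 1 - x) * poly (pderiv (laguerre_poly n m)) x + real n * poly (laguerre_poly n m) x = 0"
proof -
  define p where "p = laguerre_poly n m"
  have "pCons 0 (pderiv (pderiv p) - pderiv p) + smult (2 * m + 1) (pderiv p) + smult (real n) p = 0"
  proof (rule poly_eqI)
    fix j
    show "coeff (pCons 0 (pderiv (pderiv p) - pderiv p) + smult (2 * m + 1) (pderiv p) + smult (real n) p) j = coeff 0 j"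
    proof (cases j)
      case 0
      then show ?thesis using laguerre_poly_step[of 0 m n] by (simp add: coeff_pderiv p_def algebra_simps)
    next
      case (Suc i)
      then show ?thesis using laguerre_poly_step[of j m n] by (simp add: coeff_pderiv p_def algebra_simps)
    qed
  qed
  then have "poly (pCons 0 (pderiv (pderiv p) - pderiv p) + smult (2 * m + 1) (pderiv p) + smult (real n) p) x = 0" by simp
  then show ?thesis by (simp add: p_def algebra_simps)
qed

lemma laguerre_poly_asymp: "((\<lambda>x. poly (laguerre_poly n m) x / x ^ n) \<longlongrightarrow> 1) at_top"
proof -
  have "((\<lambda>x. \<Sum>i\<le>n. coeff (laguerre_poly n m) i * (1 / x) ^ (n - i)) \<longlongrightarrow> (\<Sum>i\<le>n. coeff (laguerre_poly n m) i * 0 ^ (n - i))) at_top"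
    by (intro tendsto_intros) real_asymp
  also have "(\<Sum>i\<le>n. coeff (laguerre_poly n m) i * 0 ^ (n - i)) = (\<Sum>i\<in>{n}. coeff (laguerre_poly n m) i * 0 ^ (n - i))"
    by (rule sum.mono_neutral_right) auto
  also have "\<dots> = 1" by (simp add: coeff_laguerre_poly)
  finally have "((\<lambda>x. \<Sum>i\<le>n. coeff (laguerre_poly n m) i * (1 / x) ^ (n - i)) \<longlongrightarrow> 1) at_top" .
  moreover have "eventually (\<lambda>x. (\<Sum>i\<le>n. coeff (laguerre_poly n m) i * (1 / x) ^ (n - i)) = poly (laguerre_poly n m) x / x ^ n) at_top"
    using eventually_gt_at_top[of 0]
  proof eventually_elim
    case (elim x)
    have "poly (laguerre_poly n m) x / x ^ n = (\<Sum>i\<le>n. coeff (laguerre_poly n m) i * x ^ i / x ^ n)"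
      by (simp add: poly_altdef degree_laguerre_poly sum_divide_distrib)
    also have "\<dots> = (\<Sum>i\<le>n. coeff (laguerre_poly n m) i * (1 / x) ^ (n - i))"
      using elim by (intro sum.cong refl) (simp add: power_diff power_one_over field_simps)
    finally show ?case by simp
  qed
  ultimately show ?thesis by (rule Lim_transform_eventually)
qed

definition polyw :: "nat \<Rightarrow> real \<Rightarrow> real \<Rightarrow> real" where
  "polyw n m x = exp (- x / 2) * x powr (m + 1/2) * poly (laguerre_poly n m) x"
definition polyw1 :: "nat \<Rightarrow> real \<Rightarrow> real \<Rightarrow> real" where
  "polyw1 n m x = exp (- x / 2) * x powr (m + 1/2) * (poly (pderiv (laguerre_poly n m)) x + ((m + 1/2) / x - 1/2) * poly (laguerre_poly n m) x)"

text \<open>Splitting off exp(-x/2) x^(m+1/2) turns Whittaker's equation into the Laguerre equation.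
  The polynomial is monic of degree n, so the leading behaviour is exp(-x/2) x^k with constant
  1.\<close>

lemma whittaker_W_polyw:
  assumes k: "k = m + 1/2 + real n"
  shows "whittaker_W k (of_real m) (\<lambda>x. of_real (polyw n m x)) (\<lambda>x. of_real (polyw1 n m x))"
proof
  fix x :: real assume x: "x > 0"
  define P where "P = poly (laguerre_poly n m)"
  define P1 where "P1 = poly (pderiv (laguerre_poly n m))"
  define P2 where "P2 = poly (pderiv (pderiv (laguerre_poly n m)))"
  define e where "e = (\<lambda>x. exp (- x / 2) * x powr (m + 1/2))"
  have e: "(e has_real_derivative e x * ((m + 1/2) / x - 1/2)) (at x)"
  proof -
    have "((\<lambda>x. exp (- x / 2)) has_real_derivative exp (- x / 2) * (- 1 / 2)) (at x)"
      by (auto intro!: derivative_eq_intros)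
    from DERIV_mult[OF this has_real_derivative_powr[OF x, of "m + 1/2"]]
    show ?thesis unfolding e_def powr_diff using x by (simp add: field_simps)
  qed
  have P: "(P has_real_derivative P1 x) (at x)" "(P1 has_real_derivative P2 x) (at x)"
    unfolding P_def P1_def P2_def by (rule poly_DERIV)+
  have "(polyw n m has_real_derivative polyw1 n m x) (at x)"
  proof -
    have "((\<lambda>x. e x * P x) has_real_derivative e x * ((m + 1/2) / x - 1/2) * P x + P1 x * e x) (at x)"
      by (rule DERIV_mult[OF e P(1)])
    then show ?thesis unfolding polyw_def[abs_def] polyw1_def P_def[symmetric] P1_def[symmetric] e_def by (simp add: algebra_simps)
  qed
  then show "((\<lambda>x. complex_of_real (polyw n m x)) has_vector_derivative of_real (polyw1 n m x)) (at x)"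
    by (intro has_vector_derivative_of_real) (simp add: has_real_derivative_iff_has_vector_derivative)
  have "(polyw1 n m has_real_derivative (1/4 - k / x - (1/4 - m\<^sup>2) / x\<^sup>2) * polyw n m x) (at x)"
  proof -
    have i: "((\<lambda>x. (m + 1/2) / x - 1/2) has_real_derivative - (m + 1/2) / x\<^sup>2) (at x)"
      using x by (auto intro!: derivative_eq_intros simp: power2_eq_square field_simps)
    have "((\<lambda>x. e x * (P1 x + ((m + 1/2) / x - 1/2) * P x)) has_real_derivative 
        e x * ((m + 1/2) / x - 1/2) * (P1 x + ((m + 1/2) / x - 1/2) * P x) + 
        (P2 x + (- (m + 1/2) / x\<^sup>2 * P x + P1 x * ((m + 1/2) / x - 1/2))) * e x) (at x)"
      by (rule DERIV_mult[OF e DERIV_add[OF P(2) DERIV_mult[OF i P(1)]]])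
    moreover have "e x * ((m + 1/2) / x - 1/2) * (P1 x + ((m + 1/2) / x - 1/2) * P x) + 
        (P2 x + (- (m + 1/2) / x\<^sup>2 * P x + P1 x * ((m + 1/2) / x - 1/2))) * e x
        = (1/4 - k / x - (1/4 - m\<^sup>2) / x\<^sup>2) * (e x * P x)"
    proof -
      have ode: "x * P2 x + (2 * m + 1 - x) * P1 x + real n * P x = 0"
        using laguerre_poly_ode by (simp add: P_def P1_def P2_def)
      have "x\<^sup>2 * (e x * ((m + 1/2) / x - 1/2) * (P1 x + ((m + 1/2) / x - 1/2) * P x) + 
        (P2 x + (- (m + 1/2) / x\<^sup>2 * P x + P1 x * ((m + 1/2) / x - 1/2))) * e x) =
        e x * (x * (x * P2 x + (2 * m + 1 - x) * P1 x + real n * P x)) + x\<^sup>2 * ((1/4 - k / x - (1/4 - m\<^sup>2) / x\<^sup>2) * (e x * P x))"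
        using x unfolding k by (simp add: field_simps power2_eq_square)
      then show ?thesis unfolding ode using x by simp
    qed
    ultimately show ?thesis unfolding polyw_def[abs_def] polyw1_def[abs_def] P_def[symmetric] P1_def[symmetric] e_def by simp
  qed
  then have "((\<lambda>x. complex_of_real (polyw1 n m x)) has_vector_derivative of_real ((1/4 - k / x - (1/4 - m\<^sup>2) / x\<^sup>2) * polyw n m x)) (at x)"
    by (intro has_vector_derivative_of_real) (simp add: has_real_derivative_iff_has_vector_derivative)
  then show "((\<lambda>x. complex_of_real (polyw1 n m x)) has_vector_derivative
      (1/4 - of_real k / of_real x - (1/4 - (of_real m)\<^sup>2) / of_real x ^ 2) * of_real (polyw n m x)) (at x)"
    by simp
next
  have "((\<lambda>x. complex_of_real (poly (laguerre_poly n m) x / x ^ n)) \<longlongrightarrow> of_real 1) at_top"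
    by (intro tendsto_of_real laguerre_poly_asymp)
  moreover have "eventually (\<lambda>x. complex_of_real (poly (laguerre_poly n m) x / x ^ n) =
     of_real (polyw n m x) / (exp (- of_real x / 2) * of_real x powr of_real k)) at_top"
    using eventually_gt_at_top[of 0]
  proof eventually_elim
    case (elim x)
    have "exp (- complex_of_real x / 2) * of_real x powr of_real k = of_real (exp (- x / 2) * x powr k)"
      using elim by (simp add: powr_of_real exp_of_real[symmetric])
    moreover have "x powr k = x powr (m + 1/2) * x ^ n" unfolding k powr_add using elim by (simp add: powr_realpow)
    ultimately show ?case using elim by (simp add: polyw_def)
  qed
  ultimately show "((\<lambda>x. complex_of_real (polyw n m x) / (exp (- complex_of_real x / 2) * complex_of_real x powr complex_of_real k)) \<longlongrightarrow> 1) at_top"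
    unfolding of_real_1 by (rule Lim_transform_eventually)
qed

text \<open>Uniqueness identifies w with the polynomial solution, and its Mellin integrand is a
  finite sum of Gamma integrands at \<nu> + 1/2 + \<mu> + i. One sign of \<mu> has to be controlled
  here, while \<open>mell_ok_Re\<close> needs both.\<close>

lemma (in whittaker_W) mell_ok_polynomial:
  assumes n: "of_real k - 1/2 - \<mu> = of_nat n" and nu: "Re (\<nu> + 1/2 + \<mu>) > 0"
  shows "mell_ok \<nu>"
proof -
  define m where "m = k - 1/2 - real n"
  have mu: "\<mu> = of_real m" using n by (simp add: m_def algebra_simps)
  have W: "whittaker_W k \<mu> (\<lambda>x. of_real (polyw n m x)) (\<lambda>x. of_real (polyw1 n m x))"
    unfolding mu by (rule whittaker_W_polyw) (simp add: m_def)
  have w: "w x = of_real (polyw n m x)" if "x > 0" for x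
    by (rule whittaker_W_unique[OF whittaker_W_axioms W that])
  have "set_integrable lborel {0<..} (\<lambda>u. \<Sum>i\<le>n. of_real (coeff (laguerre_poly n m) i) * (complex_of_real u powr ((\<nu> + 1/2 + \<mu> + of_nat i) - 1) * exp (- of_real u)))"
    unfolding set_integrable_def scaleR_sum_right
  proof (intro Bochner_Integration.integrable_sum)
    fix i
    have "Re (\<nu> + 1/2 + \<mu> + of_nat i) > 0" using nu by (simp add: add_pos_nonneg)
    from set_integrable_mult_right[OF powr_exp_integrable(1)[OF this], of "of_real (coeff (laguerre_poly n m) i)"]
    show "integrable lborel (\<lambda>x. indicat_real {0<..} x *\<^sub>R (complex_of_real (coeff (laguerre_poly n m) i) *
       (complex_of_real x powr (\<nu> + 1/2 + \<mu> + of_nat i - 1) * exp (- of_real x))))"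
      by (simp only: set_integrable_def)
  qed
  moreover have "(\<Sum>i\<le>n. of_real (coeff (laguerre_poly n m) i) * (complex_of_real u powr ((\<nu> + 1/2 + \<mu> + of_nat i) - 1) * exp (- of_real u))) = mell \<nu> u"
    if u: "u > 0" for u
  proof -
    have e: "exp (- complex_of_real u) = exp (- (of_real u / 2)) * exp (- (of_real u / 2))"
      by (simp add: mult_exp_exp)
    have "complex_of_real u powr ((\<nu> + 1/2 + \<mu> + of_nat i) - 1) = of_real u powr (\<nu> - 1) * of_real u powr (\<mu> + 1/2) * of_real u ^ i" for i
    proof -
      have "(\<nu> + 1/2 + \<mu> + of_nat i) - 1 = (\<nu> - 1) + (\<mu> + 1/2) + of_nat i" by simp
      then show ?thesis using u by (simp only: powr_add powr_nat') (simp add: powr_nat')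
    qed
    moreover have "complex_of_real u powr (\<mu> + 1/2) = of_real (u powr (m + 1/2))"
      using u powr_of_real[of u "m + 1/2"] by (simp add: mu)
    moreover have "exp (- (complex_of_real u / 2)) = of_real (exp (- u / 2))" by (simp add: exp_of_real[symmetric])
    ultimately show ?thesis using u
      by (simp add: mell_def w polyw_def poly_altdef degree_laguerre_poly sum_distrib_left e mult_ac)
  qed
  ultimately show ?thesis
    by (subst (asm) set_integrable_cong[OF refl, of _ _ _ "mell \<nu>"]) auto
qed

lemma is_Whittaker_W_imp:
  assumes "is_Whittaker_W (of_real k) \<mu> w"
  obtains w1 where "whittaker_W k \<mu> w w1"
proof -
  obtain w1 w2 where a: "\<And>x. x > 0 \<Longrightarrow> (w has_vector_derivative w1 x) (at x)"
    "\<And>x. x > 0 \<Longrightarrow> (w1 has_vector_derivative w2 x) (at x)"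
    "\<And>x. x > 0 \<Longrightarrow> w2 x + (- 1/4 + of_real k / of_real x + (1/4 - \<mu>\<^sup>2) / of_real x ^ 2) * w x = 0"
    and lim: "((\<lambda>x. w x / (exp (- of_real x / 2) * of_real x powr of_real k)) \<longlongrightarrow> 1) at_top"
    using assms unfolding is_Whittaker_W_def by auto
  have "w2 x = (1/4 - of_real k / of_real x - (1/4 - \<mu>\<^sup>2) / of_real x ^ 2) * w x" if "x > 0" for x
    using a(3)[OF that] by (simp add: algebra_simps add_eq_0_iff)
  with a(1,2) lim have "whittaker_W k \<mu> w w1" by unfold_locales auto
  then show ?thesis using that by blast
qed

section \<open>Matrices and similitudes\<close>

lemma mat2_nth [simp]:
  "mat2 a b c d $ 1 $ 1 = a" "mat2 a b c d $ 1 $ 2 = b" "mat2 a b c d $ 2 $ 1 = c" "mat2 a b c d $ 2 $ 2 = d"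
  by (simp_all add: mat2_def)

lemma mat2_eq_iff: "A = B \<longleftrightarrow> A$1$1 = B$1$1 \<and> A$1$2 = B$1$2 \<and> A$2$1 = B$2$1 \<and> A$2$2 = B$2$2"
  for A B :: "'a^2^2"
  by (auto simp: vec_eq_iff forall_2)

lemma mat2_eta: "mat2 (A$1$1) (A$1$2) (A$2$1) (A$2$2) = A"
  by (simp add: mat2_eq_iff)

lemma mat2_ops:
  fixes a b c d :: "'a::comm_ring_1"
  shows "mat2 a b c d ** mat2 a' b' c' d' = mat2 (a*a' + b*c') (a*b' + b*d') (c*a' + d*c') (c*b' + d*d')"
    "mat2 a b c d + mat2 a' b' c' d' = mat2 (a + a') (b + b') (c + c') (d + d')"
    "mat2 a b c d - mat2 a' b' c' d' = mat2 (a - a') (b - b') (c - c') (d - d')"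
    "- mat2 a b c d = mat2 (- a) (- b) (- c) (- d)"
    "transpose (mat2 a b c d) = mat2 a c b d"
    "det (mat2 a b c d) = a * d - b * c"
    "trace (mat2 a b c d) = a + d"
    "mat a = mat2 a 0 0 a"
    "0 = mat2 0 0 0 (0::'a)"
  by (simp_all add: mat2_eq_iff matrix_matrix_mult_def sum_2 transpose_def det_2 trace_def mat_def)

lemma cmat_nth [simp]: "cmat A $ i $ j = of_real (A $ i $ j)"
  by (simp add: cmat_def map_matrix_def)

lemma cmat_mat2: "cmat (mat2 a b c d) = mat2 (of_real a) (of_real b) (of_real c) (of_real d)"
  by (simp add: mat2_eq_iff)

lemma scaleR_mat2: "r *\<^sub>R mat2 a b c d = mat2 (r *\<^sub>R a) (r *\<^sub>R b) (r *\<^sub>R c) (r *\<^sub>R d)"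
  for a :: "'a::real_vector"
  by (simp add: mat2_eq_iff)

definition hc :: "complex^'n^'m \<Rightarrow> complex^'m^'n" where
  "hc A = map_matrix cnj (transpose A)"

lemma hc_nth [simp]: "hc A $ i $ j = cnj (A $ j $ i)"
  by (simp add: hc_def map_matrix_def transpose_def)

lemma hc_mult: "hc (A ** B) = hc B ** hc A"
  by (simp add: vec_eq_iff matrix_matrix_mult_def mult.commute)

lemma scaleR_matrix_mult:
  fixes A :: "'a::real_algebra_1^'n^'m"
  shows "(r *\<^sub>R A) ** B = r *\<^sub>R (A ** B)" "A ** (r *\<^sub>R B) = r *\<^sub>R (A ** B)"
  by (simp_all add: vec_eq_iff matrix_matrix_mult_def scaleR_sum_right)

lemma cmat_mult: "cmat (A ** B) = cmat A ** cmat B"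
  by (simp add: mat2_eq_iff matrix_matrix_mult_def sum_2)

lemma cmat_simps:
  "cmat (A + B) = cmat A + cmat B" "cmat (A - B) = cmat A - cmat B" "cmat (- A) = - cmat A" "cmat 0 = 0"
  "cmat (mat r) = mat (of_real r)" "cmat (r *\<^sub>R A) = r *\<^sub>R cmat A" "hc (cmat A) = cmat (transpose A)"
  by (auto simp: mat2_eq_iff mat_def transpose_def scaleR_conv_of_real[where 'a=complex])

lemma cmat_inject [simp]: "cmat A = cmat B \<longleftrightarrow> A = B"
  by (simp add: mat2_eq_iff)

lemma mat4_eq_iff:
  "A = B \<longleftrightarrow> (A$1$1 = B$1$1 \<and> A$1$2 = B$1$2 \<and> A$1$3 = B$1$3 \<and> A$1$4 = B$1$4) \<and>
     (A$2$1 = B$2$1 \<and> A$2$2 = B$2$2 \<and> A$2$3 = B$2$3 \<and> A$2$4 = B$2$4) \<and>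
     (A$3$1 = B$3$1 \<and> A$3$2 = B$3$2 \<and> A$3$3 = B$3$3 \<and> A$3$4 = B$3$4) \<and>
     (A$4$1 = B$4$1 \<and> A$4$2 = B$4$2 \<and> A$4$3 = B$4$3 \<and> A$4$4 = B$4$4)"
  for A B :: "'a^4^4"
  by (auto simp: vec_eq_iff forall_4)

lemma blk_nth [simp]:
  "blk A B C D $ 1 $ 1 = A$1$1" "blk A B C D $ 1 $ 2 = A$1$2" "blk A B C D $ 1 $ 3 = B$1$1" "blk A B C D $ 1 $ 4 = B$1$2"
  "blk A B C D $ 2 $ 1 = A$2$1" "blk A B C D $ 2 $ 2 = A$2$2" "blk A B C D $ 2 $ 3 = B$2$1" "blk A B C D $ 2 $ 4 = B$2$2"
  "blk A B C D $ 3 $ 1 = C$1$1" "blk A B C D $ 3 $ 2 = C$1$2" "blk A B C D $ 3 $ 3 = D$1$1" "blk A B C D $ 3 $ 4 = D$1$2"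
  "blk A B C D $ 4 $ 1 = C$2$1" "blk A B C D $ 4 $ 2 = C$2$2" "blk A B C D $ 4 $ 3 = D$2$1" "blk A B C D $ 4 $ 4 = D$2$2"
  by (simp_all add: blk_def)

lemma blk_parts [simp]: "blkA (blk A B C D) = A" "blkB (blk A B C D) = B" "blkC (blk A B C D) = C" "blkD (blk A B C D) = D"
  by (simp_all add: mat2_eq_iff blkA_def blkB_def blkC_def blkD_def)

lemma blk_eta: "blk (blkA g) (blkB g) (blkC g) (blkD g) = g"
  by (simp add: mat4_eq_iff blkA_def blkB_def blkC_def blkD_def)

lemma blk_inject: "blk A B C D = blk A' B' C' D' \<longleftrightarrow> A = A' \<and> B = B' \<and> C = C' \<and> D = D'"
  by (metis blk_parts)

lemma blk_mult: "blk A B C D ** blk A' B' C' D' = blk (A ** A' + B ** C') (A ** B' + B ** D') (C ** A' + D ** C') (C ** B' + D ** D')"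
  by (simp add: mat4_eq_iff matrix_matrix_mult_def sum_4 sum_2 algebra_simps)

lemma blk_hc: "hc (blk A B C D) = blk (hc A) (hc C) (hc B) (hc D)"
  by (simp add: mat4_eq_iff)

lemma transpose_blk: "transpose (blk A B C D) = blk (transpose A) (transpose C) (transpose B) (transpose D)"
  by (simp add: mat4_eq_iff transpose_def)

lemma blk_scaleR: "r *\<^sub>R blk A B C D = blk (r *\<^sub>R A) (r *\<^sub>R B) (r *\<^sub>R C) (r *\<^sub>R D)"
  by (simp add: mat4_eq_iff)

lemma mat4_blk: "mat a = blk (mat a) 0 0 (mat a)"
  by (simp add: mat4_eq_iff mat_def)

lemma matrix_mul_0 [simp]: "0 ** A = 0" "A ** 0 = 0"
  for A :: "'a::comm_ring_1^2^2"
  by (simp_all add: vec_eq_iff matrix_matrix_mult_def)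

lemma matrix_neg_mul [simp]: "(- A) ** B = - (A ** B)" "C ** (- D) = - (C ** D)"
  for A C :: "'a::comm_ring_1^'n^'m"
  by (simp_all add: vec_eq_iff matrix_matrix_mult_def sum_negf)

lemma mat_uminus: "- mat a = mat (- a)" for a :: "'a::comm_ring_1"
  by (simp add: vec_eq_iff mat_def)

lemma has_similitude_alt: "has_similitude g \<mu> \<longleftrightarrow> hc g ** Jsymp ** g = \<mu> *\<^sub>R Jsymp"
  by (simp add: has_similitude_def hc_def)

lemma has_similitude_blk:
  "has_similitude (blk A B C D) \<mu> \<longleftrightarrow> hc A ** C = hc C ** A \<and> hc B ** D = hc D ** B \<and>
     hc A ** D - hc C ** B = mat (of_real \<mu>) \<and> hc B ** C - hc D ** A = mat (- of_real \<mu>)"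
proof -
  have [simp]: "\<mu> *\<^sub>R mat 1 = (mat (of_real \<mu>) :: complex^2^2)" "\<mu> *\<^sub>R - mat 1 = (mat (- of_real \<mu>) :: complex^2^2)"
    by (auto simp: mat2_eq_iff mat_def scaleR_conv_of_real[where 'a=complex])
  have "hc (blk A B C D) ** Jsymp ** blk A B C D = blk (hc A ** C - hc C ** A) (hc A ** D - hc C ** B) (hc B ** C - hc D ** A) (hc B ** D - hc D ** B)"
    by (simp add: blk_hc Jsymp_def blk_mult)
  then show ?thesis
    unfolding has_similitude_alt Jsymp_def blk_scaleR by (auto simp: blk_inject mat_uminus[of "complex_of_real \<mu>"])
qed

lemma Jsymp_sq: "Jsymp ** Jsymp = - mat 1"
  by (simp add: Jsymp_def mat4_eq_iff matrix_matrix_mult_def sum_4 mat_def)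

lemma has_similitude_unique: "has_similitude g a \<Longrightarrow> has_similitude g b \<Longrightarrow> a = b"
proof -
  assume "has_similitude g a" "has_similitude g b"
  then have "a *\<^sub>R Jsymp = b *\<^sub>R Jsymp" by (simp add: has_similitude_def)
  then have "(a *\<^sub>R Jsymp)$1$3 = (b *\<^sub>R Jsymp)$1$3" by (simp only:)
  then show "a = b" by (simp add: Jsymp_def mat_def)
qed

lemma similitude_eq: "has_similitude g \<mu> \<Longrightarrow> similitude g = \<mu>"
  unfolding similitude_def by (rule the_equality) (auto intro: has_similitude_unique)

lemma has_similitude_mult:
  assumes "has_similitude g a" "has_similitude h b"
  shows "has_similitude (g ** h) (a * b)"
proof -
  have "hc (g ** h) ** Jsymp ** (g ** h) = hc h ** (hc g ** Jsymp ** g) ** h"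
    by (simp add: hc_mult matrix_mul_assoc)
  also have "\<dots> = hc h ** (a *\<^sub>R Jsymp) ** h" using assms(1) by (simp add: has_similitude_alt)
  also have "\<dots> = a *\<^sub>R (hc h ** Jsymp ** h)"
    by (simp add: scaleR_matrix_mult)
  also have "\<dots> = (a * b) *\<^sub>R Jsymp" using assms(2) by (simp add: has_similitude_alt)
  finally show ?thesis by (simp add: has_similitude_alt)
qed

text \<open>As J^2 = -1, the relation g* J g = \<mu> J exhibits an inverse of g explicitly.\<close>

lemma has_similitude_inverse:
  assumes "has_similitude g \<mu>" "\<mu> \<noteq> 0"
  shows "((- 1 / \<mu>) *\<^sub>R (Jsymp ** hc g ** Jsymp)) ** g = mat 1" "g ** ((- 1 / \<mu>) *\<^sub>R (Jsymp ** hc g ** Jsymp)) = mat 1"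
proof -
  have "((- 1 / \<mu>) *\<^sub>R (Jsymp ** hc g ** Jsymp)) ** g = (- 1 / \<mu>) *\<^sub>R (Jsymp ** (hc g ** Jsymp ** g))"
    by (simp only: scaleR_matrix_mult matrix_mul_assoc)
  also have "\<dots> = (- 1 / \<mu>) *\<^sub>R (Jsymp ** (\<mu> *\<^sub>R Jsymp))" using assms(1) by (simp only: has_similitude_alt)
  also have "\<dots> = (- 1 / \<mu> * \<mu>) *\<^sub>R (Jsymp ** Jsymp)"
    by (simp add: scaleR_matrix_mult)
  also have "\<dots> = mat 1" using assms(2) by (simp add: Jsymp_sq)
  finally show 1: "((- 1 / \<mu>) *\<^sub>R (Jsymp ** hc g ** Jsymp)) ** g = mat 1" .
  then show "g ** ((- 1 / \<mu>) *\<^sub>R (Jsymp ** hc g ** Jsymp)) = mat 1"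
    using matrix_left_right_inverse by blast
qed

lemma grpG_iff: "g \<in> grpG \<longleftrightarrow> (\<exists>\<mu>. \<mu> \<noteq> 0 \<and> has_similitude g \<mu>)"
  unfolding grpG_def invertible_def using has_similitude_inverse by blast

lemma grpG_mult: "g \<in> grpG \<Longrightarrow> h \<in> grpG \<Longrightarrow> g ** h \<in> grpG"
  unfolding grpG_iff by (metis has_similitude_mult mult_eq_0_iff)

lemma similitude_mult: "g \<in> grpG \<Longrightarrow> h \<in> grpG \<Longrightarrow> similitude (g ** h) = similitude g * similitude h"
  unfolding grpG_iff using has_similitude_mult similitude_eq by blast

lemma has_similitude_similitude: "g \<in> grpG \<Longrightarrow> has_similitude g (similitude g)"
  unfolding grpG_iff using similitude_eq by blast

text \<open>The explicit inverse is two-sided, so the relation also holds with g and g* exchanged.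
  It yields the symmetry of C D^t for the lower blocks, on which the decomposition of H+
  rests.\<close>

lemma similitude_transpose_relation:
  assumes "has_similitude g \<mu>" "\<mu> \<noteq> 0"
  shows "g ** Jsymp ** hc g = \<mu> *\<^sub>R Jsymp"
proof -
  have "g ** ((- 1 / \<mu>) *\<^sub>R (Jsymp ** hc g ** Jsymp)) ** Jsymp = mat 1 ** Jsymp"
    using has_similitude_inverse(2)[OF assms] by simp
  moreover have "g ** ((- 1 / \<mu>) *\<^sub>R (Jsymp ** hc g ** Jsymp)) ** Jsymp = (- 1 / \<mu>) *\<^sub>R (g ** Jsymp ** hc g ** (Jsymp ** Jsymp))"
    by (simp only: scaleR_matrix_mult matrix_mul_assoc)
  moreover have "\<dots> = (1 / \<mu>) *\<^sub>R (g ** Jsymp ** hc g)"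
    by (simp add: Jsymp_sq)
  ultimately have "\<mu> *\<^sub>R ((1 / \<mu>) *\<^sub>R (g ** Jsymp ** hc g)) = \<mu> *\<^sub>R Jsymp" by simp
  then show ?thesis using assms(2) by simp
qed

text \<open>Elements of H(R) are complex matrices here; \<open>rblk\<close> records their real
  blocks, so that real linear algebra applies to them.\<close>

definition rblk :: "real^2^2 \<Rightarrow> real^2^2 \<Rightarrow> real^2^2 \<Rightarrow> real^2^2 \<Rightarrow> complex^4^4" where
  "rblk A B C D = blk (cmat A) (cmat B) (cmat C) (cmat D)"

lemma rblk_mult: "rblk A B C D ** rblk A' B' C' D' = rblk (A ** A' + B ** C') (A ** B' + B ** D') (C ** A' + D ** C') (C ** B' + D ** D')"
  by (simp add: rblk_def blk_mult cmat_mult cmat_simps)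

lemma real_rblk: "(\<forall>i j. g $ i $ j \<in> \<real>) \<longleftrightarrow> (\<exists>A B C D. g = rblk A B C D)"
proof
  assume "\<forall>i j. g $ i $ j \<in> \<real>"
  then have "of_real (Re (g $ i $ j)) = g $ i $ j" for i j by simp
  then have "g = rblk (mat2 (Re (g$1$1)) (Re (g$1$2)) (Re (g$2$1)) (Re (g$2$2))) (mat2 (Re (g$1$3)) (Re (g$1$4)) (Re (g$2$3)) (Re (g$2$4)))
     (mat2 (Re (g$3$1)) (Re (g$3$2)) (Re (g$4$1)) (Re (g$4$2))) (mat2 (Re (g$3$3)) (Re (g$3$4)) (Re (g$4$3)) (Re (g$4$4)))"
    by (simp add: mat4_eq_iff rblk_def)
  then show "\<exists>A B C D. g = rblk A B C D" by blast
next
  assume "\<exists>A B C D. g = rblk A B C D"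
  then show "\<forall>i j. g $ i $ j \<in> \<real>" by (auto simp: forall_4 rblk_def)
qed

lemma has_similitude_rblk:
  "has_similitude (rblk A B C D) \<mu> \<longleftrightarrow> transpose A ** C = transpose C ** A \<and> transpose B ** D = transpose D ** B \<and>
     transpose A ** D - transpose C ** B = mat \<mu>"
proof -
  have "transpose B ** C - transpose D ** A = mat (- \<mu>)" if "transpose A ** D - transpose C ** B = mat \<mu>"
  proof -
    have "transpose (transpose A ** D - transpose C ** B) = transpose (mat \<mu>)" using that by simp
    then show ?thesis by (auto simp: mat2_eq_iff transpose_def matrix_matrix_mult_def sum_2 mat_def algebra_simps)
  qed
  moreover have e: "mat (complex_of_real \<mu>) = cmat (mat \<mu>)" "mat (- complex_of_real \<mu>) = cmat (mat (- \<mu>))" by (simp_all add: cmat_simps)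
  ultimately show ?thesis
    unfolding rblk_def has_similitude_blk e cmat_simps(7) cmat_mult[symmetric] cmat_simps(2)[symmetric] cmat_inject by blast
qed

lemma rblk_transpose_relation:
  assumes "has_similitude (rblk A B C D) \<mu>" "\<mu> \<noteq> 0"
  shows "C ** transpose D = D ** transpose C" "A ** transpose D - B ** transpose C = mat \<mu>"
proof -
  have r: "rblk A B C D ** Jsymp ** hc (rblk A B C D) = \<mu> *\<^sub>R Jsymp"
    using assms by (rule similitude_transpose_relation)
  have J: "Jsymp = rblk 0 (mat 1) (- mat 1) 0" by (simp add: Jsymp_def rblk_def cmat_simps)
  have h: "hc (rblk A B C D) = rblk (transpose A) (transpose C) (transpose B) (transpose D)"
    by (simp add: rblk_def blk_hc cmat_simps)
  have m: "\<mu> *\<^sub>R Jsymp = rblk 0 (mat \<mu>) (mat (- \<mu>)) 0"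
    unfolding Jsymp_def blk_scaleR rblk_def blk_inject by (simp add: mat2_eq_iff mat_def scaleR_conv_of_real[where 'a=complex])
  have "rblk (A ** transpose B - B ** transpose A) (A ** transpose D - B ** transpose C) (C ** transpose B - D ** transpose A) (C ** transpose D - D ** transpose C)
      = rblk A B C D ** rblk 0 (mat 1) (- mat 1) 0 ** rblk (transpose A) (transpose C) (transpose B) (transpose D)"
    unfolding rblk_mult by simp
  also have "\<dots> = rblk 0 (mat \<mu>) (mat (- \<mu>)) 0" using r unfolding m h unfolding J .
  finally have "rblk (A ** transpose B - B ** transpose A) (A ** transpose D - B ** transpose C) (C ** transpose B - D ** transpose A) (C ** transpose D - D ** transpose C)
      = rblk 0 (mat \<mu>) (mat (- \<mu>)) 0" .
  then show "C ** transpose D = D ** transpose C" "A ** transpose D - B ** transpose C = mat \<mu>"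
    by (auto simp: rblk_def blk_inject)
qed

lemma grpH_iff: "h \<in> grpH \<longleftrightarrow> (\<exists>A B C D \<mu>. h = rblk A B C D \<and> \<mu> \<noteq> 0 \<and> has_similitude h \<mu>)"
  unfolding grpH_def using real_rblk[of h] by (auto simp: grpG_iff)

lemma grpH_mult: "g \<in> grpH \<Longrightarrow> h \<in> grpH \<Longrightarrow> g ** h \<in> grpH"
proof -
  assume *: "g \<in> grpH" "h \<in> grpH"
  then have "g ** h \<in> grpG" by (auto simp: grpH_def intro: grpG_mult)
  moreover obtain A B C D A' B' C' D' where "g = rblk A B C D" "h = rblk A' B' C' D'" using * unfolding grpH_iff by blast
  ultimately show ?thesis unfolding grpH_def using rblk_mult real_rblk by blast
qed

lemma grpHplus_iff: "h \<in> grpHplus \<longleftrightarrow> h \<in> grpH \<and> similitude h > 0"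
  by (auto simp: grpHplus_def grpGplus_def grpH_def)

lemma grpHplus_iff2: "h \<in> grpHplus \<longleftrightarrow> (\<exists>A B C D \<mu>. h = rblk A B C D \<and> \<mu> > 0 \<and> has_similitude h \<mu>)"
  unfolding grpHplus_iff grpH_iff using similitude_eq by (metis less_numeral_extra(3))

lemma Jfac_blk: "Jfac (blk A B C D) basept = C ** mat \<i> + D"
  by (simp add: Jfac_def basept_def)

lemma moebius_blk: "moebius (blk A B C D) basept = (A ** mat \<i> + B) ** matrix_inv (C ** mat \<i> + D)"
  by (simp add: moebius_def basept_def)

lemma invertible_mult:
  fixes A :: "'a::semiring_1^'n^'n"
  assumes "invertible A"
  shows "A ** matrix_inv A = mat 1" "matrix_inv A ** A = mat 1"
  using someI_ex[OF assms[unfolded invertible_def]] by (auto simp: matrix_inv_def)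

lemma matrix_distrib_right: "(A + B) ** C = A ** C + B ** C"
  for A :: "'a::comm_ring_1^'n^'m"
  by (simp add: vec_eq_iff matrix_matrix_mult_def sum.distrib distrib_right)

lemma matrix_inv_eqI:
  fixes A :: "'a::field^'n^'n"
  assumes "A ** B = mat 1"
  shows "matrix_inv A = B"
proof -
  have BA: "B ** A = mat 1" using assms matrix_left_right_inverse by blast
  then have "invertible A" using assms unfolding invertible_def by blast
  then have "matrix_inv A ** A = mat 1" by (rule invertible_mult)
  then have "matrix_inv A ** A ** B = B" by simp
  then show ?thesis using assms by (simp add: matrix_mul_assoc[symmetric])
qed

lemma mat_commute: "A ** mat c = mat c ** A" for A :: "'a::comm_ring_1^2^2"
  by (simp add: mat2_eq_iff matrix_matrix_mult_def sum_2 mat_def mult.commute)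

lemma det_scaleR2: "det (r *\<^sub>R A) = r\<^sup>2 * det A" for A :: "real^2^2"
  by (simp add: det_2 power2_eq_square algebra_simps)

text \<open>With P = A i + B and N = C i + D the similitude relations give N* P - P* N = 2 i \<mu>.
  Evaluated at a vector v with N v = 0, the left side is 0 and the right side is 2 i \<mu>
  |v|^2.\<close>

lemma invertible_Jfac:
  assumes s: "has_similitude g \<mu>" and \<mu>: "\<mu> \<noteq> 0"
  shows "invertible (Jfac g basept)"
proof -
  define A B C D where "A = blkA g" and "B = blkB g" and "C = blkC g" and "D = blkD g"
  have g: "g = blk A B C D" by (simp add: A_def B_def C_def D_def blk_eta)
  define N P where "N = C ** mat \<i> + D" and "P = A ** mat \<i> + B"
  have r: "hc A ** C = hc C ** A" "hc B ** D = hc D ** B" "hc A ** D - hc C ** B = mat (of_real \<mu>)" "hc B ** C - hc D ** A = mat (- of_real \<mu>)"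
    using s unfolding g has_similitude_blk by auto
  have NP: "hc N ** P - hc P ** N = mat (2 * \<i> * of_real \<mu>)"
  proof -
    have "hc N ** P - hc P ** N = (hc C ** A - hc A ** C) + (hc D ** B - hc B ** D) + mat \<i> ** (hc A ** D - hc C ** B) - mat \<i> ** (hc B ** C - hc D ** A)"
      by (simp add: N_def P_def mat2_eq_iff matrix_matrix_mult_def sum_2 mat_def) (simp add: algebra_simps)
    then show ?thesis unfolding r by (simp add: mat2_eq_iff matrix_matrix_mult_def sum_2 mat_def)
  qed
  have "v = 0" if v: "N *v v = 0" for v
  proof -
    define n1 n2 where "n1 = N$1$1 * v$1 + N$1$2 * v$2" and "n2 = N$2$1 * v$1 + N$2$2 * v$2"
    have n: "n1 = 0" "n2 = 0" using v by (auto simp: n1_def n2_def vec_eq_iff forall_2 matrix_vector_mult_def sum_2)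
    define p1 p2 where "p1 = P$1$1 * v$1 + P$1$2 * v$2" and "p2 = P$2$1 * v$1 + P$2$2 * v$2"
    define L where "L = hc N ** P - hc P ** N"
    have "cnj (v$1) * (L$1$1 * v$1 + L$1$2 * v$2) + cnj (v$2) * (L$2$1 * v$1 + L$2$2 * v$2) = cnj n1 * p1 + cnj n2 * p2 - (cnj p1 * n1 + cnj p2 * n2)"
      by (simp add: L_def n1_def n2_def p1_def p2_def matrix_matrix_mult_def sum_2) (simp add: algebra_simps)
    also have "\<dots> = 0" by (simp add: n)
    also have "cnj (v$1) * (L$1$1 * v$1 + L$1$2 * v$2) + cnj (v$2) * (L$2$1 * v$1 + L$2$2 * v$2) = 2 * \<i> * of_real \<mu> * of_real ((cmod (v$1))\<^sup>2 + (cmod (v$2))\<^sup>2)"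
      unfolding L_def NP by (simp add: mat_def complex_norm_square del: of_real_power) (simp add: algebra_simps)
    finally have "(cmod (v$1))\<^sup>2 + (cmod (v$2))\<^sup>2 = 0" using \<mu> by (simp del: of_real_add)
    then show ?thesis by (simp add: vec_eq_iff forall_2 add_nonneg_eq_0_iff)
  qed
  then obtain Ni where "Ni ** N = mat 1" using matrix_left_invertible_ker[of N] by blast
  moreover from this have "N ** Ni = mat 1" using matrix_left_right_inverse by blast
  ultimately show ?thesis unfolding g Jfac_blk N_def[symmetric] invertible_def by blast
qed

lemma KinfI:
  assumes "has_similitude k 1" "blkA k ** mat \<i> + blkB k = mat \<i> ** Jfac k basept"
  shows "k \<in> Kinf"
proof -
  have "invertible (Jfac k basept)" using invertible_Jfac[OF assms(1)] by simp
  then have "moebius k basept = basept"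
    using assms(2) by (simp add: moebius_def Jfac_def basept_def matrix_mul_assoc[symmetric] invertible_mult)
  moreover have "k \<in> grpG" "similitude k = 1" using assms(1) by (auto simp: grpG_iff similitude_eq intro!: exI[of _ 1])
  ultimately show ?thesis by (simp add: Kinf_def grpGplus_def)
qed

text \<open>Fixing the base point means P = i N. Inserted into the identity N* P - P* N = 2 i this
  leaves N* N = 1, so J(k, I) is unitary.\<close>

lemma KinfD:
  assumes "k \<in> Kinf"
  shows "has_similitude k 1" "blkA k ** mat \<i> + blkB k = mat \<i> ** Jfac k basept"
    "invertible (Jfac k basept)" "hc (Jfac k basept) ** Jfac k basept = mat 1"
proof -
  have k: "k \<in> grpG" "similitude k = 1" "moebius k basept = basept"
    using assms by (auto simp: Kinf_def grpGplus_def)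
  show s: "has_similitude k 1" using has_similitude_similitude[OF k(1)] k(2) by simp
  show inv: "invertible (Jfac k basept)" using invertible_Jfac[OF s] by simp
  have "(blkA k ** mat \<i> + blkB k) ** matrix_inv (Jfac k basept) ** Jfac k basept = mat \<i> ** Jfac k basept"
    using k(3) by (simp add: moebius_def Jfac_def basept_def)
  then show P: "blkA k ** mat \<i> + blkB k = mat \<i> ** Jfac k basept"
    using inv by (simp add: matrix_mul_assoc[symmetric] invertible_mult)
  define A B C D where "A = blkA k" and "B = blkB k" and "C = blkC k" and "D = blkD k"
  have g: "k = blk A B C D" by (simp add: A_def B_def C_def D_def blk_eta)
  define N where "N = C ** mat \<i> + D"
  have N: "Jfac k basept = N" by (simp add: N_def g Jfac_blk)
  have r: "hc A ** C = hc C ** A" "hc B ** D = hc D ** B" "hc A ** D - hc C ** B = mat 1" "hc B ** C - hc D ** A = mat (- 1)"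
    using s unfolding g has_similitude_blk by auto
  have "hc N ** (A ** mat \<i> + B) - hc (A ** mat \<i> + B) ** N = (hc C ** A - hc A ** C) + (hc D ** B - hc B ** D) + mat \<i> ** (hc A ** D - hc C ** B) - mat \<i> ** (hc B ** C - hc D ** A)"
    by (simp add: N_def mat2_eq_iff matrix_matrix_mult_def sum_2 mat_def) (simp add: algebra_simps)
  moreover have "A ** mat \<i> + B = mat \<i> ** N" using P unfolding N by (simp add: A_def B_def)
  ultimately have "hc N ** (mat \<i> ** N) - hc (mat \<i> ** N) ** N = (0 + 0 + mat \<i> ** mat 1) - mat \<i> ** mat (- 1)"
    using r by simp
  also have "\<dots> = mat (2 * \<i>)" by (simp add: mat2_eq_iff matrix_matrix_mult_def sum_2 mat_def)
  finally have "hc N ** (mat \<i> ** N) - hc (mat \<i> ** N) ** N = mat (2 * \<i>)" .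
  moreover have "hc N ** (mat \<i> ** N) - hc (mat \<i> ** N) ** N = mat (2 * \<i>) ** (hc N ** N)"
    by (simp add: mat2_eq_iff matrix_matrix_mult_def sum_2 mat_def algebra_simps)
  ultimately show "hc (Jfac k basept) ** Jfac k basept = mat 1"
    unfolding N by (simp add: mat2_eq_iff matrix_matrix_mult_def sum_2 mat_def)
qed

text \<open>The cocycle relation for J becomes plain multiplicativity because the second factor
  fixes the base point.\<close>

lemma Kinf_mult:
  assumes "k \<in> Kinf" "k' \<in> Kinf"
  shows "k ** k' \<in> Kinf" "Jfac (k ** k') basept = Jfac k basept ** Jfac k' basept"
proof -
  define A B C D where "A = blkA k" and "B = blkB k" and "C = blkC k" and "D = blkD k"
  have g: "k = blk A B C D" by (simp add: A_def B_def C_def D_def blk_eta)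
  define A' B' C' D' where "A' = blkA k'" and "B' = blkB k'" and "C' = blkC k'" and "D' = blkD k'"
  have g': "k' = blk A' B' C' D'" by (simp add: A'_def B'_def C'_def D'_def blk_eta)
  have P: "A ** mat \<i> + B = mat \<i> ** (C ** mat \<i> + D)" using KinfD(2)[OF assms(1)] by (simp add: g Jfac_blk)
  have P': "A' ** mat \<i> + B' = mat \<i> ** (C' ** mat \<i> + D')" using KinfD(2)[OF assms(2)] by (simp add: g' Jfac_blk)
  have J: "(C ** A' + D ** C') ** mat \<i> + (C ** B' + D ** D') = C ** (A' ** mat \<i> + B') + D ** (C' ** mat \<i> + D')"
    "(A ** A' + B ** C') ** mat \<i> + (A ** B' + B ** D') = A ** (A' ** mat \<i> + B') + B ** (C' ** mat \<i> + D')"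
    by (simp_all add: matrix_add_ldistrib matrix_distrib_right matrix_mul_assoc)
  have J1: "(C ** A' + D ** C') ** mat \<i> + (C ** B' + D ** D') = (C ** mat \<i> + D) ** (C' ** mat \<i> + D')"
    unfolding J P' by (simp add: matrix_distrib_right matrix_mul_assoc)
  have J2: "(A ** A' + B ** C') ** mat \<i> + (A ** B' + B ** D') = (A ** mat \<i> + B) ** (C' ** mat \<i> + D')"
    unfolding J P' by (simp add: matrix_distrib_right matrix_mul_assoc)
  show J3: "Jfac (k ** k') basept = Jfac k basept ** Jfac k' basept"
    by (simp add: g g' blk_mult Jfac_blk J1)
  show "k ** k' \<in> Kinf"
  proof (rule KinfI)
    show "has_similitude (k ** k') 1" using has_similitude_mult[OF KinfD(1)[OF assms(1)] KinfD(1)[OF assms(2)]] by simp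
    show "blkA (k ** k') ** mat \<i> + blkB (k ** k') = mat \<i> ** Jfac (k ** k') basept"
      unfolding J3 by (simp add: g g' blk_mult Jfac_blk J2 P matrix_mul_assoc)
  qed
qed

lemma KinfH_mult: "k \<in> KinfH \<Longrightarrow> k' \<in> KinfH \<Longrightarrow> k ** k' \<in> KinfH"
  by (auto simp: KinfH_def Kinf_mult grpH_mult)

lemma cmat_complex_inject: "cmat A + mat \<i> ** cmat B = cmat A' + mat \<i> ** cmat B' \<longleftrightarrow> A = A' \<and> B = B'"
  by (auto simp: mat2_eq_iff matrix_matrix_mult_def sum_2 mat_def complex_eq_iff)

lemma cmat_complex_hc:
  "(cmat D + mat \<i> ** cmat C) ** hc (cmat D + mat \<i> ** cmat C) =
     cmat (C ** transpose C + D ** transpose D) + mat \<i> ** cmat (C ** transpose D - D ** transpose C)"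
  "hc (cmat D + mat \<i> ** cmat C) ** (cmat D + mat \<i> ** cmat C) =
     cmat (transpose D ** D + transpose C ** C) + mat \<i> ** cmat (transpose D ** C - transpose C ** D)"
  by (simp_all add: mat2_eq_iff matrix_matrix_mult_def sum_2 mat_def transpose_def)
     (simp_all add: complex_eq_iff)

text \<open>The two conditions are the real and the imaginary part of N N* = 1 for N = D + i
  C.\<close>

lemma KinfH_iff: "k \<in> KinfH \<longleftrightarrow> (\<exists>C D. k = rblk D (- C) C D \<and> C ** transpose C + D ** transpose D = mat 1 \<and> C ** transpose D = D ** transpose C)"
proof
  assume k: "k \<in> KinfH"
  then have kK: "k \<in> Kinf" and kH: "k \<in> grpH" by (auto simp: KinfH_def)
  obtain A B C D where g: "k = rblk A B C D" using kH by (auto simp: grpH_iff)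
  have "cmat B + mat \<i> ** cmat A = cmat (- C) + mat \<i> ** cmat D"
    using KinfD(2)[OF kK] unfolding g rblk_def Jfac_blk
    by (simp add: mat2_eq_iff matrix_matrix_mult_def sum_2 mat_def algebra_simps)
  then have AB: "B = - C" "A = D" unfolding cmat_complex_inject by auto
  have N: "Jfac k basept = cmat D + mat \<i> ** cmat C" unfolding g rblk_def Jfac_blk by (simp add: mat_commute add.commute)
  have "Jfac k basept ** hc (Jfac k basept) = mat 1" using KinfD(4)[OF kK] matrix_left_right_inverse by blast
  then have "cmat (C ** transpose C + D ** transpose D) + mat \<i> ** cmat (C ** transpose D - D ** transpose C) = cmat (mat 1) + mat \<i> ** cmat 0"
    unfolding N cmat_complex_hc by (simp add: cmat_simps)
  then have "C ** transpose C + D ** transpose D = mat 1 \<and> C ** transpose D - D ** transpose C = 0"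
    unfolding cmat_complex_inject .
  then show "\<exists>C D. k = rblk D (- C) C D \<and> C ** transpose C + D ** transpose D = mat 1 \<and> C ** transpose D = D ** transpose C"
    using g AB by auto
next
  assume "\<exists>C D. k = rblk D (- C) C D \<and> C ** transpose C + D ** transpose D = mat 1 \<and> C ** transpose D = D ** transpose C"
  then obtain C D where k: "k = rblk D (- C) C D" and o: "C ** transpose C + D ** transpose D = mat 1" "C ** transpose D = D ** transpose C" by auto
  define N where "N = cmat D + mat \<i> ** cmat C"
  have "N ** hc N = mat 1" unfolding N_def cmat_complex_hc o by (simp add: cmat_simps)
  then have "hc N ** N = mat 1" using matrix_left_right_inverse by blast
  then have "cmat (transpose D ** D + transpose C ** C) + mat \<i> ** cmat (transpose D ** C - transpose C ** D) = cmat (mat 1) + mat \<i> ** cmat 0"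
    unfolding N_def cmat_complex_hc by (simp add: cmat_simps)
  then have r: "transpose D ** D + transpose C ** C = mat 1" "transpose D ** C = transpose C ** D"
    unfolding cmat_complex_inject by auto
  have tm: "transpose (- C) = - transpose C" by (simp add: mat2_eq_iff transpose_def)
  have s: "has_similitude k 1"
    unfolding k has_similitude_rblk tm using r by simp
  have "k \<in> Kinf"
    by (rule KinfI[OF s]) (simp add: k rblk_def Jfac_blk mat2_eq_iff matrix_matrix_mult_def sum_2 mat_def algebra_simps)
  moreover have "k \<in> grpH" unfolding grpH_iff using s k zero_neq_one by metis
  ultimately show "k \<in> KinfH" by (simp add: KinfH_def)
qed

text \<open>\<open>f_K\<close> sees its argument g through g g^t and through J(g, I); by this
  orthogonality k drops out of the former.\<close>

lemma KinfH_transpose: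
  assumes "k \<in> KinfH"
  shows "k ** transpose k = mat 1"
proof -
  obtain C D where k: "k = rblk D (- C) C D" and o: "C ** transpose C + D ** transpose D = mat 1" "C ** transpose D = D ** transpose C"
    using assms by (auto simp: KinfH_iff)
  have t: "transpose (- C) = - transpose C" by (simp add: mat2_eq_iff transpose_def)
  have tk: "transpose k = rblk (transpose D) (transpose C) (- transpose C) (transpose D)"
    unfolding k rblk_def transpose_blk by (simp add: blk_inject) (simp add: mat2_eq_iff transpose_def)
  show ?thesis unfolding tk unfolding k rblk_mult using o
    by (simp add: add.commute) (simp add: rblk_def mat4_blk cmat_simps)
qed

section \<open>Double cosets\<close>

lemma rot_mult: "rot s ** rot t = rot (s + t)"
  by (simp add: rot_def mat2_ops mat2_eq_iff cos_add sin_add algebra_simps)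

lemma rot_0: "rot 0 = mat 1"
  by (simp add: rot_def mat2_eq_iff mat_def)

lemma transpose_rot: "transpose (rot t) = rot (- t)"
  by (simp add: rot_def mat2_ops)

lemma det_rot: "det (rot t) = 1"
  by (simp add: rot_def mat2_ops flip: power2_eq_square)

lemma real_mat_ops:
  fixes A B :: "real^2^2"
  shows "transpose (A ** B) = transpose B ** transpose A" "transpose (r *\<^sub>R A) = r *\<^sub>R transpose A"
    "transpose (A + B) = transpose A + transpose B"
    "mat c ** A = c *\<^sub>R A" "A ** mat c = c *\<^sub>R A" "transpose (mat c :: real^2^2) = mat c"
  by (simp_all add: mat2_eq_iff transpose_def matrix_matrix_mult_def sum_2 mat_def algebra_simps)

lemma transpose_0 [simp]: "transpose (0::real^2^2) = 0"
  by (simp add: mat2_eq_iff transpose_def)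

text \<open>The entries of the hypothesis combine to (u - z)^2 + (v + w)^2 = 0, so G is the matrix
  of a complex number, and its determinant is the squared modulus.\<close>

lemma polar_decomposition:
  fixes G :: "real^2^2"
  assumes G: "transpose G ** G = det G *\<^sub>R mat 1" and d: "det G \<noteq> 0"
  obtains y t where "y > 0" "G = y *\<^sub>R rot t" "det G = y\<^sup>2"
proof -
  obtain u v w z where g: "G = mat2 u v w z" by (metis mat2_eta)
  have e: "u * u + w * w = u * z - v * w" "v * v + z * z = u * z - v * w"
    using G by (simp_all add: g mat2_ops scaleR_mat2 mat2_eq_iff)
  have "(u - z)\<^sup>2 + (v + w)\<^sup>2 = 0" using e by (simp add: power2_eq_square algebra_simps)
  then have zv: "z = u" "v = - w" by (simp_all add: sum_power2_eq_zero_iff)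
  have dd: "det G = u\<^sup>2 + w\<^sup>2" by (simp add: g mat2_ops zv power2_eq_square)
  define y where "y = sqrt (u\<^sup>2 + w\<^sup>2)"
  have "u\<^sup>2 + w\<^sup>2 > 0" using d dd by (metis order_le_less sum_power2_ge_zero)
  then have y: "y > 0" unfolding y_def by (rule real_sqrt_gt_zero)
  have y2: "y\<^sup>2 = u\<^sup>2 + w\<^sup>2" unfolding y_def by simp
  have "(u / y)\<^sup>2 + (- w / y)\<^sup>2 = (u\<^sup>2 + w\<^sup>2) / y\<^sup>2"
    by (simp add: power_divide add_divide_distrib)
  also have "\<dots> = 1" unfolding y2[symmetric] using y by simp
  finally have "(u / y)\<^sup>2 + (- w / y)\<^sup>2 = 1" .
  then obtain t where t: "u / y = cos t" "- w / y = sin t" using sincos_total_2pi[of "u / y" "- w / y"] by metis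
  have "u = y * cos t" "w = - (y * sin t)" using t y by (simp_all add: field_simps)
  then have "G = y *\<^sub>R rot t" by (simp add: g zv rot_def scaleR_mat2)
  moreover have "det G = y\<^sup>2" using dd by (simp add: y_def)
  ultimately show ?thesis using y that by blast
qed

lemma symmetric_entry: "transpose Q = Q \<Longrightarrow> Q$2$1 = Q$1$2" for Q :: "'a^2^2"
proof -
  assume "transpose Q = Q"
  then have "Q$2$1 = transpose Q $ 2 $ 1" by (simp only:)
  then show ?thesis by (simp add: transpose_def)
qed

text \<open>The traceless part of Q is r times a reflection with entries built from cos f and sin f;
  rotation by f / 2 diagonalizes it with eigenvalues -r and r.\<close>

lemma spectral2:
  fixes Q :: "real^2^2"
  assumes sym: "transpose Q = Q" and pos: "Q$1$1 > 0" "det Q > 0"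
  obtains e1 e2 t where "0 < e1" "e1 \<le> e2" "Q = rot t ** mat2 e1 0 0 e2 ** transpose (rot t)"
proof -
  define m \<delta> \<beta> where "m = (Q$1$1 + Q$2$2) / 2" and "\<delta> = (Q$2$2 - Q$1$1) / 2" and "\<beta> = Q$1$2"
  have Q: "Q = mat2 (m - \<delta>) \<beta> \<beta> (m + \<delta>)"
    using symmetric_entry[OF sym] by (simp add: mat2_eq_iff m_def \<delta>_def \<beta>_def field_simps)
  have d: "m\<^sup>2 - (\<delta>\<^sup>2 + \<beta>\<^sup>2) > 0" using pos(2) by (simp add: Q mat2_ops power2_eq_square algebra_simps)
  have a: "m - \<delta> > 0" using pos by (simp add: Q)
  define r where "r = sqrt (\<delta>\<^sup>2 + \<beta>\<^sup>2)"
  have r0: "r \<ge> 0" by (simp add: r_def)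
  have r2: "r\<^sup>2 = \<delta>\<^sup>2 + \<beta>\<^sup>2" by (simp add: r_def)
  obtain f where f: "\<delta> = r * cos f" "\<beta> = r * sin f"
  proof (cases "r = 0")
    case True
    then have "\<delta>\<^sup>2 + \<beta>\<^sup>2 = 0" using r2 by simp
    then have "\<delta> = 0" "\<beta> = 0" unfolding sum_power2_eq_zero_iff by simp_all
    then show ?thesis using that[of 0] True by simp
  next
    case False
    have "(\<delta> / r)\<^sup>2 + (\<beta> / r)\<^sup>2 = r\<^sup>2 / r\<^sup>2"
      unfolding r2 power_divide by (simp only: add_divide_distrib)
    then have "(\<delta> / r)\<^sup>2 + (\<beta> / r)\<^sup>2 = 1" using False by simp
    then obtain f where "\<delta> / r = cos f" "\<beta> / r = sin f" using sincos_total_2pi by metis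
    then show ?thesis using that[of f] False by (simp add: divide_eq_eq mult.commute)
  qed
  define c s where "c = cos (f / 2)" and "s = sin (f / 2)"
  have cs: "cos f = c * c - s * s" "sin f = 2 * s * c" "c * c + s * s = 1"
    using cos_double[of "f / 2"] sin_double[of "f / 2"] by (simp_all add: c_def s_def flip: power2_eq_square)
  have rt: "rot (f / 2) = mat2 c s (- s) c" by (simp add: rot_def c_def s_def)
  have m: "m > r"
  proof -
    have "\<bar>\<delta>\<bar> \<le> \<bar>r\<bar>" unfolding abs_le_square_iff r2 by simp
    moreover have "\<bar>r\<bar> < \<bar>m\<bar>" using d unfolding r2[symmetric] by (metis abs_le_square_iff diff_gt_0_iff_gt not_le)
    ultimately have "m > 0" using a by linarith
    then show ?thesis using d unfolding r2[symmetric] by (intro power2_less_imp_less[of r m]) auto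
  qed
  have "rot (f / 2) ** mat2 (m - r) 0 0 (m + r) ** transpose (rot (f / 2)) = 
      mat2 ((c * c + s * s) * m - r * (c * c - s * s)) (r * (2 * s * c)) (r * (2 * s * c)) ((c * c + s * s) * m + r * (c * c - s * s))"
    unfolding rt mat2_ops by (simp add: mat2_eq_iff algebra_simps)
  also have "\<dots> = Q" unfolding cs(1,2)[symmetric] f[symmetric] unfolding cs(3) Q by simp
  finally have "Q = rot (f / 2) ** mat2 (m - r) 0 0 (m + r) ** transpose (rot (f / 2))" by (rule HOL.sym)
  then show ?thesis using that[of "m - r" "m + r" "f / 2"] m r0 by simp
qed

section \<open>The form S, its torus and the normal form of double cosets\<close>

locale form_data =
  fixes a b p Dr :: real
  assumes Dr: "Dr > 0" "4 * a - b\<^sup>2 = Dr" and p: "p > 0" "p\<^sup>2 * sqrt Dr = 2"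
begin

definition S :: "real^2^2" where "S = mat2 a (b/2) (b/2) 1"
text \<open>A matrix of determinant 1 that makes S scalar: st^t S st = (sqrt Dr / 2) 1, which is
  where p^2 sqrt Dr = 2 comes from. It serves as a concrete t0, diagonal for b = 0;
  \<open>sti\<close> is its inverse and \<open>stt\<close> its inverse transpose.\<close>

definition st :: "real^2^2" where "st = mat2 p 0 (- b * p / 2) (1 / p)"
definition sti :: "real^2^2" where "sti = mat2 (1 / p) 0 (b * p / 2) p"
definition stt :: "real^2^2" where "stt = mat2 (1 / p) (b * p / 2) 0 p"

lemma p0: "p \<noteq> 0" using p by simp

lemma st_inv: "st ** sti = mat 1" "sti ** st = mat 1" "transpose st ** stt = mat 1" "stt ** transpose st = mat 1"
  "transpose sti = stt" "transpose stt = sti" "det st = 1"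
  using p0 by (simp_all add: st_def sti_def stt_def mat2_ops mat2_eq_iff)

lemma p_inv: "1 / p\<^sup>2 = sqrt Dr / 2"
proof -
  have "1 / p\<^sup>2 = (p\<^sup>2 * sqrt Dr / 2) / p\<^sup>2" by (simp add: p(2))
  also have "\<dots> = sqrt Dr / 2" using p(1) by simp
  finally show ?thesis .
qed

lemma st_S: "transpose st ** S ** st = (sqrt Dr / 2) *\<^sub>R mat 1"
proof -
  have e: "p\<^sup>2 * (a - b\<^sup>2 / 4) = sqrt Dr / 2"
  proof -
    have "sqrt Dr * sqrt Dr = 4 * a - b\<^sup>2" using Dr by simp
    then have "p\<^sup>2 * (a - b\<^sup>2 / 4) = p\<^sup>2 * (sqrt Dr * sqrt Dr) / 4" by (simp add: right_diff_distrib)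
    also have "\<dots> = (p\<^sup>2 * sqrt Dr) * sqrt Dr / 4" by simp
    finally show ?thesis using p by simp
  qed
  have "transpose st ** S ** st = mat2 (p\<^sup>2 * (a - b\<^sup>2 / 4)) 0 0 (1 / p\<^sup>2)"
    using p0 by (simp add: st_def S_def mat2_ops mat2_eq_iff power2_eq_square) (simp add: algebra_simps)
  then show ?thesis unfolding e p_inv by (simp add: mat2_eq_iff mat_def)
qed

lemma S_eq: "S = (sqrt Dr / 2) *\<^sub>R (stt ** sti)"
proof -
  have "stt ** (transpose st ** S ** st) ** sti = (stt ** transpose st) ** S ** (st ** sti)" by (simp add: matrix_mul_assoc)
  then show ?thesis unfolding st_S st_inv by (simp add: real_mat_ops scaleR_matrix_mult)
qed

text \<open>Conjugation by \<open>st\<close> carries the condition on g to G^t G = det G, so T(R)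
  becomes the group of positive multiples of rotations. The lower block of the embedding then has
  the same scalar and the same angle.\<close>

lemma grpT_form:
  assumes "g \<in> grpT S"
  obtains y t where "y > 0" "g = y *\<^sub>R (st ** rot t ** sti)" "det g *\<^sub>R matrix_inv (transpose g) = y *\<^sub>R (stt ** rot t ** transpose st)" "det g = y\<^sup>2"
proof -
  have g: "invertible g" "transpose g ** S ** g = det g *\<^sub>R S" using assms by (auto simp: grpT_def)
  define G where "G = sti ** g ** st"
  have dG: "det G = det g" using st_inv(2) by (simp add: G_def det_mul) (metis det_I det_mul mult.commute mult.left_neutral mult.assoc)
  have d0: "det G \<noteq> 0" using g(1) dG by (simp add: invertible_det_nz)
  have s0: "sqrt Dr / 2 \<noteq> 0" using Dr by simp
  have "(sqrt Dr / 2) *\<^sub>R (transpose G ** G) = transpose st ** (transpose g ** ((sqrt Dr / 2) *\<^sub>R (stt ** sti)) ** g) ** st"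
    unfolding G_def real_mat_ops st_inv by (simp add: matrix_mul_assoc scaleR_matrix_mult)
  also have "\<dots> = transpose st ** (det g *\<^sub>R S) ** st" unfolding S_eq[symmetric] g(2) ..
  also have "\<dots> = det g *\<^sub>R (transpose st ** S ** st)" by (simp add: scaleR_matrix_mult)
  also have "\<dots> = (sqrt Dr / 2) *\<^sub>R (det g *\<^sub>R mat 1)" by (simp add: st_S)
  finally have "transpose G ** G = det G *\<^sub>R mat 1" using s0 dG by (metis scaleR_left_imp_eq)
  then obtain y t where y: "y > 0" "G = y *\<^sub>R rot t" "det G = y\<^sup>2" using d0 polar_decomposition by metis
  have "st ** G ** sti = (st ** sti) ** g ** (st ** sti)" by (simp add: G_def matrix_mul_assoc)
  then have gg: "g = y *\<^sub>R (st ** rot t ** sti)" by (simp add: st_inv y(2) scaleR_matrix_mult)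
  have tr: "transpose g = y *\<^sub>R (stt ** rot (- t) ** transpose st)"
    unfolding gg real_mat_ops st_inv transpose_rot by (simp add: matrix_mul_assoc)
  have "transpose g ** ((1 / y) *\<^sub>R (stt ** rot t ** transpose st)) = (y * (1 / y)) *\<^sub>R (stt ** rot (- t) ** (transpose st ** stt) ** rot t ** transpose st)"
    unfolding tr by (simp add: scaleR_matrix_mult matrix_mul_assoc)
  also have "\<dots> = stt ** (rot (- t) ** rot t) ** transpose st" using y(1) by (simp add: st_inv matrix_mul_assoc)
  also have "\<dots> = mat 1" by (simp add: rot_mult rot_0 st_inv)
  finally have "matrix_inv (transpose g) = (1 / y) *\<^sub>R (stt ** rot t ** transpose st)" by (rule matrix_inv_eqI)
  then have "det g *\<^sub>R matrix_inv (transpose g) = (y * y * (1 / y)) *\<^sub>R (stt ** rot t ** transpose st)"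
    using y(3) dG by (simp add: power2_eq_square)
  then have "det g *\<^sub>R matrix_inv (transpose g) = y *\<^sub>R (stt ** rot t ** transpose st)"
    using y(1) by simp
  then show ?thesis using that y(1,3) gg dG by simp
qed

text \<open>Upper diagonal block of the normal form \<open>PP\<close>. There X is the unipotent
  coordinate of R(R), x and t are the torus coordinates, and lam and \<zeta> parametrize the double
  cosets.\<close>

definition PA :: "real \<Rightarrow> real \<Rightarrow> real \<Rightarrow> real \<Rightarrow> real^2^2" where
  "PA lam \<zeta> x t = (lam * x) *\<^sub>R (st ** rot t ** mat2 \<zeta> 0 0 (1 / \<zeta>))"
definition PD :: "real \<Rightarrow> real \<Rightarrow> real \<Rightarrow> real^2^2" where
  "PD \<zeta> x t = x *\<^sub>R (stt ** rot t ** mat2 (1 / \<zeta>) 0 0 \<zeta>)"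
definition PP :: "real \<Rightarrow> real \<Rightarrow> real \<Rightarrow> real \<Rightarrow> real^2^2 \<Rightarrow> complex^4^4" where
  "PP lam \<zeta> x t X = rblk (mat 1) X 0 (mat 1) ** rblk (PA lam \<zeta> x t) 0 0 (PD \<zeta> x t)"

lemma PP_alt: "PP lam \<zeta> x t X = rblk (PA lam \<zeta> x t) (X ** PD \<zeta> x t) 0 (PD \<zeta> x t)"
  by (simp add: PP_def rblk_mult)

lemma PA_PD:
  assumes "\<zeta> \<noteq> 0"
  shows "transpose (PA lam \<zeta> x t) ** PD \<zeta> x t = mat (lam * x\<^sup>2)"
proof -
  have "transpose (PA lam \<zeta> x t) ** PD \<zeta> x t = (lam * x\<^sup>2) *\<^sub>R (mat2 \<zeta> 0 0 (1 / \<zeta>) ** (rot (- t) ** (transpose st ** stt) ** rot t) ** mat2 (1 / \<zeta>) 0 0 \<zeta>)"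
    by (simp add: PA_def PD_def real_mat_ops scaleR_matrix_mult transpose_rot matrix_mul_assoc power2_eq_square mat2_ops(5))
  also have "rot (- t) ** (transpose st ** stt) ** rot t = mat 1" by (simp add: st_inv rot_mult rot_0)
  finally show ?thesis using assms by (simp add: mat2_ops scaleR_mat2)
qed

lemma PP_similitude:
  assumes "\<zeta> \<noteq> 0" "transpose X = X"
  shows "has_similitude (PP lam \<zeta> x t X) (lam * x\<^sup>2)"
proof -
  have "transpose (X ** PD \<zeta> x t) ** PD \<zeta> x t = transpose (PD \<zeta> x t) ** (X ** PD \<zeta> x t)"
    by (simp only: real_mat_ops(1) assms(2) matrix_mul_assoc)
  then show ?thesis
    unfolding PP_alt has_similitude_rblk using PA_PD[OF assms(1), of lam x t] by simp
qed

text \<open>Scalars multiply into x, angles add to t, and the unipotent part, conjugated past the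
  torus, is absorbed in X. Nothing reaches lam or \<zeta>.\<close>

lemma grpR_PP:
  assumes r: "r \<in> grpR S" and X: "transpose X = X" and x: "x > 0"
  obtains x' t' X' where "x' > 0" "transpose X' = X'" "r ** PP lam \<zeta> x t X = PP lam \<zeta> x' t' X'"
proof -
  obtain g Y where g: "g \<in> grpT S" and Y: "transpose Y = Y" and r: "r = embT g ** rblk (mat 1) Y 0 (mat 1)"
    using r by (auto simp: grpR_def grpU_def rblk_def cmat_simps)
  obtain y s where y: "y > 0" "g = y *\<^sub>R (st ** rot s ** sti)" "det g *\<^sub>R matrix_inv (transpose g) = y *\<^sub>R (stt ** rot s ** transpose st)" "det g = y\<^sup>2"
    using grpT_form[OF g] by metis
  define G' where "G' = y *\<^sub>R (stt ** rot s ** transpose st)"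
  have e: "embT g = rblk g 0 0 G'" unfolding embT_def rblk_def y(3) G'_def by (simp add: cmat_simps)
  define X' where "X' = (1 / y\<^sup>2) *\<^sub>R (g ** (Y + X) ** transpose g)"
  have tg: "transpose g = y *\<^sub>R (stt ** rot (- s) ** transpose st)"
    unfolding y(2) real_mat_ops st_inv transpose_rot by (simp add: matrix_mul_assoc)
  have "transpose g ** G' = (y * y) *\<^sub>R (stt ** (rot (- s) ** (transpose st ** stt) ** rot s) ** transpose st)"
    unfolding tg G'_def by (simp add: scaleR_matrix_mult matrix_mul_assoc)
  then have gG: "transpose g ** G' = y\<^sup>2 *\<^sub>R mat 1" by (simp add: st_inv rot_mult rot_0 power2_eq_square)
  have XG: "X' ** G' = g ** (Y + X)"
  proof -
    have "X' ** G' = (1 / y\<^sup>2) *\<^sub>R (g ** (Y + X) ** (transpose g ** G'))"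
      unfolding X'_def scaleR_matrix_mult by (simp add: matrix_mul_assoc)
    then show ?thesis unfolding gG using y(1) by (simp add: scaleR_matrix_mult)
  qed
  have gA: "g ** PA lam \<zeta> x t = PA lam \<zeta> (y * x) (s + t)"
  proof -
    have "g ** PA lam \<zeta> x t = (y * (lam * x)) *\<^sub>R (st ** (rot s ** (sti ** st) ** rot t) ** mat2 \<zeta> 0 0 (1 / \<zeta>))"
      unfolding y(2) PA_def by (simp add: scaleR_matrix_mult matrix_mul_assoc)
    then show ?thesis by (simp add: st_inv rot_mult PA_def mult_ac)
  qed
  have GD: "G' ** PD \<zeta> x t = PD \<zeta> (y * x) (s + t)"
  proof -
    have "G' ** PD \<zeta> x t = (y * x) *\<^sub>R (stt ** (rot s ** (transpose st ** stt) ** rot t) ** mat2 (1 / \<zeta>) 0 0 \<zeta>)"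
      unfolding G'_def PD_def by (simp add: scaleR_matrix_mult matrix_mul_assoc)
    then show ?thesis by (simp add: st_inv rot_mult PD_def mult_ac)
  qed
  have "X' ** PD \<zeta> (y * x) (s + t) = g ** (Y + X) ** PD \<zeta> x t"
    unfolding GD[symmetric] matrix_mul_assoc XG ..
  then have "r ** PP lam \<zeta> x t X = PP lam \<zeta> (y * x) (s + t) X'"
    unfolding r e PP_alt rblk_mult by (simp add: gA GD matrix_add_ldistrib matrix_distrib_right matrix_mul_assoc add.commute)
  moreover have "transpose X' = X'" unfolding X'_def real_mat_ops X Y by (simp add: matrix_mul_assoc)
  moreover have "y * x > 0" using x y by simp
  ultimately show ?thesis using that by blast
qed

text \<open>For U = st^(-1) t0 the symmetric matrix U^t U commutes with the quarter turn, hence is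
  scalar; with det U = 1 this makes U a rotation. A different choice of t0 thus only shifts the
  torus angle.\<close>

lemma hrep_PP:
  assumes t0: "conj_to_SO2 S t0"
  obtains t where "\<And>lam \<zeta>. hrep t0 lam \<zeta> = PP lam \<zeta> 1 t 0"
proof -
  have d1: "det t0 = 1" and eq: "{g \<in> grpT S. det g = 1} = {t0 ** k ** matrix_inv t0 | k. rotation_matrix k}"
    using t0 by (auto simp: conj_to_SO2_def)
  have inv: "invertible t0" using d1 by (simp add: invertible_det_nz)
  note ti = invertible_mult[OF inv]
  define J where "J = rot (pi / 2)"
  have J: "J = mat2 0 1 (-1) 0" by (simp add: J_def rot_def)
  have "rotation_matrix J" unfolding rotation_matrix_def orthogonal_matrix_def J by (simp add: mat2_ops)
  then have "t0 ** J ** matrix_inv t0 \<in> {g \<in> grpT S. det g = 1}" unfolding eq by blast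
  then have T: "transpose (t0 ** J ** matrix_inv t0) ** S ** (t0 ** J ** matrix_inv t0) = S" by (auto simp: grpT_def)
  define S' where "S' = transpose t0 ** S ** t0"
  have "transpose J ** S' ** J = transpose t0 ** (transpose (t0 ** J ** matrix_inv t0) ** S ** (t0 ** J ** matrix_inv t0)) ** t0"
  proof -
    have "transpose t0 ** (transpose (t0 ** J ** matrix_inv t0) ** S ** (t0 ** J ** matrix_inv t0)) ** t0 =
       transpose (matrix_inv t0 ** t0) ** transpose J ** (transpose t0 ** S ** t0) ** J ** (matrix_inv t0 ** t0)"
      by (simp only: real_mat_ops matrix_mul_assoc)
    then show ?thesis unfolding ti S'_def by (simp add: real_mat_ops)
  qed
  then have JS: "transpose J ** S' ** J = S'" unfolding T S'_def[symmetric] .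
  define U where "U = sti ** t0"
  have UU: "S' = (sqrt Dr / 2) *\<^sub>R (transpose U ** U)"
    unfolding S'_def U_def S_eq real_mat_ops st_inv by (simp add: scaleR_matrix_mult matrix_mul_assoc)
  define V where "V = transpose U ** U"
  have s0: "sqrt Dr / 2 \<noteq> 0" using Dr by simp
  have "(sqrt Dr / 2) *\<^sub>R (transpose J ** V ** J) = (sqrt Dr / 2) *\<^sub>R V"
    using JS unfolding UU V_def[symmetric] by (simp add: scaleR_matrix_mult)
  then have JV: "transpose J ** V ** J = V" using s0 by (metis scaleR_left_imp_eq)
  have dU: "det U = 1" using d1 st_inv(2,7) by (simp add: U_def det_mul) (metis det_I det_mul mult.right_neutral)
  obtain u v w z where uu: "U = mat2 u v w z" by (metis mat2_eta)
  have e: "u * u + w * w = v * v + z * z" "u * v + w * z = 0" using JV unfolding V_def uu J by (auto simp: mat2_ops mat2_eq_iff)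
  have du: "u * z - v * w = 1" using dU by (simp add: uu mat2_ops)
  have "u * u + w * w = 1"
  proof -
    have "(u * u + w * w) * (v * v + z * z) = (u * z - v * w)\<^sup>2 + (u * v + w * z)\<^sup>2" by (simp add: power2_eq_square algebra_simps)
    then have "(u * u + w * w)\<^sup>2 = 1" using e du by (simp add: power2_eq_square)
    then have "u * u + w * w = 1 \<or> u * u + w * w = - 1" by (simp add: power2_eq_1_iff)
    then show ?thesis using sum_squares_ge_zero[of u w] by auto
  qed
  then have "transpose U ** U = det U *\<^sub>R mat 1" using e unfolding dU by (simp add: uu mat2_ops mat2_eq_iff mult.commute)
  then obtain y t where y: "y > 0" "U = y *\<^sub>R rot t" "det U = y\<^sup>2" using dU by (elim polar_decomposition) auto
  have "y = 1" using y dU by (simp add: power2_eq_1_iff)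
  then have U: "U = rot t" using y by simp
  have "st ** U = (st ** sti) ** t0" by (simp add: U_def matrix_mul_assoc)
  then have t0e: "t0 = st ** rot t" by (simp add: st_inv U)
  have "transpose t0 ** (stt ** rot t) = rot (- t) ** (transpose st ** stt) ** rot t"
    unfolding t0e real_mat_ops transpose_rot by (simp add: matrix_mul_assoc)
  then have "matrix_inv (transpose t0) = stt ** rot t" by (intro matrix_inv_eqI) (simp add: st_inv rot_mult rot_0)
  then have "hrep t0 lam \<zeta> = PP lam \<zeta> 1 t 0" for lam \<zeta>
    unfolding hrep_def PP_alt PA_def PD_def rblk_def by (simp add: t0e inverse_eq_divide cmat_simps)
  then show ?thesis using that by blast
qed

text \<open>Q = C C^t + D D^t equals N N* for N = J(h, I), so it is positive definite and ignores
  right translation by K. Diagonalizing st^t Q st supplies t, \<zeta> and x. Since \<open>D1\<close>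
  D1^t = Q, the matrices D1^(-1) C and D1^(-1) D are the lower blocks of an element of K, and its
  removal leaves h block triangular.\<close>

lemma PP_decomposition:
  assumes h: "h \<in> grpHplus"
  obtains lam \<zeta> x t X k where "lam > 0" "\<zeta> \<ge> 1" "x > 0" "transpose X = X" "k \<in> KinfH" "h = PP lam \<zeta> x t X ** k"
proof -
  obtain A B C D \<mu> where hh: "h = rblk A B C D" and \<mu>: "\<mu> > 0" and sim: "has_similitude h \<mu>"
    using h by (auto simp: grpHplus_iff2)
  have CD: "C ** transpose D = D ** transpose C" using rblk_transpose_relation(1)[OF sim[unfolded hh]] \<mu> by simp
  define Q where "Q = C ** transpose C + D ** transpose D"
  define N where "N = Jfac h basept"
  have N: "N = cmat D + mat \<i> ** cmat C" unfolding N_def hh rblk_def Jfac_blk by (simp add: mat_commute add.commute)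
  have "invertible N" unfolding N_def using invertible_Jfac[OF sim] \<mu> by simp
  then have dN: "det N \<noteq> 0" by (simp add: invertible_det_nz)
  have "N ** hc N = cmat Q + mat \<i> ** cmat (C ** transpose D - D ** transpose C)"
    unfolding N Q_def by (rule cmat_complex_hc)
  then have NQ: "N ** hc N = cmat Q" unfolding CD by (simp add: cmat_simps)
  have "det (cmat Q) = det N * cnj (det N)" unfolding NQ[symmetric] det_mul by (simp add: det_2)
  also have "\<dots> = of_real ((cmod (det N))\<^sup>2)" by (rule complex_norm_square[symmetric])
  also have "det (cmat Q) = of_real (det Q)" by (simp add: det_2)
  finally have dQ: "det Q > 0" using dN by (simp only: of_real_eq_iff) simp
  have symQ: "transpose Q = Q" by (simp add: Q_def real_mat_ops)
  have "Q$1$1 \<ge> 0" by (simp add: Q_def matrix_matrix_mult_def sum_2 transpose_def)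
  moreover have "Q$1$1 \<noteq> 0"
  proof
    assume "Q$1$1 = 0"
    then have "det Q = - (Q$1$2 * Q$1$2)" using symmetric_entry[OF symQ] by (simp add: det_2)
    then show False using dQ by (smt (verit) zero_le_square)
  qed
  ultimately have Q11: "Q$1$1 > 0" by simp
  define Q' where "Q' = transpose st ** Q ** st"
  have "det Q' = det Q" by (simp add: Q'_def det_mul st_inv)
  then have dQ': "det Q' > 0" using dQ by simp
  have symQ': "transpose Q' = Q'" by (simp add: Q'_def real_mat_ops symQ matrix_mul_assoc)
  have "Q'$1$1 > 0"
  proof -
    define f q1 q2 q3 where "f = - b / 2" and "q1 = Q$1$1" and "q2 = Q$1$2" and "q3 = Q$2$2"
    have QQ: "Q = mat2 q1 q2 q2 q3" using symmetric_entry[OF symQ] by (simp add: mat2_eq_iff q1_def q2_def q3_def)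
    have st: "st = mat2 p 0 (p * f) (1 / p)" by (simp add: st_def f_def mult.commute)
    have q: "q1 > 0" "q1 * q3 - q2 * q2 > 0" using Q11 dQ by (simp_all add: QQ mat2_ops)
    have "Q'$1$1 = p\<^sup>2 * (q1 + 2 * f * q2 + f\<^sup>2 * q3)"
      by (simp add: Q'_def QQ st mat2_ops power2_eq_square algebra_simps)
    moreover have "q1 * (q1 + 2 * f * q2 + f\<^sup>2 * q3) = (q1 + f * q2)\<^sup>2 + f\<^sup>2 * (q1 * q3 - q2 * q2)"
      by (simp add: power2_eq_square algebra_simps)
    moreover have "(q1 + f * q2)\<^sup>2 + f\<^sup>2 * (q1 * q3 - q2 * q2) > 0"
    proof (cases "f = 0")
      case True then show ?thesis using q by simp
    next
      case False
      then have "f\<^sup>2 * (q1 * q3 - q2 * q2) > 0" using q by simp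
      then show ?thesis by (simp add: add_nonneg_pos)
    qed
    ultimately have "q1 * (q1 + 2 * f * q2 + f\<^sup>2 * q3) > 0" by simp
    then have "q1 + 2 * f * q2 + f\<^sup>2 * q3 > 0" using q(1) by (simp add: zero_less_mult_iff)
    then have "p\<^sup>2 * (q1 + 2 * f * q2 + f\<^sup>2 * q3) > 0" using p by simp
    then show ?thesis using \<open>Q'$1$1 = p\<^sup>2 * (q1 + 2 * f * q2 + f\<^sup>2 * q3)\<close> by simp
  qed
  then obtain e1 e2 t where e: "0 < e1" "e1 \<le> e2" "Q' = rot t ** mat2 e1 0 0 e2 ** transpose (rot t)"
    using spectral2[OF symQ' _ dQ'] by metis
  \<comment> \<open>The eigenvalues are to be e1 = x^2 / \<zeta>^2 and e2 = x^2 \<zeta>^2; their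
    order e1 \<le> e2 gives \<zeta> \<ge> 1.\<close>
  define x where "x = sqrt (sqrt (e1 * e2))"
  define \<zeta> where "\<zeta> = sqrt (sqrt (e2 / e1))"
  have x: "x > 0" using e by (simp add: x_def)
  have z: "\<zeta> \<ge> 1" using e by (simp add: \<zeta>_def)
  have x2: "x\<^sup>2 = sqrt e1 * sqrt e2" "\<zeta>\<^sup>2 = sqrt e2 / sqrt e1" using e by (simp_all add: x_def \<zeta>_def real_sqrt_mult real_sqrt_divide power_mult_distrib power_divide)
  have e12: "x\<^sup>2 * (1 / \<zeta> * (1 / \<zeta>)) = e1" "x\<^sup>2 * (\<zeta> * \<zeta>) = e2"
  proof -
    have "x\<^sup>2 * (1 / \<zeta> * (1 / \<zeta>)) = x\<^sup>2 / \<zeta>\<^sup>2" by (simp add: power2_eq_square)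
    also have "\<dots> = e1" unfolding x2 using e by simp
    finally show "x\<^sup>2 * (1 / \<zeta> * (1 / \<zeta>)) = e1" .
    have "x\<^sup>2 * (\<zeta> * \<zeta>) = x\<^sup>2 * \<zeta>\<^sup>2" by (simp add: power2_eq_square)
    also have "\<dots> = e2" unfolding x2 using e by simp
    finally show "x\<^sup>2 * (\<zeta> * \<zeta>) = e2" .
  qed
  \<comment> \<open>Forced by the similitude factor lam x^2 of \<open>PP\<close>.\<close>
  define lam where "lam = \<mu> / x\<^sup>2"
  have lam: "lam > 0" using \<mu> x by (simp add: lam_def)
  define D1 where "D1 = PD \<zeta> x t"
  have DD: "D1 ** transpose D1 = Q"
  proof -
    have "D1 ** transpose D1 = stt ** (rot t ** (x\<^sup>2 *\<^sub>R (mat2 (1 / \<zeta>) 0 0 \<zeta> ** mat2 (1 / \<zeta>) 0 0 \<zeta>)) ** transpose (rot t)) ** transpose stt"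
      by (simp add: D1_def PD_def real_mat_ops scaleR_matrix_mult matrix_mul_assoc power2_eq_square mat2_ops(5))
    also have "x\<^sup>2 *\<^sub>R (mat2 (1 / \<zeta>) 0 0 \<zeta> ** mat2 (1 / \<zeta>) 0 0 \<zeta>) = mat2 e1 0 0 e2"
      unfolding e12[symmetric] by (simp add: mat2_ops scaleR_mat2)
    also have "stt ** (rot t ** mat2 e1 0 0 e2 ** transpose (rot t)) ** transpose stt = (stt ** transpose st) ** Q ** (st ** sti)"
      unfolding e(3)[symmetric] Q'_def st_inv(6) by (simp add: matrix_mul_assoc)
    finally show ?thesis by (simp add: st_inv)
  qed
  \<comment> \<open>For lam = 1 / x^2 the block \<open>PA\<close> is the inverse transpose of
    \<open>D1\<close>.\<close>
  define E where "E = PA (1 / x\<^sup>2) \<zeta> x t"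
  have ED: "transpose E ** D1 = mat 1" unfolding E_def D1_def using PA_PD[of \<zeta> "1 / x\<^sup>2" x t] z x by simp
  have DE: "D1 ** transpose E = mat 1" using ED matrix_left_right_inverse by blast
  define C1 D2 where "C1 = transpose E ** C" and "D2 = transpose E ** D"
  have DC: "D1 ** C1 = C" "D1 ** D2 = D" by (simp_all add: C1_def D2_def matrix_mul_assoc DE)
  have tD: "transpose C1 = transpose C ** E" "transpose D2 = transpose D ** E" by (simp_all add: C1_def D2_def real_mat_ops)
  have o1: "C1 ** transpose C1 + D2 ** transpose D2 = mat 1"
  proof -
    have "C1 ** transpose C1 + D2 ** transpose D2 = transpose E ** Q ** E"
      unfolding tD unfolding C1_def D2_def Q_def by (simp add: matrix_add_ldistrib matrix_distrib_right matrix_mul_assoc)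
    also have "\<dots> = (transpose E ** D1) ** transpose (transpose E ** D1)" unfolding DD[symmetric] real_mat_ops by (simp add: matrix_mul_assoc)
    finally show ?thesis by (simp add: ED real_mat_ops)
  qed
  have o2: "C1 ** transpose D2 = D2 ** transpose C1"
  proof -
    have "C1 ** transpose D2 = transpose E ** (C ** transpose D) ** E" unfolding tD unfolding C1_def by (simp add: matrix_mul_assoc)
    also have "\<dots> = D2 ** transpose C1" unfolding CD tD unfolding D2_def by (simp add: matrix_mul_assoc)
    finally show ?thesis .
  qed
  define k where "k = rblk D2 (- C1) C1 D2"
  have k: "k \<in> KinfH" unfolding KinfH_iff k_def using o1 o2 by blast
  define kt where "kt = rblk (transpose D2) (transpose C1) (- transpose C1) (transpose D2)"
  have kk: "k ** kt = mat 1" unfolding k_def kt_def rblk_mult using o1 o2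
    by (simp add: add.commute) (simp add: rblk_def mat4_blk cmat_simps)
  then have kk': "kt ** k = mat 1" using matrix_left_right_inverse by blast
  have tm: "transpose (- M) = - transpose M" for M :: "real^2^2" by (simp add: mat2_eq_iff transpose_def)
  have ks: "has_similitude kt 1"
    unfolding kt_def has_similitude_rblk tm using o1 o2 by (simp add: add.commute)
  define P where "P = h ** kt"
  have Ps: "has_similitude P \<mu>" using has_similitude_mult[OF sim ks] by (simp add: P_def)
  have hP: "h = P ** k" by (simp add: P_def matrix_mul_assoc[symmetric] kk')
  define A1 B1 where "A1 = A ** transpose D2 - B ** transpose C1" and "B1 = A ** transpose C1 + B ** transpose D2"
  have PP1: "P = rblk A1 B1 0 D1"
  proof -
    have "C ** transpose D2 = D1 ** (C1 ** transpose D2)" "D ** transpose C1 = D1 ** (D2 ** transpose C1)"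
      unfolding matrix_mul_assoc DC by simp_all
    then have 1: "C ** transpose D2 - D ** transpose C1 = 0" unfolding o2 by simp
    have "C ** transpose C1 + D ** transpose D2 = D1 ** (C1 ** transpose C1 + D2 ** transpose D2)"
      unfolding matrix_add_ldistrib matrix_mul_assoc DC ..
    then have 2: "C ** transpose C1 + D ** transpose D2 = D1" unfolding o1 by simp
    show ?thesis unfolding P_def hh kt_def rblk_mult using 1 2 by (simp add: A1_def B1_def)
  qed
  have rel: "transpose B1 ** D1 = transpose D1 ** B1" "transpose A1 ** D1 = mat \<mu>"
    using Ps unfolding PP1 has_similitude_rblk by auto
  have A1: "A1 = PA lam \<zeta> x t"
  proof -
    have "transpose A1 = transpose A1 ** D1 ** transpose E" by (simp add: matrix_mul_assoc[symmetric] DE)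
    also have "\<dots> = \<mu> *\<^sub>R transpose E" by (simp add: rel real_mat_ops)
    finally have "transpose (transpose A1) = transpose (\<mu> *\<^sub>R transpose E)" by simp
    then have "A1 = \<mu> *\<^sub>R E" by (simp add: real_mat_ops)
    then show ?thesis by (simp add: E_def PA_def lam_def)
  qed
  define X where "X = B1 ** transpose E"
  have XD: "X ** D1 = B1" by (simp add: X_def matrix_mul_assoc[symmetric] ED)
  have "transpose X = transpose (transpose E ** D1) ** E ** transpose B1 "
    by (simp add: X_def real_mat_ops ED)
  also have "\<dots> = X"
  proof -
    have "E ** transpose B1 = E ** (transpose B1 ** D1) ** transpose E" by (simp add: matrix_mul_assoc[symmetric] DE)
    also have "\<dots> = (transpose (D1 ** transpose E)) ** B1 ** transpose E"
      unfolding rel real_mat_ops by (simp add: matrix_mul_assoc)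
    also have "\<dots> = X" by (simp add: DE X_def real_mat_ops)
    finally show ?thesis by (simp add: ED real_mat_ops)
  qed
  finally have X: "transpose X = X" .
  have "P = PP lam \<zeta> x t X" unfolding PP1 PP_alt A1 D1_def[symmetric] XD ..
  then show ?thesis using that[OF lam z x X k] hP by blast
qed

end

section \<open>The section and the Bessel function on double cosets\<close>

lemma mat4_mult: "(A ** B) $ i $ j = A$i$1 * B$1$j + A$i$2 * B$2$j + A$i$3 * B$3$j + A$i$4 * B$4$j"
  for A B :: "'a::comm_ring_1^4^4"
  by (simp add: matrix_matrix_mult_def sum_4)

lemma hc_0 [simp]: "hc 0 = 0"
  by (simp add: vec_eq_iff)

text \<open>The coordinates of N(R) are found by comparing entries. \<open>w\<close> comes out real
  because the mixed terms are a complex number and its conjugate. The entry \<tau> of the Hermitian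
  block lies outside N(R) and goes into \<open>m2\<close>.\<close>

lemma parabolic_factorization:
  fixes \<zeta> a d z xc :: complex and x1 \<tau> \<mu> :: real
  assumes nz: "\<zeta> \<noteq> 0" "a \<noteq> 0" and mu: "cnj a * d = of_real \<mu>"
  defines "w \<equiv> x1 * \<mu> / (cmod \<zeta>)\<^sup>2 - 2 * Re (xc * d * cnj z / \<zeta>)"
  shows "m1 \<zeta> ** m2 (mat2 a (of_real \<tau> * d) 0 d) ** nP z w (xc * d / \<zeta>) =
    blk (mat 1) (mat2 (of_real x1) xc (cnj xc) (of_real \<tau>)) 0 (mat 1) **
    blk (mat2 \<zeta> (\<zeta> * z) 0 a) 0 0 (mat2 (of_real \<mu> / cnj \<zeta>) 0 (- d * cnj z) d)"
proof -
  have n1: "nP z w y = vector [vector [1, z, of_real w + z * cnj y, y], vector [0, 1, cnj y, 0], vector [0, 0, 1, 0], vector [0, 0, - cnj z, 1]]" for y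
    unfolding nP_def mat4_eq_iff mat4_mult by simp
  have n2: "m1 \<zeta> ** m2 (mat2 a (of_real \<tau> * d) 0 d) = vector [vector [\<zeta>, 0, 0, 0], vector [0, a, 0, of_real \<tau> * d],
     vector [0, 0, of_real \<mu> / cnj \<zeta>, 0], vector [0, 0, 0, d]]"
    unfolding m1_def m2_def mat4_eq_iff mat4_mult mu11_def by (simp add: mu[symmetric] divide_inverse)
  have w: "\<zeta> * (of_real w + z * cnj (xc * d / \<zeta>)) = of_real x1 * (of_real \<mu> / cnj \<zeta>) + xc * (- d * cnj z)"
  proof -
    have 1: "complex_of_real ((cmod \<zeta>)\<^sup>2) = \<zeta> * cnj \<zeta>" by (rule complex_norm_square)
    have 2: "complex_of_real (2 * Re (xc * d * cnj z / \<zeta>)) = xc * d * cnj z / \<zeta> + cnj (xc * d * cnj z / \<zeta>)"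
      by (simp only: complex_add_cnj)
    have "of_real w = of_real x1 * of_real \<mu> / (\<zeta> * cnj \<zeta>) - (xc * d * cnj z / \<zeta> + cnj (xc * d * cnj z / \<zeta>))"
      unfolding w_def of_real_diff of_real_divide of_real_mult[of x1] 1 2 ..
    then show ?thesis using nz by (simp add: field_simps)
  qed
  have c: "a * cnj d = of_real \<mu>" using arg_cong[OF mu, of cnj] by simp
  have y: "a * cnj (xc * d / \<zeta>) = cnj xc * (of_real \<mu> / cnj \<zeta>)"
    unfolding c[symmetric] by simp
  show ?thesis unfolding n1 n2 blk_mult mat4_eq_iff mat4_mult
    using w y nz by (simp add: mat2_ops)
qed

context form_data
begin

definition \<alpha> :: complex where "\<alpha> = (of_real b + \<i> * of_real (sqrt Dr)) / 2"

lemma alpha_S: "alpha S = \<alpha>"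
  using Dr(2) by (simp add: alpha_def S_def \<alpha>_def Let_def)

lemma eta_S: "eta S = blk (mat2 1 0 \<alpha> 1) 0 0 (mat2 1 (- cnj \<alpha>) 0 1)"
  by (simp add: eta_def alpha_S mat4_eq_iff)

lemma alpha_norm: "\<alpha> * cnj \<alpha> = of_real a" "\<alpha> + cnj \<alpha> = of_real b"
proof -
  have "sqrt Dr * sqrt Dr = Dr" using Dr by simp
  then have "complex_of_real (sqrt Dr) * of_real (sqrt Dr) = of_real Dr" unfolding of_real_mult[symmetric] by simp
  moreover have "complex_of_real Dr = 4 * of_real a - of_real b * of_real b" unfolding Dr(2)[symmetric] by (simp add: power2_eq_square)
  ultimately show "\<alpha> * cnj \<alpha> = of_real a" by (simp add: \<alpha>_def algebra_simps)
  show "\<alpha> + cnj \<alpha> = of_real b" by (simp add: \<alpha>_def complex_eq_iff)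
qed

lemma p_sqrt: "p * sqrt Dr / 2 = 1 / p"
  using p p_inv by (simp add: power2_eq_square field_simps)

text \<open>As \<alpha> has norm a and trace b, conjugation by eta puts tr(S X) into the entry that
  \<open>m2\<close> receives. Through it the Whittaker function yields a character of X, which the
  Bessel function cancels.\<close>

lemma eta_u:
  assumes "transpose X = X"
  shows "eta S ** blk (mat 1) (cmat X) 0 (mat 1) =
    blk (mat 1) (mat2 (of_real (X$1$1)) (of_real (X$1$1) * cnj \<alpha> + of_real (X$1$2)) (cnj (of_real (X$1$1) * cnj \<alpha> + of_real (X$1$2)))
       (of_real (trace (S ** X)))) 0 (mat 1) ** eta S"
proof -
  define x1 x2 x3 where "x1 = X$1$1" and "x2 = X$1$2" and "x3 = X$2$2"
  have X: "X = mat2 x1 x2 x2 x3" using symmetric_entry[OF assms] by (simp add: mat2_eq_iff x1_def x2_def x3_def)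
  have t: "trace (S ** X) = a * x1 + b * x2 + x3" by (simp add: S_def X mat2_ops)
  have t': "complex_of_real (trace (S ** X)) = \<alpha> * cnj \<alpha> * of_real x1 + (\<alpha> + cnj \<alpha>) * of_real x2 + of_real x3"
    unfolding t alpha_norm by simp
  show ?thesis unfolding eta_S blk_mult blk_inject t' unfolding X
    by (simp add: mat2_ops cmat_mat2) (simp add: mat2_eq_iff algebra_simps)
qed

text \<open>The norm of (i \<zeta>, 1/\<zeta>), the bottom row of the lower unipotent matrix with
  entry i times diag(\<zeta>, 1/\<zeta>). The matrix \<open>kap\<close> has the normalized row as
  its bottom row and is the unitary Iwasawa factor of that product.\<close>

definition NN :: "real \<Rightarrow> real" where "NN \<zeta> = sqrt (\<zeta>\<^sup>2 + 1 / \<zeta>\<^sup>2)"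

definition kap :: "real \<Rightarrow> complex^2^2" where
  "kap \<zeta> = mat2 (of_real (1 / (\<zeta> * NN \<zeta>))) (\<i> * of_real (\<zeta> / NN \<zeta>)) (\<i> * of_real (\<zeta> / NN \<zeta>)) (of_real (1 / (\<zeta> * NN \<zeta>)))"

lemma NN_pos: "\<zeta> > 0 \<Longrightarrow> NN \<zeta> > 0"
  by (simp add: NN_def add_pos_pos)

lemma NN_sq: "(NN \<zeta>)\<^sup>2 = \<zeta>\<^sup>2 + 1 / \<zeta>\<^sup>2"
  by (simp add: NN_def)

lemma NN_rel:
  assumes "\<zeta> > 0"
  shows "1 / (NN \<zeta> * NN \<zeta>) * (1 / \<zeta> + \<zeta>^3) = \<zeta>" "1 / (\<zeta> * NN \<zeta>) * (1 / (\<zeta> * NN \<zeta>)) + \<zeta> / NN \<zeta> * (\<zeta> / NN \<zeta>) = 1"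
proof -
  have n: "NN \<zeta> * NN \<zeta> = \<zeta> * \<zeta> + 1 / (\<zeta> * \<zeta>)" using NN_sq[of \<zeta>] by (simp add: power2_eq_square)
  have "1 / \<zeta> + \<zeta>^3 = \<zeta> * (NN \<zeta> * NN \<zeta>)" unfolding n using assms by (simp add: field_simps power3_eq_cube)
  then show "1 / (NN \<zeta> * NN \<zeta>) * (1 / \<zeta> + \<zeta>^3) = \<zeta>" using NN_pos[OF assms] by simp
  have "1 / (\<zeta> * NN \<zeta>) * (1 / (\<zeta> * NN \<zeta>)) + \<zeta> / NN \<zeta> * (\<zeta> / NN \<zeta>) = (\<zeta> * \<zeta> + 1 / (\<zeta> * \<zeta>)) / (NN \<zeta> * NN \<zeta>)"
    by (simp add: add_divide_distrib)
  also have "\<dots> = 1" unfolding n[symmetric] using NN_pos[OF assms] by simp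
  finally show "1 / (\<zeta> * NN \<zeta>) * (1 / (\<zeta> * NN \<zeta>)) + \<zeta> / NN \<zeta> * (\<zeta> / NN \<zeta>) = 1" .
qed

text \<open>The off-diagonal entries of kap kap^t are what \<open>f_K\<close> picks out; since they
  agree, both of its branches give the same expression.\<close>

lemma kap_unitary:
  assumes "\<zeta> > 0"
  shows "hc (kap \<zeta>) ** kap \<zeta> = mat 1" "det (kap \<zeta>) = 1" "kap \<zeta> ** transpose (kap \<zeta>) = mat2 (of_real ((1 / (\<zeta> * NN \<zeta>))\<^sup>2 - (\<zeta> / NN \<zeta>)\<^sup>2)) (2 * \<i> / of_real ((NN \<zeta>)\<^sup>2)) (2 * \<i> / of_real ((NN \<zeta>)\<^sup>2)) (of_real ((1 / (\<zeta> * NN \<zeta>))\<^sup>2 - (\<zeta> / NN \<zeta>)\<^sup>2))"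
proof -
  define u v where "u = 1 / (\<zeta> * NN \<zeta>)" and "v = \<zeta> / NN \<zeta>"
  have uv: "u * u + v * v = 1" using NN_rel(2)[OF assms] by (simp add: u_def v_def)
  have uvc: "complex_of_real u * of_real u + of_real v * of_real v = 1"
    unfolding of_real_mult[symmetric] of_real_add[symmetric] uv by simp
  have ii: "\<i> * complex_of_real v * (\<i> * complex_of_real v) = - (of_real v * of_real v)" by (simp add: complex_eq_iff)
  have uv2: "u * v = 1 / (NN \<zeta>)\<^sup>2" using assms by (simp add: u_def v_def power2_eq_square)
  have K: "kap \<zeta> = mat2 (of_real u) (\<i> * of_real v) (\<i> * of_real v) (of_real u)" by (simp add: kap_def u_def v_def)
  have h: "hc (kap \<zeta>) = mat2 (of_real u) (- \<i> * of_real v) (- \<i> * of_real v) (of_real u)" unfolding K by (simp add: mat2_eq_iff)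
  show "hc (kap \<zeta>) ** kap \<zeta> = mat 1" unfolding h unfolding K mat2_ops using uvc by (simp add: mat2_eq_iff ii add.commute)
  show "det (kap \<zeta>) = 1" unfolding K mat2_ops using uvc by (simp add: ii)
  have "complex_of_real (u * v) = 1 / of_real ((NN \<zeta>)\<^sup>2)" unfolding uv2 by simp
  then show "kap \<zeta> ** transpose (kap \<zeta>) = mat2 (of_real ((1 / (\<zeta> * NN \<zeta>))\<^sup>2 - (\<zeta> / NN \<zeta>)\<^sup>2)) (2 * \<i> / of_real ((NN \<zeta>)\<^sup>2)) (2 * \<i> / of_real ((NN \<zeta>)\<^sup>2)) (of_real ((1 / (\<zeta> * NN \<zeta>))\<^sup>2 - (\<zeta> / NN \<zeta>)\<^sup>2))"
    unfolding K mat2_ops u_def[symmetric] v_def[symmetric] by (simp add: mat2_eq_iff power2_eq_square mult_ac)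
qed

lemma kap_Kinf:
  assumes "\<zeta> > 0"
  shows "blk (kap \<zeta>) 0 0 (kap \<zeta>) \<in> Kinf"
proof (rule KinfI)
  show "has_similitude (blk (kap \<zeta>) 0 0 (kap \<zeta>)) 1"
    unfolding has_similitude_blk using kap_unitary(1)[OF assms] by (simp add: mat_uminus)
  show "blkA (blk (kap \<zeta>) 0 0 (kap \<zeta>)) ** mat \<i> + blkB (blk (kap \<zeta>) 0 0 (kap \<zeta>)) = mat \<i> ** Jfac (blk (kap \<zeta>) 0 0 (kap \<zeta>)) basept"
    by (simp add: Jfac_blk mat_commute)
qed

context
  fixes lam \<zeta> x t :: real
  assumes pos: "lam > 0" "\<zeta> > 0" "x > 0"
begin

text \<open>\<open>\<zeta>1\<close>, \<open>a1\<close>, \<open>d1\<close> and \<open>z1\<close> are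
  the entries of the triangular Iwasawa factors. The torus angle t shows up as a phase in this part,
  where the characters act, whereas \<open>kap\<close> does not depend on it.\<close>

definition "\<zeta>1 = of_real (lam * x * p / NN \<zeta>) * cis (- t)"
definition "a1 = of_real (lam * x * NN \<zeta> / p) * cis t"
definition "d1 = of_real (x * p / NN \<zeta>) * cis t"
definition "z1 = - \<i> * of_real (\<zeta>\<^sup>2) + of_real (sin t * (NN \<zeta>)\<^sup>2) * cis t"

text \<open>\<open>st\<close> turns diagonal because \<alpha> p - b p / 2 = i / p. The rotation
  turns upper triangular because (i, 1) is a row eigenvector of all rotations. The remaining product
  is the Iwasawa decomposition with unitary factor \<open>kap\<close>.\<close>

lemma eta_PA: "mat2 1 0 \<alpha> 1 ** cmat (PA lam \<zeta> x t) = mat2 \<zeta>1 (\<zeta>1 * z1) 0 a1 ** kap \<zeta>"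
proof -
  define N where "N = NN \<zeta>"
  have N: "N > 0" using NN_pos pos by (simp add: N_def)
  have L1: "mat2 1 0 \<alpha> 1 ** cmat st = mat2 (of_real p) 0 0 (of_real (1 / p)) ** mat2 1 0 \<i> 1"
  proof -
    have "\<alpha> * of_real p + of_real (- b * p / 2) = \<i> * of_real (p * sqrt Dr / 2)" by (simp add: \<alpha>_def field_simps)
    then show ?thesis unfolding p_sqrt st_def cmat_mat2 mat2_ops by (simp add: mat2_eq_iff)
  qed
  have L2: "mat2 1 0 \<i> 1 ** cmat (rot t) = mat2 (cis (- t)) (of_real (sin t)) 0 (cis t) ** mat2 1 0 \<i> 1"
    unfolding rot_def cmat_mat2 mat2_ops by (simp add: mat2_eq_iff complex_eq_iff)
  have L3: "mat2 1 0 \<i> 1 ** cmat (mat2 \<zeta> 0 0 (1 / \<zeta>)) = mat2 (of_real (1 / N)) (- \<i> * of_real (\<zeta>\<^sup>2 / N)) 0 (of_real N) ** kap \<zeta>"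
  proof -
    have e: "1 / (N * N) * (1 / \<zeta> + \<zeta>^3) = \<zeta>" using NN_rel(1)[OF pos(2)] by (simp add: N_def)
    have "complex_of_real (1 / N) * of_real (1 / (\<zeta> * N)) + - \<i> * of_real (\<zeta>\<^sup>2 / N) * (\<i> * of_real (\<zeta> / N)) = of_real (1 / (N * N) * (1 / \<zeta> + \<zeta>^3))"
      by (simp add: distrib_left power2_eq_square power3_eq_cube mult_ac)
    then have "complex_of_real (1 / N) * of_real (1 / (\<zeta> * N)) + - \<i> * of_real (\<zeta>\<^sup>2 / N) * (\<i> * of_real (\<zeta> / N)) = of_real \<zeta>" unfolding e .
    then show ?thesis unfolding kap_def cmat_mat2 mat2_ops N_def[symmetric] using pos N
      by (simp add: mat2_eq_iff power2_eq_square)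
  qed
  have "mat2 1 0 \<alpha> 1 ** cmat (PA lam \<zeta> x t) = (lam * x) *\<^sub>R ((mat2 1 0 \<alpha> 1 ** cmat st) ** cmat (rot t) ** cmat (mat2 \<zeta> 0 0 (1 / \<zeta>)))"
    unfolding PA_def cmat_simps cmat_mult scaleR_matrix_mult by (simp add: matrix_mul_assoc)
  also have "\<dots> = (lam * x) *\<^sub>R (mat2 (of_real p) 0 0 (of_real (1 / p)) ** (mat2 1 0 \<i> 1 ** cmat (rot t)) ** cmat (mat2 \<zeta> 0 0 (1 / \<zeta>)))"
    unfolding L1 by (simp add: matrix_mul_assoc)
  also have "\<dots> = (lam * x) *\<^sub>R (mat2 (of_real p) 0 0 (of_real (1 / p)) ** mat2 (cis (- t)) (of_real (sin t)) 0 (cis t) ** (mat2 1 0 \<i> 1 ** cmat (mat2 \<zeta> 0 0 (1 / \<zeta>))))"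
    unfolding L2 by (simp add: matrix_mul_assoc)
  also have "\<dots> = (lam * x) *\<^sub>R (mat2 (of_real p) 0 0 (of_real (1 / p)) ** mat2 (cis (- t)) (of_real (sin t)) 0 (cis t) ** mat2 (of_real (1 / N)) (- \<i> * of_real (\<zeta>\<^sup>2 / N)) 0 (of_real N)) ** kap \<zeta>"
    unfolding L3 scaleR_matrix_mult by (simp add: matrix_mul_assoc)
  also have "(lam * x) *\<^sub>R (mat2 (of_real p) 0 0 (of_real (1 / p)) ** mat2 (cis (- t)) (of_real (sin t)) 0 (cis t) ** mat2 (of_real (1 / N)) (- \<i> * of_real (\<zeta>\<^sup>2 / N)) 0 (of_real N))
     = mat2 \<zeta>1 (\<zeta>1 * z1) 0 a1"
  proof -
    have c: "cis (- t) * cis t = 1" by (simp add: cis_mult)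
    have "\<zeta>1 * z1 = of_real (lam * x * p / N) * (- \<i> * of_real (\<zeta>\<^sup>2) * cis (- t) + of_real (sin t * N\<^sup>2) * (cis (- t) * cis t))"
      unfolding \<zeta>1_def z1_def N_def by (simp only: algebra_simps)
    also have "\<dots> = of_real (lam * x) * (of_real p * (cis (- t) * (- \<i> * of_real (\<zeta>\<^sup>2 / N)) + of_real (sin t) * of_real N))"
      unfolding c using N by (simp add: field_simps power2_eq_square)
    finally have zz: "\<zeta>1 * z1 = of_real (lam * x) * (of_real p * (cis (- t) * (- \<i> * of_real (\<zeta>\<^sup>2 / N)) + of_real (sin t) * of_real N))" .
    show ?thesis unfolding zz unfolding mat2_ops scaleR_mat2 \<zeta>1_def a1_def N_def[symmetric]
      by (simp add: mat2_eq_iff scaleR_conv_of_real[where 'a=complex] algebra_simps)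
  qed
  finally show ?thesis .
qed

text \<open>The element of K is block diagonal with \<open>kap\<close> in both blocks, a unitary
  matrix being its own conjugate inverse transpose. So the lower block must split off the same
  \<open>kap\<close>, and its entries are dictated by those of the upper block.\<close>

lemma eta_PD: "mat2 1 (- cnj \<alpha>) 0 1 ** cmat (PD \<zeta> x t) = mat2 (of_real (lam * x\<^sup>2) / cnj \<zeta>1) 0 (- d1 * cnj z1) d1 ** kap \<zeta>"
proof -
  define N where "N = NN \<zeta>"
  have N: "N > 0" using NN_pos pos by (simp add: N_def)
  have L1: "mat2 1 (- cnj \<alpha>) 0 1 ** cmat stt = mat2 (of_real (1 / p)) 0 0 (of_real p) ** mat2 1 \<i> 0 1"
  proof -
    have "of_real (b * p / 2) + - cnj \<alpha> * of_real p = \<i> * of_real (p * sqrt Dr / 2)" by (simp add: \<alpha>_def field_simps)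
    then show ?thesis unfolding p_sqrt stt_def cmat_mat2 mat2_ops by (simp add: mat2_eq_iff)
  qed
  have L2: "mat2 1 \<i> 0 1 ** cmat (rot t) = mat2 (cis (- t)) 0 (- of_real (sin t)) (cis t) ** mat2 1 \<i> 0 1"
    unfolding rot_def cmat_mat2 mat2_ops by (simp add: mat2_eq_iff complex_eq_iff)
  have L3: "mat2 1 \<i> 0 1 ** cmat (mat2 (1 / \<zeta>) 0 0 \<zeta>) = mat2 (of_real N) 0 (- \<i> * of_real (\<zeta>\<^sup>2 / N)) (of_real (1 / N)) ** kap \<zeta>"
  proof -
    have e: "1 / (N * N) * (1 / \<zeta> + \<zeta>^3) = \<zeta>" using NN_rel(1)[OF pos(2)] by (simp add: N_def)
    have "- \<i> * complex_of_real (\<zeta>\<^sup>2 / N) * (\<i> * of_real (\<zeta> / N)) + of_real (1 / N) * of_real (1 / (\<zeta> * N)) = of_real (1 / (N * N) * (1 / \<zeta> + \<zeta>^3))"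
      by (simp add: distrib_left power2_eq_square power3_eq_cube mult_ac)
    then have "- \<i> * complex_of_real (\<zeta>\<^sup>2 / N) * (\<i> * of_real (\<zeta> / N)) + of_real (1 / N) * of_real (1 / (\<zeta> * N)) = of_real \<zeta>" unfolding e .
    then show ?thesis unfolding kap_def cmat_mat2 mat2_ops N_def[symmetric] using pos N
      by (simp add: mat2_eq_iff power2_eq_square)
  qed
  have "mat2 1 (- cnj \<alpha>) 0 1 ** cmat (PD \<zeta> x t) = x *\<^sub>R ((mat2 1 (- cnj \<alpha>) 0 1 ** cmat stt) ** cmat (rot t) ** cmat (mat2 (1 / \<zeta>) 0 0 \<zeta>))"
    unfolding PD_def cmat_simps cmat_mult scaleR_matrix_mult by (simp add: matrix_mul_assoc)
  also have "\<dots> = x *\<^sub>R (mat2 (of_real (1 / p)) 0 0 (of_real p) ** (mat2 1 \<i> 0 1 ** cmat (rot t)) ** cmat (mat2 (1 / \<zeta>) 0 0 \<zeta>))"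
    unfolding L1 by (simp add: matrix_mul_assoc)
  also have "\<dots> = x *\<^sub>R (mat2 (of_real (1 / p)) 0 0 (of_real p) ** mat2 (cis (- t)) 0 (- of_real (sin t)) (cis t) ** (mat2 1 \<i> 0 1 ** cmat (mat2 (1 / \<zeta>) 0 0 \<zeta>)))"
    unfolding L2 by (simp add: matrix_mul_assoc)
  also have "\<dots> = x *\<^sub>R (mat2 (of_real (1 / p)) 0 0 (of_real p) ** mat2 (cis (- t)) 0 (- of_real (sin t)) (cis t) ** mat2 (of_real N) 0 (- \<i> * of_real (\<zeta>\<^sup>2 / N)) (of_real (1 / N))) ** kap \<zeta>"
    unfolding L3 scaleR_matrix_mult by (simp add: matrix_mul_assoc)
  also have "x *\<^sub>R (mat2 (of_real (1 / p)) 0 0 (of_real p) ** mat2 (cis (- t)) 0 (- of_real (sin t)) (cis t) ** mat2 (of_real N) 0 (- \<i> * of_real (\<zeta>\<^sup>2 / N)) (of_real (1 / N)))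
     = mat2 (of_real (lam * x\<^sup>2) / cnj \<zeta>1) 0 (- d1 * cnj z1) d1"
  proof -
    have c: "cis t * cis (- t) = 1" by (simp add: cis_mult)
    have "- d1 * cnj z1 = - of_real (x * p / N) * (\<i> * of_real (\<zeta>\<^sup>2) * cis t + of_real (sin t * N\<^sup>2) * (cis t * cis (- t)))"
      unfolding d1_def z1_def N_def by (simp add: cis_cnj algebra_simps)
    also have "\<dots> = of_real x * (of_real p * (- of_real (sin t) * of_real N + cis t * (- \<i> * of_real (\<zeta>\<^sup>2 / N))))"
      unfolding c using N by (simp add: field_simps power2_eq_square)
    finally have zz: "- d1 * cnj z1 = of_real x * (of_real p * (- of_real (sin t) * of_real N + cis t * (- \<i> * of_real (\<zeta>\<^sup>2 / N))))" .
    have "of_real (lam * x\<^sup>2) / cnj \<zeta>1 = of_real (x * N / p) * inverse (cis t)"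
      unfolding \<zeta>1_def N_def[symmetric] using pos N p by (simp add: cis_cnj field_simps power2_eq_square)
    also have "inverse (cis t) = cis (- t)" by simp
    finally have y: "of_real (lam * x\<^sup>2) / cnj \<zeta>1 = of_real (x * N / p) * cis (- t)" .
    show ?thesis unfolding zz y unfolding mat2_ops scaleR_mat2 d1_def N_def[symmetric]
      by (simp add: mat2_eq_iff scaleR_conv_of_real[where 'a=complex] algebra_simps)
  qed
  finally show ?thesis .
qed

lemma eta_PP:
  assumes X: "transpose X = X"
  obtains w y where "eta S ** PP lam \<zeta> x t X = m1 \<zeta>1 ** m2 (mat2 a1 (of_real (trace (S ** X)) * d1) 0 d1) ** nP z1 w y ** blk (kap \<zeta>) 0 0 (kap \<zeta>)"
proof -
  define xc where "xc = of_real (X$1$1) * cnj \<alpha> + of_real (X$1$2)"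
  have N: "NN \<zeta> > 0" using NN_pos pos by simp
  have nz: "\<zeta>1 \<noteq> 0" "a1 \<noteq> 0" unfolding \<zeta>1_def a1_def using pos N p by auto
  have "cis (- t) * cis t = 1" by (simp add: cis_mult)
  then have mu: "cnj a1 * d1 = of_real (lam * x\<^sup>2)"
    unfolding a1_def d1_def using N p by (simp add: cis_cnj power2_eq_square field_simps)
  have "eta S ** PP lam \<zeta> x t X = (eta S ** blk (mat 1) (cmat X) 0 (mat 1)) ** blk (cmat (PA lam \<zeta> x t)) 0 0 (cmat (PD \<zeta> x t))"
    unfolding PP_def rblk_def by (simp add: cmat_simps matrix_mul_assoc)
  also have "\<dots> = blk (mat 1) (mat2 (of_real (X$1$1)) xc (cnj xc) (of_real (trace (S ** X)))) 0 (mat 1) ** (eta S ** blk (cmat (PA lam \<zeta> x t)) 0 0 (cmat (PD \<zeta> x t)))"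
    unfolding eta_u[OF X] xc_def by (simp add: matrix_mul_assoc)
  also have "eta S ** blk (cmat (PA lam \<zeta> x t)) 0 0 (cmat (PD \<zeta> x t)) =
      blk (mat2 \<zeta>1 (\<zeta>1 * z1) 0 a1) 0 0 (mat2 (of_real (lam * x\<^sup>2) / cnj \<zeta>1) 0 (- d1 * cnj z1) d1) ** blk (kap \<zeta>) 0 0 (kap \<zeta>)"
    unfolding eta_S blk_mult by (simp add: eta_PA eta_PD)
  finally have "eta S ** PP lam \<zeta> x t X = blk (mat 1) (mat2 (of_real (X$1$1)) xc (cnj xc) (of_real (trace (S ** X)))) 0 (mat 1) **
      blk (mat2 \<zeta>1 (\<zeta>1 * z1) 0 a1) 0 0 (mat2 (of_real (lam * x\<^sup>2) / cnj \<zeta>1) 0 (- d1 * cnj z1) d1) ** blk (kap \<zeta>) 0 0 (kap \<zeta>)"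
    by (simp only: matrix_mul_assoc)
  then show ?thesis unfolding parabolic_factorization[OF nz mu, symmetric] using that by blast
qed

end

end

lemma unitary_det:
  fixes N :: "complex^2^2"
  assumes "hc N ** N = mat 1"
  shows "det N * cnj (det N) = 1"
proof -
  have "det (hc N ** N) = 1" using assms by simp
  moreover have "det (hc N) = cnj (det N)" by (simp add: det_2)
  ultimately show ?thesis by (simp add: det_mul mult.commute)
qed

lemma trace_mult_commute: "trace (A ** B) = trace (B ** A)" for A B :: "'a::comm_ring_1^2^2"
  by (simp add: trace_def matrix_matrix_mult_def sum_2 algebra_simps)

context form_data
begin

lemma PP_Hplus:
  assumes "lam > 0" "\<zeta> \<noteq> 0" "x > 0" "transpose X = X"
  shows "PP lam \<zeta> x t X \<in> grpHplus"
  unfolding grpHplus_iff2 using PP_similitude[OF assms(2,4), of lam x t] assms(1,3) PP_alt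
  by (metis mult_pos_pos zero_less_power)

lemma det_PD: "\<zeta> \<noteq> 0 \<Longrightarrow> det (PD \<zeta> x t) = x\<^sup>2"
proof -
  assume z: "\<zeta> \<noteq> 0"
  have "det stt = 1" using p0 by (simp add: stt_def mat2_ops)
  then show ?thesis using z by (simp add: PD_def det_scaleR2 det_mul det_rot mat2_ops)
qed

lemma trace_S_PA:
  "trace (S ** PA lam \<zeta> x t ** transpose (PA lam \<zeta> x t)) = (lam * x)\<^sup>2 * (sqrt Dr / 2 * (\<zeta>\<^sup>2 + 1 / \<zeta>\<^sup>2))"
proof -
  let ?A = "PA lam \<zeta> x t"
  have "trace (S ** ?A ** transpose ?A) = trace (transpose ?A ** S ** ?A)"
    by (subst trace_mult_commute) (simp add: matrix_mul_assoc)
  also have "transpose ?A ** S ** ?A = (lam * x)\<^sup>2 *\<^sub>R (mat2 \<zeta> 0 0 (1 / \<zeta>) ** (rot (- t) ** (transpose st ** S ** st) ** rot t) ** mat2 \<zeta> 0 0 (1 / \<zeta>))"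
    by (simp add: PA_def real_mat_ops scaleR_matrix_mult transpose_rot matrix_mul_assoc power2_eq_square mat2_ops(5))
  also have "rot (- t) ** (transpose st ** S ** st) ** rot t = (sqrt Dr / 2) *\<^sub>R mat 1"
    unfolding st_S by (simp add: scaleR_matrix_mult rot_mult rot_0)
  finally show ?thesis by (simp add: scaleR_matrix_mult mat2_ops scaleR_mat2 power2_eq_square algebra_simps)
qed

text \<open>k fixes the base point, so numerator and denominator of the action share the right
  factor J(k, I).\<close>

lemma PP_parts:
  assumes pos: "lam > 0" "\<zeta> > 0" "x > 0" and X: "transpose X = X" and k: "k \<in> KinfH"
  shows "similitude (PP lam \<zeta> x t X ** k) = lam * x\<^sup>2"
    "Jfac (PP lam \<zeta> x t X ** k) basept = cmat (PD \<zeta> x t) ** Jfac k basept"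
    "moebius (PP lam \<zeta> x t X ** k) basept = mat (\<i> * of_real (1 / (lam * x\<^sup>2))) ** cmat (PA lam \<zeta> x t ** transpose (PA lam \<zeta> x t)) + cmat X"
    "PP lam \<zeta> x t X ** k \<in> grpHplus"
proof -
  let ?A = "PA lam \<zeta> x t" and ?D = "PD \<zeta> x t"
  have kK: "k \<in> Kinf" and kH: "k \<in> grpH" using k by (auto simp: KinfH_def)
  have sk: "has_similitude k 1" using KinfD(1)[OF kK] .
  have z: "\<zeta> \<noteq> 0" using pos by simp
  have sim: "has_similitude (PP lam \<zeta> x t X ** k) (lam * x\<^sup>2)"
    using has_similitude_mult[OF PP_similitude[OF z X, of lam x t] sk] by simp
  then show s: "similitude (PP lam \<zeta> x t X ** k) = lam * x\<^sup>2" by (rule similitude_eq)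
  have "PP lam \<zeta> x t X \<in> grpHplus" using PP_Hplus pos X z by blast
  then have "PP lam \<zeta> x t X ** k \<in> grpH" using kH by (auto simp: grpHplus_iff intro: grpH_mult)
  then show "PP lam \<zeta> x t X ** k \<in> grpHplus" unfolding grpHplus_iff s using pos by simp
  define A B C D where "A = blkA k" and "B = blkB k" and "C = blkC k" and "D = blkD k"
  have g: "k = blk A B C D" by (simp add: A_def B_def C_def D_def blk_eta)
  define N where "N = Jfac k basept"
  have N: "C ** mat \<i> + D = N" by (simp add: N_def g Jfac_blk)
  have P: "A ** mat \<i> + B = mat \<i> ** N" using KinfD(2)[OF kK] by (simp add: g N_def)
  have pp: "PP lam \<zeta> x t X ** k = blk (cmat ?A ** A + cmat (X ** ?D) ** C) (cmat ?A ** B + cmat (X ** ?D) ** D) (cmat ?D ** C) (cmat ?D ** D)"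
    unfolding PP_alt rblk_def g blk_mult by (simp add: cmat_simps)
  have J: "(cmat ?D ** C) ** mat \<i> + cmat ?D ** D = cmat ?D ** N"
    unfolding N[symmetric] by (simp add: matrix_add_ldistrib matrix_mul_assoc)
  show JJ: "Jfac (PP lam \<zeta> x t X ** k) basept = cmat ?D ** Jfac k basept"
    unfolding pp Jfac_blk J N_def ..
  have "(cmat ?A ** A + cmat (X ** ?D) ** C) ** mat \<i> + (cmat ?A ** B + cmat (X ** ?D) ** D) = cmat ?A ** (A ** mat \<i> + B) + cmat (X ** ?D) ** (C ** mat \<i> + D)"
    by (simp add: matrix_add_ldistrib matrix_distrib_right matrix_mul_assoc add_ac)
  also have "\<dots> = (mat \<i> ** cmat ?A + cmat (X ** ?D)) ** N"
    unfolding N P by (simp add: matrix_distrib_right matrix_mul_assoc mat_commute)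
  finally have num: "(cmat ?A ** A + cmat (X ** ?D) ** C) ** mat \<i> + (cmat ?A ** B + cmat (X ** ?D) ** D) = (mat \<i> ** cmat ?A + cmat (X ** ?D)) ** N" .
  define \<mu> where "\<mu> = lam * x\<^sup>2"
  have mu: "\<mu> \<noteq> 0" using pos by (simp add: \<mu>_def)
  define Di where "Di = (1 / \<mu>) *\<^sub>R transpose ?A"
  have DiD: "Di ** ?D = mat 1" unfolding Di_def scaleR_matrix_mult PA_PD[OF z] \<mu>_def[symmetric]
    using mu by (simp add: mat2_eq_iff mat_def)
  then have DDi: "?D ** Di = mat 1" using matrix_left_right_inverse by blast
  have iN: "invertible N" using KinfD(3)[OF kK] by (simp add: N_def)
  have "matrix_inv (cmat ?D ** N) = matrix_inv N ** cmat Di"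
  proof (rule matrix_inv_eqI)
    have "cmat ?D ** N ** (matrix_inv N ** cmat Di) = cmat ?D ** (N ** matrix_inv N) ** cmat Di" by (simp add: matrix_mul_assoc)
    then show "cmat ?D ** N ** (matrix_inv N ** cmat Di) = mat 1"
      using DDi by (simp add: invertible_mult[OF iN] cmat_mult[symmetric] cmat_simps)
  qed
  then have "moebius (PP lam \<zeta> x t X ** k) basept = (mat \<i> ** cmat ?A + cmat (X ** ?D)) ** (N ** matrix_inv N) ** cmat Di"
    unfolding pp moebius_blk J num by (simp add: matrix_mul_assoc)
  also have "\<dots> = mat \<i> ** cmat (?A ** Di) + cmat (X ** (?D ** Di))"
    unfolding invertible_mult[OF iN] by (simp add: matrix_distrib_right cmat_mult matrix_mul_assoc)
  also have "\<dots> = mat (\<i> * of_real (1 / \<mu>)) ** cmat (?A ** transpose ?A) + cmat X"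
    unfolding DDi by (simp add: Di_def scaleR_matrix_mult cmat_simps) (simp add: mat2_eq_iff matrix_matrix_mult_def sum_2 mat_def scaleR_conv_of_real[where 'a=complex])
  finally show "moebius (PP lam \<zeta> x t X ** k) basept = mat (\<i> * of_real (1 / (lam * x\<^sup>2))) ** cmat (PA lam \<zeta> x t ** transpose (PA lam \<zeta> x t)) + cmat X"
    unfolding \<mu>_def .
qed

text \<open>The trace of S against the imaginary part of h<I> on the normal form; the coordinate x
  has dropped out of it.\<close>

definition tt :: "real \<Rightarrow> real \<Rightarrow> real" where "tt lam \<zeta> = lam * (sqrt Dr * ((\<zeta>\<^sup>2 + 1 / \<zeta>\<^sup>2) / 2))"

text \<open>The similitude factor contributes x^(2 l) and det \<open>PD\<close> = x^2 the inverse of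
  this. Conjugating h<I> reverses the sign of its imaginary part, so that the exponential
  decays.\<close>

lemma Bessel_PP:
  assumes pos: "lam > 0" "\<zeta> > 0" "x > 0" and X: "transpose X = X" and k: "k \<in> KinfH"
  shows "Bessel_fun S l (PP lam \<zeta> x t X ** k) = of_real lam ^ l * cnj (det (Jfac k basept) powi (- int l)) *
     exp (- 2 * of_real pi * \<i> * of_real (trace (S ** X))) * exp (- 2 * of_real pi * of_real (tt lam \<zeta>))"
proof -
  note P = PP_parts[OF pos X k, of t]
  let ?A = "PA lam \<zeta> x t"
  define \<mu> where "\<mu> = lam * x\<^sup>2"
  have mu: "\<mu> > 0" using pos by (simp add: \<mu>_def)
  define Y where "Y = ?A ** transpose ?A"
  have "map_matrix cnj (mat (\<i> * of_real (1 / \<mu>)) ** cmat Y + cmat X) = cmat X - mat (\<i> * of_real (1 / \<mu>)) ** cmat Y"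
    by (simp add: mat2_eq_iff matrix_matrix_mult_def sum_2 mat_def map_matrix_def)
  moreover have "trace (cmat S ** (cmat X - mat (\<i> * of_real c) ** cmat Y)) = of_real (trace (S ** X)) - \<i> * of_real (c * trace (S ** Y))" for c
    by (simp add: trace_def matrix_matrix_mult_def sum_2 mat_def) (simp add: algebra_simps)
  ultimately have "trace (cmat S ** map_matrix cnj (mat (\<i> * of_real (1 / \<mu>)) ** cmat (?A ** transpose ?A) + cmat X))
     = of_real (trace (S ** X)) - \<i> * of_real (1 / \<mu> * trace (S ** ?A ** transpose ?A))"
    unfolding Y_def by (simp only: matrix_mul_assoc)
  also have "1 / \<mu> * trace (S ** ?A ** transpose ?A) = tt lam \<zeta>"
    unfolding trace_S_PA \<mu>_def tt_def using pos by (simp add: power2_eq_square)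
  finally have tr: "trace (cmat S ** map_matrix cnj (moebius (PP lam \<zeta> x t X ** k) basept)) = of_real (trace (S ** X)) - \<i> * of_real (tt lam \<zeta>)"
    unfolding P(3) \<mu>_def .
  have e: "exp (- 2 * of_real pi * \<i> * (of_real (trace (S ** X)) - \<i> * of_real (tt lam \<zeta>))) = 
     exp (- 2 * of_real pi * \<i> * of_real (trace (S ** X))) * exp (- 2 * complex_of_real pi * of_real (tt lam \<zeta>))"
    unfolding mult_exp_exp by (rule arg_cong[where f = exp]) (simp add: algebra_simps)
  have "det (cmat (PD \<zeta> x t)) = of_real (x\<^sup>2)" using det_PD[of \<zeta> x t] pos by (simp add: det_2 flip: of_real_mult of_real_diff)
  then have d: "det (Jfac (PP lam \<zeta> x t X ** k) basept) = of_real (x\<^sup>2) * det (Jfac k basept)"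
    unfolding P(2) det_mul by simp
  have "of_real (lam * x\<^sup>2) ^ l * cnj ((of_real (x\<^sup>2) * det (Jfac k basept)) powi (- int l)) =
      of_real lam ^ l * (of_real (x\<^sup>2) ^ l * of_real (x\<^sup>2) powi (- int l)) * cnj (det (Jfac k basept) powi (- int l))"
    by (simp add: power_int_mult_distrib power_mult_distrib power_int_minus)
  also have "complex_of_real (x\<^sup>2) ^ l * of_real (x\<^sup>2) powi (- int l) = 1"
    using pos by (simp add: power_int_minus)
  finally have "of_real (lam * x\<^sup>2) ^ l * cnj ((of_real (x\<^sup>2) * det (Jfac k basept)) powi (- int l)) = of_real lam ^ l * cnj (det (Jfac k basept) powi (- int l))" by simp
  then show ?thesis unfolding Bessel_fun_def tr e d P(1) using P(4) by (simp add: mult.assoc)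
qed

end

text \<open>The data are normalized to lower right entry 1 of S, so the additive character of the
  Whittaker model is psi(-x).\<close>

locale bessel_section = form_data +
  fixes l :: nat and l1 l2 :: int and \<omega> :: "real \<Rightarrow> complex" and W0 :: "real^2^2 \<Rightarrow> complex" and Wh :: "real \<Rightarrow> complex"
    and q aplus s :: complex and \<chi>0 :: "complex \<Rightarrow> complex" and W0x :: "complex^2^2 \<Rightarrow> complex"
    and Wsharp :: "complex^4^4 \<Rightarrow> complex \<Rightarrow> complex"
  assumes W0_u: "\<And>x g. W0 (mat2 1 x 0 1 ** g) = psi (- x) * W0 g"
    and W0_central: "\<And>z g. z \<noteq> 0 \<Longrightarrow> W0 (mat z ** g) = \<omega> z * W0 g"
    and omega: "\<And>y. y > 0 \<Longrightarrow> \<omega> y = of_real y powr q"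
    and W0_diag: "\<And>t. t > 0 \<Longrightarrow> W0 (mat2 t 0 0 1) = aplus * \<omega> (sqrt (4 * pi * t)) * Wh (4 * pi * t)"
    and chi0: "chi0_char \<omega> l2 \<chi>0"
    and W0x: "extends_to_GU11 \<chi>0 W0 W0x"
    and Wsharp: "is_section l l1 \<chi>0 W0x Wsharp"
begin

definition m :: nat where "m = nat \<bar>int l - l1\<bar>"

text \<open>The integrand on the double coset of lam and X = (\<zeta>^2 + \<zeta>^(-2)) / 2. In
  order: the modulus character, the part of \<chi> that survives the central character of W0, the
  Whittaker function, \<open>f_K\<close>, and the two factors of the Bessel function.\<close>

definition phi :: "real \<Rightarrow> real \<Rightarrow> complex" where
  "phi lam X = of_real ((lam / (sqrt Dr * X)) ^ 3) powr (s + 1/2) * of_real lam powr (- q) *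
     (aplus * \<omega> (sqrt (4 * pi * (lam * (sqrt Dr * X)))) * Wh (4 * pi * (lam * (sqrt Dr * X)))) *
     (\<i> / of_real X) ^ m * of_real lam ^ l * exp (- 2 * of_real pi * of_real (lam * (sqrt Dr * X)))"

definition XX :: "real \<Rightarrow> real" where "XX \<zeta> = (\<zeta>\<^sup>2 + 1 / \<zeta>\<^sup>2) / 2"

lemma f_K_value:
  assumes z: "\<zeta> > 0" and k: "k \<in> KinfH"
  shows "f_K l l1 (blk (kap \<zeta>) 0 0 (kap \<zeta>) ** k) = (\<i> / of_real (XX \<zeta>)) ^ m * det (Jfac k basept) powi (- int l)"
proof -
  let ?k = "blk (kap \<zeta>) 0 0 (kap \<zeta>)"
  have "(?k ** k) ** transpose (?k ** k) = ?k ** (k ** transpose k) ** transpose ?k"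
    by (simp add: matrix_transpose_mul matrix_mul_assoc)
  also have "\<dots> = ?k ** transpose ?k" using KinfH_transpose[OF k] by simp
  also have "\<dots> = blk (kap \<zeta> ** transpose (kap \<zeta>)) 0 0 (kap \<zeta> ** transpose (kap \<zeta>))"
  proof -
    have "transpose (0::complex^2^2) = 0" by (simp add: mat2_eq_iff transpose_def)
    then show ?thesis by (simp add: transpose_blk blk_mult)
  qed
  finally have e: "(?k ** k) ** transpose (?k ** k) = blk (kap \<zeta> ** transpose (kap \<zeta>)) 0 0 (kap \<zeta> ** transpose (kap \<zeta>))" .
  have J: "Jfac ((?k ** k) ** transpose (?k ** k)) basept = kap \<zeta> ** transpose (kap \<zeta>)"
    unfolding e Jfac_blk by simp
  have c: "2 * \<i> / of_real ((NN \<zeta>)\<^sup>2) = \<i> / of_real (XX \<zeta>)"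
    unfolding NN_sq XX_def by simp
  have kK: "k \<in> Kinf" using k by (simp add: KinfH_def)
  have d: "det (Jfac (?k ** k) basept) = det (Jfac k basept)"
    unfolding Kinf_mult(2)[OF kap_Kinf[OF z] kK] det_mul using kap_unitary(2)[OF z] by (simp add: Jfac_blk)
  show ?thesis
  proof (cases "int l \<le> l1")
    case True
    then have "m = nat (l1 - int l)" by (simp add: m_def)
    then show ?thesis unfolding f_K_def Let_def J d kap_unitary(3)[OF z] c using True by simp
  next
    case False
    then have "m = nat (int l - l1)" by (simp add: m_def)
    then show ?thesis unfolding f_K_def Let_def J d kap_unitary(3)[OF z] c using False by simp
  qed
qed

lemma integrand_PP:
  assumes pos: "lam > 0" "\<zeta> > 0" "x > 0" and X: "transpose X = X" and k: "k \<in> KinfH"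
  shows "Wsharp (eta S ** (PP lam \<zeta> x t X ** k)) s * Bessel_fun S l (PP lam \<zeta> x t X ** k) = phi lam (XX \<zeta>)"
proof -
  define N where "N = NN \<zeta>"
  have N: "N > 0" using NN_pos pos by (simp add: N_def)
  have N2: "N * N = 2 * XX \<zeta>" using NN_sq[of \<zeta>] by (simp add: N_def XX_def power2_eq_square)
  have X0: "XX \<zeta> > 0" using N2 N by (metis mult_pos_pos zero_less_mult_pos zero_less_numeral)
  define \<tau> where "\<tau> = trace (S ** X)"
  define a where "a = a1 lam \<zeta> x t"
  define d where "d = d1 \<zeta> x t"
  define z where "z = \<zeta>1 lam \<zeta> x t"
  have a: "a = of_real (lam * x * N / p) * cis t" and d: "d = of_real (x * p / N) * cis t" and z: "z = of_real (lam * x * p / N) * cis (- t)"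
    unfolding a_def d_def z_def N_def a1_def[OF pos] d1_def[OF pos] \<zeta>1_def[OF pos] by simp_all
  obtain w y z1 where eta: "eta S ** PP lam \<zeta> x t X = m1 z ** m2 (mat2 a (of_real \<tau> * d) 0 d) ** nP z1 w y ** blk (kap \<zeta>) 0 0 (kap \<zeta>)"
    using eta_PP[OF pos X, of t] unfolding a_def d_def z_def \<tau>_def by metis
  \<comment> \<open>The argument of the Whittaker function is the phase cis t times this real
    matrix, so its value follows from the extension by \<chi>0.\<close>
  define gr where "gr = mat2 (lam * x * N / p) (\<tau> * (x * p / N)) 0 (x * p / N)"
  have mm: "mat2 a (of_real \<tau> * d) 0 d = mat (cis t) ** cmat gr"
    unfolding gr_def cmat_mat2 mat2_ops a d by (simp add: mult_ac)
  have gi: "invertible gr" unfolding invertible_det_nz gr_def mat2_ops using pos N p by simp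
  have mG: "mat2 a (of_real \<tau> * d) 0 d \<in> GU11" unfolding GU11_def mm using gi cis_neq_zero by blast
  have z0: "z \<noteq> 0" unfolding z using pos N p by simp
  have kk: "blk (kap \<zeta>) 0 0 (kap \<zeta>) ** k \<in> Kinf" using Kinf_mult(1)[OF kap_Kinf[OF pos(2)]] k by (simp add: KinfH_def)
  have "Wsharp (eta S ** (PP lam \<zeta> x t X ** k)) s = Wsharp (m1 z ** m2 (mat2 a (of_real \<tau> * d) 0 d) ** nP z1 w y ** (blk (kap \<zeta>) 0 0 (kap \<zeta>) ** k)) s"
    unfolding matrix_mul_assoc eta ..
  also have "\<dots> = of_real (deltaP z (mat2 a (of_real \<tau> * d) 0 d)) powr (s + 1/2) * inverse (\<chi>0 (cnj z)) * W0x (mat2 a (of_real \<tau> * d) 0 d) * f_K l l1 (blk (kap \<zeta>) 0 0 (kap \<zeta>) ** k)"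
    using Wsharp z0 mG kk unfolding is_section_def by blast
  finally have W: "Wsharp (eta S ** (PP lam \<zeta> x t X ** k)) s = of_real (deltaP z (mat2 a (of_real \<tau> * d) 0 d)) powr (s + 1/2) * inverse (\<chi>0 (cnj z)) *
     W0x (mat2 a (of_real \<tau> * d) 0 d) * ((\<i> / of_real (XX \<zeta>)) ^ m * det (Jfac k basept) powi (- int l))"
    unfolding f_K_value[OF pos(2) k] .
  have delta: "deltaP z (mat2 a (of_real \<tau> * d) 0 d) = (lam / (sqrt Dr * XX \<zeta>)) ^ 3"
  proof -
    have "cis t * cis (- t) = 1" by (simp add: cis_mult)
    then have mu: "mu11 (mat2 a (of_real \<tau> * d) 0 d) = of_real (lam * x\<^sup>2)"
      unfolding mu11_def a d using N p by (simp add: cis_cnj power2_eq_square field_simps)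
    have "z * cnj z = of_real ((cmod z)\<^sup>2)" by (rule complex_norm_square[symmetric])
    moreover have "cmod z = lam * x * p / N" unfolding z norm_mult norm_of_real using pos N p by simp
    ultimately have zz: "z * cnj z = of_real ((lam * x * p / N)\<^sup>2)" by simp
    have "cmod (z * cnj z * inverse (of_real (lam * x\<^sup>2))) = (lam * x * p / N)\<^sup>2 / (lam * x\<^sup>2)"
      unfolding zz divide_inverse[symmetric] of_real_divide[symmetric] norm_of_real using pos by simp
    also have "\<dots> = lam * (p\<^sup>2 / (N * N))" using pos by (simp add: power2_eq_square)
    also have "p\<^sup>2 = 2 / sqrt Dr" using p Dr by (simp add: field_simps)
    also have "lam * (2 / sqrt Dr / (N * N)) = lam / (sqrt Dr * XX \<zeta>)" unfolding N2 by simp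
    finally show ?thesis unfolding deltaP_def mu by simp
  qed
  have chi: "\<chi>0 (u * v) = \<chi>0 u * \<chi>0 v" if "u \<noteq> 0" "v \<noteq> 0" for u v using chi0 that by (auto simp: chi0_char_def)
  have chir: "\<chi>0 (of_real r) = \<omega> r" if "r \<noteq> 0" for r using chi0 that by (auto simp: chi0_char_def)
  have chiu: "\<chi>0 (cis t) \<noteq> 0" using chi0 by (simp add: chi0_char_def power_int_eq_0_iff)
  \<comment> \<open>\<chi>(\<zeta>) involves the conjugate of \<zeta>, which turns the phase cis
    (-t) of \<open>z\<close> into the cis t carried by the \<open>m2\<close> part; the two
    contributions cancel.\<close>
  have cz: "\<chi>0 (cnj z) = \<omega> (lam * x * p / N) * \<chi>0 (cis t)"
  proof -
    have "cnj z = of_real (lam * x * p / N) * cis t" unfolding z by (simp add: cis_cnj)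
    then show ?thesis using pos N p by (simp only:) (subst chi, auto simp: chir simp flip: of_real_mult of_real_divide)
  qed
  define r where "r = x * p / N"
  have r: "r > 0" using pos N p by (simp add: r_def)
  \<comment> \<open>\<open>gr\<close> is the unipotent matrix with entry \<tau> times the scalar
    \<open>r\<close> times diag(T, 1), and \<open>T\<close> is
    \<open>tt lam \<zeta>\<close>.\<close>
  define T where "T = lam * (sqrt Dr * XX \<zeta>)"
  have T: "T > 0" unfolding T_def using pos X0 Dr by simp
  have rT: "r * T = lam * x * N / p"
  proof -
    have sp: "sqrt Dr * p = 2 / p" using p_sqrt p by (simp add: field_simps)
    have "r * T = lam * x * (sqrt Dr * p) * XX \<zeta> / N" unfolding r_def T_def by (simp add: mult_ac)
    also have "\<dots> = lam * x * (2 / p) * XX \<zeta> / N" unfolding sp ..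
    also have "\<dots> = lam * x / p * (N * N) / N" unfolding N2 by simp
    finally show ?thesis using N by simp
  qed
  have "gr = mat2 1 \<tau> 0 1 ** (mat r ** mat2 T 0 0 1)"
    unfolding gr_def rT[symmetric] r_def[symmetric] mat2_ops by (simp add: mult_ac)
  then have "W0 gr = psi (- \<tau>) * (\<omega> r * (aplus * \<omega> (sqrt (4 * pi * T)) * Wh (4 * pi * T)))"
    using W0_u W0_central W0_diag[OF T] r by simp
  then have W0m: "W0x (mat2 a (of_real \<tau> * d) 0 d) = \<chi>0 (cis t) * (psi (- \<tau>) * (\<omega> r * (aplus * \<omega> (sqrt (4 * pi * T)) * Wh (4 * pi * T))))"
    unfolding mm using W0x gi cis_neq_zero unfolding extends_to_GU11_def by metis
  have om: "\<omega> (lam * x * p / N) = of_real lam powr q * \<omega> r" "\<omega> r \<noteq> 0"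
  proof -
    have "lam * x * p / N = lam * r" by (simp add: r_def)
    then show "\<omega> (lam * x * p / N) = of_real lam powr q * \<omega> r" using pos r by (simp add: omega powr_times_real)
    show "\<omega> r \<noteq> 0" using r by (simp add: omega)
  qed
  have ps: "psi (- \<tau>) * exp (- 2 * of_real pi * \<i> * of_real \<tau>) = 1"
    unfolding psi_def mult_exp_exp by simp
  have kK: "k \<in> Kinf" using k by (simp add: KinfH_def)
  define dk where "dk = det (Jfac k basept)"
  have "dk * cnj dk = 1" unfolding dk_def by (rule unitary_det[OF KinfD(4)[OF kK]])
  \<comment> \<open>The section carries a power of det J(k, I) and the Bessel function its
    conjugate; J(k, I) is unitary, so they multiply to 1.\<close>
  then have dd: "dk powi (- int l) * cnj (dk powi (- int l)) = 1"
    by (simp add: power_int_minus flip: power_mult_distrib inverse_mult_distrib)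
  have B: "Bessel_fun S l (PP lam \<zeta> x t X ** k) = of_real lam ^ l * cnj (dk powi (- int l)) * exp (- 2 * of_real pi * \<i> * of_real \<tau>) * exp (- 2 * of_real pi * of_real T)"
    unfolding Bessel_PP[OF pos X k] tt_def XX_def[symmetric] T_def dk_def \<tau>_def ..
  have lamq: "inverse (of_real lam powr q) = of_real lam powr (- q)" by (simp add: powr_minus)
  have "Wsharp (eta S ** (PP lam \<zeta> x t X ** k)) s * Bessel_fun S l (PP lam \<zeta> x t X ** k) =
     of_real ((lam / (sqrt Dr * XX \<zeta>)) ^ 3) powr (s + 1/2) * (inverse (of_real lam powr q) * (inverse (\<omega> r) * \<omega> r) * (inverse (\<chi>0 (cis t)) * \<chi>0 (cis t))) *
     (aplus * \<omega> (sqrt (4 * pi * T)) * Wh (4 * pi * T)) * (\<i> / of_real (XX \<zeta>)) ^ m * of_real lam ^ l *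
     exp (- 2 * of_real pi * of_real T) * (psi (- \<tau>) * exp (- 2 * of_real pi * \<i> * of_real \<tau>)) * (dk powi (- int l) * cnj (dk powi (- int l)))"
    unfolding W delta cz om W0m B dk_def[symmetric] inverse_mult_distrib by (simp only: mult_ac)
  also have "\<dots> = phi lam (XX \<zeta>)"
    unfolding ps dd lamq phi_def T_def using om(2) chiu by simp
  finally show ?thesis .
qed

end

section \<open>Invariance and measurability of the integrand\<close>

lemma mat1_KinfH: "mat 1 \<in> KinfH"
  unfolding KinfH_iff
  by (rule exI[of _ 0], rule exI[of _ "mat 1"]) (simp add: rblk_def mat4_blk cmat_simps real_mat_ops)

context form_data
begin

lemma grpR_Hplus:
  assumes "r \<in> grpR S"
  shows "r \<in> grpHplus"
proof -
  obtain g Y where g: "g \<in> grpT S" and Y: "transpose Y = Y" and r: "r = embT g ** rblk (mat 1) Y 0 (mat 1)"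
    using assms by (auto simp: grpR_def grpU_def rblk_def cmat_simps)
  obtain y s where y: "y > 0" "g = y *\<^sub>R (st ** rot s ** sti)" "det g *\<^sub>R matrix_inv (transpose g) = y *\<^sub>R (stt ** rot s ** transpose st)" "det g = y\<^sup>2"
    using grpT_form[OF g] by metis
  define G' where "G' = y *\<^sub>R (stt ** rot s ** transpose st)"
  have e: "embT g = rblk g 0 0 G'" unfolding embT_def rblk_def y(3) G'_def by (simp add: cmat_simps)
  have tg: "transpose g = y *\<^sub>R (stt ** rot (- s) ** transpose st)"
    unfolding y(2) real_mat_ops st_inv transpose_rot by (simp add: matrix_mul_assoc)
  have "transpose g ** G' = (y * y) *\<^sub>R (stt ** (rot (- s) ** (transpose st ** stt) ** rot s) ** transpose st)"
    unfolding tg G'_def by (simp add: scaleR_matrix_mult matrix_mul_assoc)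
  then have gG: "transpose g ** G' = mat (y\<^sup>2)" by (simp add: st_inv rot_mult rot_0 power2_eq_square) (simp add: mat2_eq_iff mat_def)
  have "has_similitude (embT g) (y\<^sup>2)" unfolding e has_similitude_rblk using gG by simp
  moreover have "has_similitude (rblk (mat 1) Y 0 (mat 1)) 1"
    unfolding has_similitude_rblk using Y by (simp add: real_mat_ops)
  ultimately have "has_similitude r (y\<^sup>2 * 1)" unfolding r by (rule has_similitude_mult)
  moreover have "r = rblk g (g ** Y) 0 G'" unfolding r e rblk_mult by simp
  ultimately show ?thesis unfolding grpHplus_iff2 using y(1) by (metis mult.right_neutral zero_less_power)
qed

lemma mat1_grpR: "mat 1 \<in> grpR S"
proof -
  have "matrix_inv (mat 1 :: real^2^2) = mat 1" by (rule matrix_inv_eqI) simp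
  moreover have "transpose (mat 1 :: real^2^2) = mat 1" by (simp add: real_mat_ops)
  ultimately have "embT (mat 1) = mat 1" by (simp add: embT_def cmat_simps mat4_blk)
  moreover have "mat 1 \<in> grpT S"
    unfolding grpT_def by (simp add: real_mat_ops invertible_det_nz)
  moreover have "mat 1 \<in> grpU" unfolding grpU_def by (auto simp: mat4_blk cmat_simps intro!: exI[of _ 0])
  ultimately show ?thesis unfolding grpR_def by (metis (mono_tags, lifting) matrix_mul_lid mem_Collect_eq)
qed

lemma cosetR_self: "h \<in> cosetR S h"
  unfolding cosetR_def using mat1_grpR by (metis image_eqI matrix_mul_lid)

lemma cosetR_grpH: "h \<in> grpH \<Longrightarrow> x \<in> cosetR S h \<Longrightarrow> x \<in> grpH"
  unfolding cosetR_def using grpR_Hplus grpH_mult by (auto simp: grpHplus_iff)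

text \<open>The coset is nonempty, since it contains h, so the chosen point is some r h, and
  invariance removes r.\<close>

lemma on_coset_eq:
  assumes "\<forall>r\<in>grpR S. \<forall>h\<in>grpH. F (r ** h) = F h" "h \<in> grpH"
  shows "on_coset F (cosetR S h) = F h"
proof -
  have "(SOME x. x \<in> cosetR S h) \<in> cosetR S h" using cosetR_self by (rule someI)
  then show ?thesis unfolding on_coset_def using assms by (auto simp: cosetR_def)
qed

text \<open>A set of cosets is measurable when its union is Borel. Identifying the union of a
  preimage reduces measurability on the quotient to measurability on H(R).\<close>

lemma Union_quotRH: "\<Union>{X \<in> quotRH S. on_coset F X \<in> A} = {h \<in> grpH. F h \<in> A}"
  if F: "\<forall>r\<in>grpR S. \<forall>h\<in>grpH. F (r ** h) = F h"
proof (intro equalityI subsetI)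
  fix h assume "h \<in> \<Union>{X \<in> quotRH S. on_coset F X \<in> A}"
  then obtain h' where h': "h' \<in> grpH" "h \<in> cosetR S h'" "on_coset F (cosetR S h') \<in> A" by (auto simp: quotRH_def)
  have "F h = F h'" using h' F by (auto simp: cosetR_def)
  then show "h \<in> {h \<in> grpH. F h \<in> A}" using h' on_coset_eq[OF F h'(1)] cosetR_grpH by auto
next
  fix h assume "h \<in> {h \<in> grpH. F h \<in> A}"
  then show "h \<in> \<Union>{X \<in> quotRH S. on_coset F X \<in> A}"
    using on_coset_eq[OF F, of h] cosetR_self[of h] by (auto simp: quotRH_def intro!: bexI[of _ h])
qed

text \<open>The coordinates of a decomposition are merely chosen. The quantities built from Q are
  continuous in the entries of h and recover lam and X on H+(R): \<open>sQ\<close> is the trace of S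
  times the adjugate of Q, and \<open>muf\<close> reads the similitude factor off one entry.\<close>

definition Qh :: "complex^4^4 \<Rightarrow> complex^2^2" where
  "Qh h = Jfac h basept ** hc (Jfac h basept)"
definition dQ :: "complex^4^4 \<Rightarrow> real" where "dQ h = Re (det (Qh h))"
definition sQ :: "complex^4^4 \<Rightarrow> real" where "sQ h = a * Re (Qh h$2$2) - b * Re (Qh h$1$2) + Re (Qh h$1$1)"
definition muf :: "complex^4^4 \<Rightarrow> real" where "muf h = Re ((hc h ** Jsymp ** h)$1$3)"

lemma muf_similitude: "has_similitude h \<mu> \<Longrightarrow> muf h = \<mu>"
  by (simp add: muf_def has_similitude_alt) (simp add: Jsymp_def mat_def)

text \<open>Q becomes E = D D^t with determinant x^4. Since E A A^t is scalar, the adjugate of E is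
  proportional to A A^t, whose trace against S is \<open>trace_S_PA\<close>.\<close>

lemma PP_invariants:
  fixes t :: real
  assumes pos: "lam > 0" "\<zeta> > 0" "x > 0" and X: "transpose X = X" and k: "k \<in> KinfH"
  defines "h \<equiv> PP lam \<zeta> x t X ** k"
  shows "muf h / sqrt (dQ h) = lam" "sQ h / (sqrt (dQ h) * sqrt Dr) = (\<zeta>\<^sup>2 + 1 / \<zeta>\<^sup>2) / 2"
proof -
  let ?A = "PA lam \<zeta> x t" and ?D = "PD \<zeta> x t"
  have z: "\<zeta> \<noteq> 0" using pos by simp
  note P = PP_parts[OF pos X k, of t, folded h_def]
  have kK: "k \<in> Kinf" using k by (simp add: KinfH_def)
  have "Jfac k basept ** hc (Jfac k basept) = mat 1" using KinfD(4)[OF kK] matrix_left_right_inverse by blast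
  then have "cmat ?D ** (Jfac k basept ** hc (Jfac k basept)) ** hc (cmat ?D) = cmat ?D ** hc (cmat ?D)" by simp
  then have Q: "Qh h = cmat (?D ** transpose ?D)"
    unfolding Qh_def P(2) hc_mult by (simp add: matrix_mul_assoc cmat_mult cmat_simps)
  define E where "E = ?D ** transpose ?D"
  have dE: "det E = x^4" unfolding E_def det_mul det_transpose det_PD[OF z] by (simp flip: power_add)
  have "dQ h = det E" unfolding dQ_def Q E_def[symmetric] by (simp add: det_2)
  then have d: "sqrt (dQ h) = x\<^sup>2" unfolding dE using pos by (simp add: real_sqrt_unique)
  have "muf h = lam * x\<^sup>2" using P(1,4) has_similitude_similitude[of h] by (auto simp: grpHplus_iff grpH_def intro: muf_similitude)
  then show "muf h / sqrt (dQ h) = lam" unfolding d using pos by simp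
  define B where "B = ?A ** transpose ?A"
  have DA: "transpose ?D ** ?A = mat (lam * x\<^sup>2)"
    using arg_cong[OF PA_PD[OF z, of lam x t], of transpose] by (simp add: real_mat_ops)
  have DA': "?D ** transpose ?A = mat (lam * x\<^sup>2)"
  proof -
    define c where "c = lam * x\<^sup>2"
    have c: "c \<noteq> 0" using pos by (simp add: c_def)
    have "((1 / c) *\<^sub>R transpose ?A) ** ?D = mat 1"
      unfolding scaleR_matrix_mult PA_PD[OF z] c_def[symmetric] using c by (simp add: mat2_eq_iff mat_def)
    then have "?D ** ((1 / c) *\<^sub>R transpose ?A) = mat 1" using matrix_left_right_inverse by blast
    then have "c *\<^sub>R (?D ** ((1 / c) *\<^sub>R transpose ?A)) = c *\<^sub>R mat 1" by simp
    then show ?thesis using c unfolding c_def[symmetric] scaleR_matrix_mult by (simp add: mat2_eq_iff mat_def)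
  qed
  have "E ** B = ?D ** (transpose ?D ** ?A) ** transpose ?A" by (simp add: E_def B_def matrix_mul_assoc)
  also have "\<dots> = (lam * x\<^sup>2) *\<^sub>R (?D ** transpose ?A)" unfolding DA by (simp add: real_mat_ops scaleR_matrix_mult)
  finally have EB: "E ** B = (lam * x\<^sup>2)\<^sup>2 *\<^sub>R mat 1" unfolding DA' by (simp add: mat2_eq_iff mat_def power2_eq_square)
  define adj where "adj = mat2 (E$2$2) (- E$1$2) (- E$2$1) (E$1$1)"
  have "adj ** E = det E *\<^sub>R mat 1" by (simp add: adj_def mat2_eq_iff matrix_matrix_mult_def sum_2 det_2 mat_def algebra_simps)
  then have "det E *\<^sub>R B = adj ** (E ** B)" by (simp add: matrix_mul_assoc scaleR_matrix_mult)
  also have "\<dots> = (lam * x\<^sup>2)\<^sup>2 *\<^sub>R adj" unfolding EB scaleR_matrix_mult by simp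
  finally have "(1 / (lam * x\<^sup>2)\<^sup>2) *\<^sub>R (det E *\<^sub>R B) = adj" using pos by simp
  then have adj: "adj = (1 / lam\<^sup>2) *\<^sub>R B" unfolding dE using pos by (simp add: power_mult_distrib flip: power_mult)
  have E21: "E$2$1 = E$1$2" by (rule symmetric_entry) (simp add: E_def real_mat_ops)
  have "sQ h = trace (S ** adj)"
    unfolding sQ_def Q E_def[symmetric] by (simp add: S_def adj_def mat2_ops E21)
  also have "\<dots> = (1 / lam\<^sup>2) * trace (S ** ?A ** transpose ?A)"
    unfolding adj B_def scaleR_matrix_mult by (simp add: trace_def matrix_mul_assoc sum_divide_distrib)
  also have "\<dots> = x\<^sup>2 * (sqrt Dr / 2 * (\<zeta>\<^sup>2 + 1 / \<zeta>\<^sup>2))" unfolding trace_S_PA using pos by (simp add: power_mult_distrib)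
  finally show "sQ h / (sqrt (dQ h) * sqrt Dr) = (\<zeta>\<^sup>2 + 1 / \<zeta>\<^sup>2) / 2" unfolding d using pos Dr by (simp add: field_simps)
qed

lemma continuous_invariants: "continuous_on UNIV dQ" "continuous_on UNIV sQ" "continuous_on UNIV muf"
  unfolding dQ_def[abs_def] sQ_def[abs_def] muf_def[abs_def] Qh_def Jfac_def basept_def blkC_def blkD_def det_2
    matrix_matrix_mult_def hc_def map_matrix_def transpose_def
  by (simp_all add: sum_2 sum_4 mat_def) (intro continuous_intros)+

end

text \<open>The similitude factor is the real part of an entry of h* J h, hence continuous, and
  membership becomes a combination of closed conditions with an open one.\<close>

lemma grpH_borel: "grpH \<in> sets borel" "grpHplus \<in> sets borel"
proof -
  define \<nu> where "\<nu> = (\<lambda>h::complex^4^4. Re ((hc h ** Jsymp ** h)$1$3))"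
  have s: "has_similitude h \<mu> \<Longrightarrow> \<nu> h = \<mu>" for h \<mu>
    by (simp add: \<nu>_def has_similitude_alt) (simp add: Jsymp_def mat_def)
  have H: "grpH = ({h. \<forall>i j. Im (h $ i $ j) = 0} \<inter> {h. hc h ** Jsymp ** h = \<nu> h *\<^sub>R Jsymp}) \<inter> {h. \<nu> h \<noteq> 0}"
    unfolding grpH_def grpG_iff using s by (auto simp: complex_is_Real_iff has_similitude_alt)
  have Hp: "grpHplus = grpH \<inter> {h. \<nu> h > 0}"
    using s[OF has_similitude_similitude] by (auto simp: grpH_def grpHplus_iff)
  have cn: "continuous_on UNIV \<nu>"
    unfolding \<nu>_def hc_def map_matrix_def transpose_def matrix_matrix_mult_def
    by (simp add: sum_4) (intro continuous_intros)
  have 1: "closed {h::complex^4^4. \<forall>i j. Im (h $ i $ j) = 0}"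
    by (intro closed_Collect_all closed_Collect_eq continuous_intros)
  have ce: "continuous_on UNIV (\<lambda>h::complex^4^4. (hc h ** Jsymp ** h) $ i $ j)" for i j
    unfolding hc_def map_matrix_def transpose_def matrix_matrix_mult_def
    by (simp add: sum_4) (intro continuous_intros)
  have "{h. hc h ** Jsymp ** h = \<nu> h *\<^sub>R Jsymp} = {h. \<forall>i j. (hc h ** Jsymp ** h) $ i $ j = (\<nu> h *\<^sub>R Jsymp) $ i $ j}"
    by (simp add: vec_eq_iff)
  also have "closed \<dots>"
    by (intro closed_Collect_all closed_Collect_eq ce) (simp, intro continuous_intros cn)
  finally have 2: "closed {h. hc h ** Jsymp ** h = \<nu> h *\<^sub>R Jsymp}" .
  have 3: "open {h. \<nu> h \<noteq> 0}" "open {h. \<nu> h > 0}"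
    by (intro open_Collect_neq open_Collect_less cn continuous_intros)+
  show H': "grpH \<in> sets borel" unfolding H using 1 2 3 by (intro sets.Int) auto
  show "grpHplus \<in> sets borel" unfolding Hp using H' 3 by (intro sets.Int) auto
qed

context bessel_section
begin

definition integrand :: "complex^4^4 \<Rightarrow> complex" where
  "integrand h = Wsharp (eta S ** h) s * Bessel_fun S l h"

lemma integrand_not_Hplus: "h \<notin> grpHplus \<Longrightarrow> integrand h = 0"
  by (simp add: integrand_def Bessel_fun_def)

text \<open>On H+(R) the value depends on lam and \<zeta> alone, which R(R) does not move. As R(R)
  has positive similitude factors, it also preserves the complement, where the Bessel function is
  0.\<close>

lemma integrand_R_invariant:
  assumes r: "r \<in> grpR S" and h: "h \<in> grpH"
  shows "integrand (r ** h) = integrand h"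
proof (cases "h \<in> grpHplus")
  case True
  then obtain lam \<zeta> x t X k where d: "lam > 0" "\<zeta> \<ge> 1" "x > 0" "transpose X = X" "k \<in> KinfH" "h = PP lam \<zeta> x t X ** k"
    using PP_decomposition by metis
  obtain x' t' X' where d': "x' > 0" "transpose X' = X'" "r ** PP lam \<zeta> x t X = PP lam \<zeta> x' t' X'"
    using grpR_PP[OF r d(4,3)] by metis
  have z: "\<zeta> > 0" using d(2) by simp
  have "r ** h = PP lam \<zeta> x' t' X' ** k" unfolding d(6) matrix_mul_assoc d'(3) ..
  then show ?thesis unfolding integrand_def d(6) using integrand_PP[OF d(1) z d(3,4,5)] integrand_PP[OF d(1) z d'(1,2) d(5)] by simp
next
  case False
  have rH: "r \<in> grpHplus" using grpR_Hplus[OF r] .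
  have "similitude (r ** h) = similitude r * similitude h" using rH h by (intro similitude_mult) (auto simp: grpHplus_iff grpH_def)
  then have "r ** h \<notin> grpHplus" using False h rH by (auto simp: grpHplus_iff zero_less_mult_iff)
  then show ?thesis using False integrand_not_Hplus by simp
qed

lemma integrand_K_invariant:
  assumes k: "k \<in> KinfH" and h: "h \<in> grpH"
  shows "integrand (h ** k) = integrand h"
proof (cases "h \<in> grpHplus")
  case True
  then obtain lam \<zeta> x t X k' where d: "lam > 0" "\<zeta> \<ge> 1" "x > 0" "transpose X = X" "k' \<in> KinfH" "h = PP lam \<zeta> x t X ** k'"
    using PP_decomposition by metis
  have z: "\<zeta> > 0" using d(2) by simp
  have "h ** k = PP lam \<zeta> x t X ** (k' ** k)" unfolding d(6) matrix_mul_assoc ..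
  then show ?thesis unfolding integrand_def d(6) using integrand_PP[OF d(1) z d(3,4,5)] integrand_PP[OF d(1) z d(3,4) KinfH_mult[OF d(5) k]] by simp
next
  case False
  have "similitude (h ** k) = similitude h * similitude k" using k h by (intro similitude_mult) (auto simp: KinfH_def grpH_def)
  moreover have "similitude k = 1" using k by (auto simp: KinfH_def Kinf_def)
  ultimately have "h ** k \<notin> grpHplus" using False h by (auto simp: grpHplus_iff)
  then show ?thesis using False integrand_not_Hplus by simp
qed

lemma integrand_formula:
  assumes "h \<in> grpHplus"
  shows "muf h / sqrt (dQ h) > 0" "sQ h / (sqrt (dQ h) * sqrt Dr) > 0"
    "integrand h = phi (muf h / sqrt (dQ h)) (sQ h / (sqrt (dQ h) * sqrt Dr))"
proof -
  obtain lam \<zeta> x t X k where d: "lam > 0" "\<zeta> \<ge> 1" "x > 0" "transpose X = X" "k \<in> KinfH" "h = PP lam \<zeta> x t X ** k"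
    using assms PP_decomposition by metis
  have z: "\<zeta> > 0" using d(2) by simp
  note i = PP_invariants[OF d(1) z d(3,4,5), of t, folded d(6)]
  show "muf h / sqrt (dQ h) > 0" unfolding i using d by simp
  show "sQ h / (sqrt (dQ h) * sqrt Dr) > 0" unfolding i using z by (simp add: add_pos_pos)
  show "integrand h = phi (muf h / sqrt (dQ h)) (sQ h / (sqrt (dQ h) * sqrt Dr))"
    unfolding i using integrand_PP[OF d(1) z d(3,4,5), of t] by (simp add: integrand_def d(6) XX_def)
qed

lemma integrand_hrep:
  assumes t0: "conj_to_SO2 S t0" and z: "\<zeta> \<ge> 1"
  shows "lam > 0 \<Longrightarrow> integrand (hrep t0 lam \<zeta>) = phi lam (XX \<zeta>)" "lam < 0 \<Longrightarrow> integrand (hrep t0 lam \<zeta>) = 0"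
proof -
  obtain t where t: "hrep t0 lam \<zeta> = PP lam \<zeta> 1 t 0" using hrep_PP[OF t0] by metis
  have z0: "\<zeta> > 0" "\<zeta> \<noteq> 0" using z by auto
  show "integrand (hrep t0 lam \<zeta>) = phi lam (XX \<zeta>)" if "lam > 0"
    using integrand_PP[OF that z0(1), of 1 0 "mat 1" t] mat1_KinfH unfolding t integrand_def by simp
  show "integrand (hrep t0 lam \<zeta>) = 0" if "lam < 0"
  proof (rule integrand_not_Hplus)
    have "has_similitude (PP lam \<zeta> 1 t 0) lam" using PP_similitude[OF z0(2), of 0 lam 1 t] by simp
    then have "similitude (hrep t0 lam \<zeta>) = lam" unfolding t by (rule similitude_eq)
    then show "hrep t0 lam \<zeta> \<notin> grpHplus" using that by (simp add: grpHplus_iff)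
  qed
qed

end

section \<open>The integral\<close>

context form_data
begin

text \<open>The density of the quotient measure in (lam, \<zeta>), with its factor pi, extended by 0
  to the plane.\<close>

definition wt :: "real \<times> real \<Rightarrow> real" where
  "wt = (\<lambda>(lam, \<zeta>). indicator (- {0}) lam * indicator {1..} \<zeta> * (pi * ((\<zeta> - inverse (\<zeta> ^ 3)) * inverse (lam ^ 4))))"

lemma wt_nonneg: "wt z \<ge> 0"
proof -
  have "\<zeta> - inverse (\<zeta> ^ 3) \<ge> 0" if "\<zeta> \<ge> 1" for \<zeta> :: real
    using that le_imp_inverse_le[of 1 "\<zeta> ^ 3"] one_le_power[of \<zeta> 3] by simp
  then show ?thesis by (auto simp: wt_def indicator_def split: prod.split)
qed

lemma wt_measurable [measurable]: "wt \<in> borel_measurable (lborel \<Otimes>\<^sub>M lborel)"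
  unfolding wt_def by measurable

text \<open>The normalization concerns nonnegative functions. Applied to indicators of Borel sets
  composed with G, it shows that G on the quotient and g on the weighted plane have the same
  distribution on the complex numbers. Integrability and integral depend on the distribution alone,
  so G need not be split into positive parts.\<close>

lemma quot_measure_transfer:
  fixes G :: "complex^4^4 \<Rightarrow> complex" and g :: "real \<times> real \<Rightarrow> complex"
  assumes M: "quot_measure S t0 M"
    and Gm: "G \<in> borel_measurable (restrict_space borel grpH)"
    and R: "\<forall>r\<in>grpR S. \<forall>h\<in>grpH. G (r ** h) = G h"
    and K: "\<forall>h\<in>grpH. \<forall>k\<in>KinfH. G (h ** k) = G h"
    and g [measurable]: "g \<in> borel_measurable (lborel \<Otimes>\<^sub>M lborel)"
    and gG: "\<And>lam \<zeta>. lam \<noteq> 0 \<Longrightarrow> \<zeta> \<ge> 1 \<Longrightarrow> G (hrep t0 lam \<zeta>) = g (lam, \<zeta>)"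
  shows "integrable M (on_coset G) \<longleftrightarrow> integrable (lborel \<Otimes>\<^sub>M lborel) (\<lambda>z. wt z *\<^sub>R g z)"
    "(\<integral>X. on_coset G X \<partial>M) = (\<integral>z. wt z *\<^sub>R g z \<partial>(lborel \<Otimes>\<^sub>M lborel))"
proof -
  note M' = M[unfolded quot_measure_def]
  note sp = M'[THEN conjunct1] and se = M'[THEN conjunct2, THEN conjunct1]
    and form = M'[THEN conjunct2, THEN conjunct2, THEN conjunct2, THEN spec, THEN mp, THEN mp, THEN mp]
  have Gc [measurable]: "on_coset G \<in> borel_measurable M"
  proof (rule measurableI)
    fix A :: "complex set" assume A: "A \<in> sets borel"
    have "G -` A \<inter> grpH \<in> sets (restrict_space borel grpH)"
      using measurable_sets[OF Gm A] by (simp add: space_restrict_space)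
    then have "{h \<in> grpH. G h \<in> A} \<in> sets borel"
      using grpH_borel(1) by (subst (asm) sets_restrict_space_iff) (auto simp: vimage_def Int_def conj_commute)
    then have "\<Union>{X \<in> quotRH S. on_coset G X \<in> A} \<in> sets borel" unfolding Union_quotRH[OF R] .
    then show "on_coset G -` A \<inter> space M \<in> sets M"
      unfolding sp se by (auto simp: vimage_def Int_def conj_commute)
  qed simp
  let ?N = "density (lborel \<Otimes>\<^sub>M lborel) (\<lambda>z. ennreal (wt z))"
  have gN: "g \<in> borel_measurable ?N" by simp
  have "distr M borel (on_coset G) = distr ?N borel g"
  proof (rule measure_eqI)
    fix A assume "A \<in> sets (distr M borel (on_coset G))"
    then have A [measurable]: "A \<in> sets borel" by simp
    define F where "F = (\<lambda>h. indicator A (G h) :: ennreal)"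
    have F1: "F \<in> borel_measurable (restrict_space borel grpH)"
      unfolding F_def using Gm by measurable
    have "emeasure (distr M borel (on_coset G)) A = (\<integral>\<^sup>+X. indicator A X \<partial>distr M borel (on_coset G))" by simp
    also have "\<dots> = (\<integral>\<^sup>+X. indicator A (on_coset G X) \<partial>M)" by (rule nn_integral_distr) auto
    also have "\<dots> = (\<integral>\<^sup>+X. on_coset F X \<partial>M)" by (simp add: on_coset_def F_def)
    also have "\<dots> = ennreal pi * (\<integral>\<^sup>+lam\<in>-{0}. (\<integral>\<^sup>+\<zeta>\<in>{1..}.
             F (hrep t0 lam \<zeta>) * ennreal ((\<zeta> - inverse (\<zeta>^3)) * inverse (lam^4)) \<partial>lborel) \<partial>lborel)"
      by (rule form[OF F1]) (use R K in \<open>simp_all add: F_def\<close>)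
    also have "(\<integral>\<^sup>+lam\<in>-{0}. (\<integral>\<^sup>+\<zeta>\<in>{1..}. F (hrep t0 lam \<zeta>) * ennreal ((\<zeta> - inverse (\<zeta>^3)) * inverse (lam^4)) \<partial>lborel) \<partial>lborel)
      = (\<integral>\<^sup>+lam. (\<integral>\<^sup>+\<zeta>. indicator A (g (lam, \<zeta>)) * ennreal (wt (lam, \<zeta>) / pi) \<partial>lborel) \<partial>lborel)"
    proof (intro nn_integral_cong)
      fix lam :: real
      show "(\<integral>\<^sup>+\<zeta>\<in>{1..}. F (hrep t0 lam \<zeta>) * ennreal ((\<zeta> - inverse (\<zeta>^3)) * inverse (lam^4)) \<partial>lborel) * indicator (- {0}) lam
        = (\<integral>\<^sup>+\<zeta>. indicator A (g (lam, \<zeta>)) * ennreal (wt (lam, \<zeta>) / pi) \<partial>lborel)"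
      proof (cases "lam = 0")
        case False
        then have "(\<integral>\<^sup>+\<zeta>\<in>{1..}. F (hrep t0 lam \<zeta>) * ennreal ((\<zeta> - inverse (\<zeta>^3)) * inverse (lam^4)) \<partial>lborel) =
          (\<integral>\<^sup>+\<zeta>. indicator A (g (lam, \<zeta>)) * ennreal (wt (lam, \<zeta>) / pi) \<partial>lborel)"
          by (intro nn_integral_cong) (auto simp: F_def gG wt_def indicator_def)
        then show ?thesis using False by simp
      qed (simp add: wt_def)
    qed
    also have "\<dots> = (\<integral>\<^sup>+z. indicator A (g z) * ennreal (wt z / pi) \<partial>(lborel \<Otimes>\<^sub>M lborel))"
      by (rule lborel.nn_integral_fst) measurable
    also have "ennreal pi * \<dots> = (\<integral>\<^sup>+z. ennreal pi * (indicator A (g z) * ennreal (wt z / pi)) \<partial>(lborel \<Otimes>\<^sub>M lborel))"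
      by (rule nn_integral_cmult[symmetric]) measurable
    also have "\<dots> = (\<integral>\<^sup>+z. ennreal (wt z) * indicator A (g z) \<partial>(lborel \<Otimes>\<^sub>M lborel))"
    proof (intro nn_integral_cong)
      fix z
      have "ennreal pi * ennreal (wt z / pi) = ennreal (wt z)"
        using wt_nonneg[of z] by (simp flip: ennreal_mult)
      then show "ennreal pi * (indicator A (g z) * ennreal (wt z / pi)) = ennreal (wt z) * indicator A (g z)"
        by (metis mult.commute mult.left_commute)
    qed
    also have "\<dots> = (\<integral>\<^sup>+z. indicator A (g z) \<partial>?N)"
      by (rule nn_integral_density[symmetric]) measurable
    also have "\<dots> = (\<integral>\<^sup>+X. indicator A X \<partial>distr ?N borel g)" by (rule nn_integral_distr[symmetric]) auto
    also have "\<dots> = emeasure (distr ?N borel g) A" by simp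
    finally show "emeasure (distr M borel (on_coset G)) A = emeasure (distr ?N borel g) A" .
  qed simp
  note eq = this
  have "integrable M (on_coset G) \<longleftrightarrow> integrable (distr M borel (on_coset G)) (\<lambda>x. x)"
    by (subst integrable_distr_eq) auto
  also have "\<dots> \<longleftrightarrow> integrable ?N g" unfolding eq by (subst integrable_distr_eq) auto
  also have "\<dots> \<longleftrightarrow> integrable (lborel \<Otimes>\<^sub>M lborel) (\<lambda>z. wt z *\<^sub>R g z)"
    by (rule integrable_density) (auto simp: wt_nonneg)
  finally show "integrable M (on_coset G) \<longleftrightarrow> integrable (lborel \<Otimes>\<^sub>M lborel) (\<lambda>z. wt z *\<^sub>R g z)" .
  have "(\<integral>X. on_coset G X \<partial>M) = (\<integral>x. x \<partial>distr M borel (on_coset G))"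
    by (subst integral_distr) auto
  also have "\<dots> = (\<integral>z. g z \<partial>?N)" unfolding eq by (subst integral_distr) auto
  also have "\<dots> = (\<integral>z. wt z *\<^sub>R g z \<partial>(lborel \<Otimes>\<^sub>M lborel))"
    by (rule integral_density) (auto simp: wt_nonneg)
  finally show "(\<integral>X. on_coset G X \<partial>M) = (\<integral>z. wt z *\<^sub>R g z \<partial>(lborel \<Otimes>\<^sub>M lborel))" .
qed

end

section \<open>The power integral and separation of variables\<close>

lemma XX_integral:
  fixes e :: complex
  assumes e: "Re e > 1"
  defines "f \<equiv> \<lambda>\<zeta>::real. of_real (\<zeta> - inverse (\<zeta> ^ 3)) * exp (- e * of_real (ln ((\<zeta>\<^sup>2 + 1 / \<zeta>\<^sup>2) / 2)))"
  shows "set_integrable lborel {1..} f" "(LBINT \<zeta>:{1..}. f \<zeta>) = 1 / (e - 1)"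
proof -
  \<comment> \<open>In the variable X the weight \<zeta> - \<zeta>^(-3) is dX, so the integral is
    that of X^(-e) from 1 to infinity.\<close>
  define X where "X = (\<lambda>\<zeta>::real. (\<zeta>\<^sup>2 + 1 / \<zeta>\<^sup>2) / 2)"
  have X1: "X \<zeta> \<ge> 1" if "\<zeta> \<ge> 1" for \<zeta>
  proof -
    have "X \<zeta> - 1 = (\<zeta> - 1 / \<zeta>)\<^sup>2 / 2" using that by (simp add: X_def power2_eq_square field_simps)
    then show ?thesis by (smt (verit) divide_nonneg_nonneg zero_le_power2)
  qed
  have X0: "X \<zeta> > 0" if "\<zeta> \<ge> 1" for \<zeta> using X1[OF that] by simp
  have Xd: "(X has_real_derivative (\<zeta> - inverse (\<zeta> ^ 3))) (at \<zeta>)" if "\<zeta> \<ge> 1" for \<zeta>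
    unfolding X_def using that by (auto intro!: derivative_eq_intros simp: field_simps power2_eq_square power3_eq_cube)
  have lnd: "((\<lambda>\<zeta>. ln (X \<zeta>)) has_real_derivative (\<zeta> - inverse (\<zeta> ^ 3)) / X \<zeta>) (at \<zeta>)" if "\<zeta> \<ge> 1" for \<zeta>
    using X0[OF that] by (auto intro!: derivative_eq_intros Xd that simp: divide_inverse mult.commute)
  have nn: "\<zeta> - inverse (\<zeta> ^ 3) \<ge> 0" if "\<zeta> \<ge> 1" for \<zeta> :: real
    using that le_imp_inverse_le[of 1 "\<zeta> ^ 3"] one_le_power[of \<zeta> 3] by simp
  \<comment> \<open>The norm of f is the same expression with exponent Re e, a nonnegative function
    with an explicit primitive; this settles integrability.\<close>
  define r where "r = Re e"
  have r: "r > 1" using e by (simp add: r_def)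
  define fr where "fr = (\<lambda>\<zeta>. (\<zeta> - inverse (\<zeta> ^ 3)) * exp (- r * ln (X \<zeta>)))"
  have frn: "fr \<zeta> \<ge> 0" if "\<zeta> \<ge> 1" for \<zeta>
    unfolding fr_def using that by (intro mult_nonneg_nonneg nn) auto
  define Fr where "Fr = (\<lambda>\<zeta>. - exp (- (r - 1) * ln (X \<zeta>)) / (r - 1))"
  have XL: "filterlim (\<lambda>\<zeta>. ln (X \<zeta>)) at_top at_top" unfolding X_def by real_asymp
  have Frd: "(Fr has_real_derivative fr \<zeta>) (at \<zeta>)" if "\<zeta> \<ge> 1" for \<zeta>
  proof -
    have "exp (- (r - 1) * ln (X \<zeta>)) = exp (- r * ln (X \<zeta>)) * X \<zeta>"
    proof -
      have "- (r - 1) * ln (X \<zeta>) = - r * ln (X \<zeta>) + ln (X \<zeta>)" by (simp add: algebra_simps)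
      then show ?thesis using X0[OF that] by (simp only: exp_add exp_ln)
    qed
    moreover have k: "((\<lambda>y. - exp (- \<kappa> * y) / \<kappa>) has_real_derivative exp (- \<kappa> * y)) (at y)" if "\<kappa> > 0" for \<kappa> y :: real
      using that by (auto intro!: derivative_eq_intros)
    have "((\<lambda>y. - exp (- (r - 1) * y) / (r - 1)) has_real_derivative exp (- (r - 1) * y)) (at y)" for y
      by (rule k) (use r in simp)
    from DERIV_chain2[OF this lnd[OF that]]
    have "(Fr has_real_derivative exp (- (r - 1) * ln (X \<zeta>)) * ((\<zeta> - inverse (\<zeta> ^ 3)) / X \<zeta>)) (at \<zeta>)"
      unfolding Fr_def .
    ultimately show ?thesis unfolding fr_def using X0[OF that] by (simp add: mult_ac)
  qed
  have Frl: "(Fr \<longlongrightarrow> 0) at_top"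
  proof -
    have "((\<lambda>y. - exp (- (r - 1) * y) / (r - 1)) \<longlongrightarrow> 0) at_top" using r by real_asymp
    from filterlim_compose[OF this XL] show ?thesis unfolding Fr_def .
  qed
  have fb: "(\<lambda>\<zeta>. fr \<zeta>) \<in> borel_measurable borel" unfolding fr_def X_def by measurable
  have "(\<integral>\<^sup>+x. ennreal (fr x) * indicator {1..} x \<partial>lborel) = ennreal (0 - Fr 1)"
    by (rule nn_integral_FTC_atLeast[OF fb Frd frn Frl])
  then have "(\<integral>\<^sup>+x. ennreal (norm (indicator {1..} x *\<^sub>R fr x)) \<partial>lborel) < \<infinity>"
  proof -
    have "(\<integral>\<^sup>+x. ennreal (norm (indicator {1..} x *\<^sub>R fr x)) \<partial>lborel) = (\<integral>\<^sup>+x. ennreal (fr x) * indicator {1..} x \<partial>lborel)"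
      by (intro nn_integral_cong) (auto simp: indicator_def frn)
    then show ?thesis using \<open>(\<integral>\<^sup>+x. ennreal (fr x) * indicator {1..} x \<partial>lborel) = ennreal (0 - Fr 1)\<close> by simp
  qed
  then have fri: "set_integrable lborel {1..} fr"
    unfolding set_integrable_def using fb by (intro integrableI_bounded) auto
  show fi: "set_integrable lborel {1..} f"
  proof (rule set_integrable_bound[OF fri])
    show "set_borel_measurable lborel {1..} f"
      unfolding set_borel_measurable_def f_def by measurable
    have "norm (f \<zeta>) = fr \<zeta>" if "\<zeta> \<ge> 1" for \<zeta>
      using nn[OF that] by (simp add: f_def fr_def norm_mult X_def r_def del: of_real_diff)
    then show "AE x in lborel. x \<in> {1..} \<longrightarrow> norm (f x) \<le> norm (fr x)" by (auto simp: frn)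
  qed
  have fX: "f \<zeta> = of_real (\<zeta> - inverse (\<zeta> ^ 3)) * exp (- e * of_real (ln (X \<zeta>)))" for \<zeta>
    by (simp only: f_def X_def)
  define Fc where "Fc = (\<lambda>\<zeta>. - exp (- (e - 1) * of_real (ln (X \<zeta>))) / (e - 1))"
  have e1: "e - 1 \<noteq> 0" using e by auto
  have Fcd: "(Fc has_vector_derivative f \<zeta>) (at \<zeta>)" if "\<zeta> \<ge> 1" for \<zeta>
  proof -
    have k: "((\<lambda>y. - exp (- \<kappa> * y) / \<kappa>) has_field_derivative exp (- \<kappa> * y)) (at y)" if "\<kappa> \<noteq> 0" for \<kappa> y :: complex
      using that by (auto intro!: derivative_eq_intros)
    have "((\<lambda>y. - exp (- (e - 1) * y) / (e - 1)) has_field_derivative exp (- (e - 1) * y)) (at y)" for y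
      by (rule k) (rule e1)
    then have "((\<lambda>y. - exp (- (e - 1) * of_real y) / (e - 1)) has_vector_derivative exp (- (e - 1) * of_real (ln (X \<zeta>)))) (at (ln (X \<zeta>)))"
      by (rule has_vector_derivative_real_field)
    from vector_diff_chain_at[OF lnd[OF that, unfolded has_real_derivative_iff_has_vector_derivative] this]
    have "(Fc has_vector_derivative ((\<zeta> - inverse (\<zeta> ^ 3)) / X \<zeta>) *\<^sub>R exp (- (e - 1) * of_real (ln (X \<zeta>)))) (at \<zeta>)"
      unfolding Fc_def by (simp add: o_def)
    moreover have "exp (- (e - 1) * of_real (ln (X \<zeta>))) = exp (- e * of_real (ln (X \<zeta>))) * of_real (X \<zeta>)"
    proof -
      have "- (e - 1) * of_real (ln (X \<zeta>)) = - e * of_real (ln (X \<zeta>)) + of_real (ln (X \<zeta>))" by (simp add: algebra_simps)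
      moreover have "exp (complex_of_real (ln (X \<zeta>))) = of_real (X \<zeta>)" using X0[OF that] by (simp add: exp_of_real)
      ultimately show ?thesis by (simp only: exp_add)
    qed
    ultimately show ?thesis using X0[OF that] unfolding fX by (simp add: scaleR_conv_of_real mult_ac)
  qed
  \<comment> \<open>With integrability known, the complex value is the limit over an exhaustion by
    compact intervals.\<close>
  have U: "(\<Union>n. {1..1 + real n}) = {1..}"
  proof (intro equalityI subsetI)
    fix x :: real assume x: "x \<in> {1..}"
    obtain n where "x - 1 \<le> real n" using real_arch_simple by blast
    then have "x \<in> {1..1 + real n}" using x by simp
    then show "x \<in> (\<Union>n. {1..1 + real n})" by blast
  qed auto
  have lim1: "(\<lambda>n. LBINT \<zeta>:{1..1 + real n}. f \<zeta>) \<longlonglongrightarrow> (LBINT \<zeta>:(\<Union>n. {1..1 + real n}). f \<zeta>)"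
  proof (rule set_integral_cont_up)
    show "set_integrable lborel (\<Union>n. {1..1 + real n}) f" unfolding U by (rule fi)
  qed (auto simp: incseq_def)
  have ftc: "(LBINT \<zeta>:{1..1 + real n}. f \<zeta>) = Fc (1 + real n) - Fc 1" for n
    unfolding set_lebesgue_integral_def
  proof (rule integral_FTC_atLeastAtMost)
    show "continuous_on {1..1 + real n} f"
    proof -
      have "\<zeta> \<noteq> 0 \<and> \<zeta>\<^sup>2 + 1 / \<zeta>\<^sup>2 \<noteq> 0" if "\<zeta> \<in> {1..1 + real n}" for \<zeta>
        using X0[of \<zeta>] that by (auto simp: X_def)
      then show ?thesis unfolding f_def by (intro continuous_intros) auto
    qed
  qed (auto intro: has_vector_derivative_at_within Fcd)
  have "((\<lambda>y. - exp (- (e - 1) * of_real y) / (e - 1)) \<longlongrightarrow> 0) at_top"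
  proof (rule tendsto_norm_zero_cancel)
    have "((\<lambda>y. exp (- (r - 1) * y) / norm (e - 1)) \<longlongrightarrow> 0) at_top" using r e1 by real_asymp
    then show "((\<lambda>y. norm (- exp (- (e - 1) * complex_of_real y) / (e - 1))) \<longlongrightarrow> 0) at_top"
      by (simp add: norm_divide r_def)
  qed
  note L1 = this
  have "filterlim (\<lambda>n. 1 + real n) at_top sequentially" by real_asymp
  then have L2: "filterlim (\<lambda>n. ln (X (1 + real n))) at_top sequentially" by (rule filterlim_compose[OF XL])
  have "(\<lambda>n. Fc (1 + real n)) \<longlonglongrightarrow> 0" unfolding Fc_def by (rule filterlim_compose[OF L1 L2])
  then have "(\<lambda>n. Fc (1 + real n) - Fc 1) \<longlonglongrightarrow> 0 - Fc 1" by (intro tendsto_intros)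
  then have "(\<lambda>n. LBINT \<zeta>:{1..1 + real n}. f \<zeta>) \<longlonglongrightarrow> - Fc 1" by (simp add: ftc)
  then have "(LBINT \<zeta>:{1..}. f \<zeta>) = - Fc 1" using lim1 unfolding U using LIMSEQ_unique by blast
  also have "\<dots> = 1 / (e - 1)" by (simp add: Fc_def X_def)
  finally show "(LBINT \<zeta>:{1..}. f \<zeta>) = 1 / (e - 1)" .
qed

lemma lborel_scale:
  fixes f :: "real \<Rightarrow> 'a::{banach, second_countable_topology}"
  assumes "c > 0"
  shows "integrable lborel (\<lambda>x. f (c * x)) \<longleftrightarrow> integrable lborel f"
    "(\<integral>x. f (c * x) \<partial>lborel) = (1 / c) *\<^sub>R (\<integral>x. f x \<partial>lborel)"
  using lborel_integrable_real_affine_iff[of c f 0] lborel_integral_real_affine[of c f 0] assms by auto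

text \<open>For fixed \<zeta> the substitution u = b(\<zeta>) lam separates the variables, at the
  price of a factor 1 / b(\<zeta>). It is made only where A(\<zeta>) is nonzero; elsewhere the
  section is identically 0.\<close>

lemma separable_scaling:
  fixes A h :: "real \<Rightarrow> complex" and b :: "real \<Rightarrow> real"
  assumes [measurable]: "A \<in> borel_measurable borel" "h \<in> borel_measurable borel" "b \<in> borel_measurable borel"
    and b: "\<And>\<zeta>. A \<zeta> \<noteq> 0 \<Longrightarrow> b \<zeta> > 0"
    and hi: "integrable lborel h" and Ai: "integrable lborel (\<lambda>\<zeta>. A \<zeta> / of_real (b \<zeta>))"
  shows "integrable (lborel \<Otimes>\<^sub>M lborel) (\<lambda>(lam, \<zeta>). A \<zeta> * h (b \<zeta> * lam))"
    "(\<integral>z. (case z of (lam, \<zeta>) \<Rightarrow> A \<zeta> * h (b \<zeta> * lam)) \<partial>(lborel \<Otimes>\<^sub>M lborel)) = (\<integral>\<zeta>. A \<zeta> / of_real (b \<zeta>) \<partial>lborel) * (\<integral>u. h u \<partial>lborel)"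
proof -
  let ?F = "\<lambda>(\<zeta>, lam). A \<zeta> * h (b \<zeta> * lam)"
  have sec: "integrable lborel (\<lambda>lam. A \<zeta> * h (b \<zeta> * lam))" for \<zeta>
    by (cases "A \<zeta> = 0") (auto simp: lborel_scale[OF b] hi)
  have secn: "(\<integral>lam. norm (A \<zeta> * h (b \<zeta> * lam)) \<partial>lborel) = norm (A \<zeta> / of_real (b \<zeta>)) * (\<integral>u. norm (h u) \<partial>lborel)" for \<zeta>
    using lborel_scale(2)[of "b \<zeta>" "\<lambda>u. norm (h u)"] b[of \<zeta>]
    by (cases "A \<zeta> = 0") (simp_all add: norm_mult norm_divide)
  have secv: "(\<integral>lam. A \<zeta> * h (b \<zeta> * lam) \<partial>lborel) = A \<zeta> / of_real (b \<zeta>) * (\<integral>u. h u \<partial>lborel)" for \<zeta>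
    using lborel_scale(2)[of "b \<zeta>" h] b[of \<zeta>]
    by (cases "A \<zeta> = 0") (simp_all add: scaleR_conv_of_real)
  have Fi: "integrable (lborel \<Otimes>\<^sub>M lborel) ?F"
  proof (rule lborel_pair.Fubini_integrable)
    show "?F \<in> borel_measurable (lborel \<Otimes>\<^sub>M lborel)" by measurable
    show "integrable lborel (\<lambda>\<zeta>. \<integral>lam. norm (?F (\<zeta>, lam)) \<partial>lborel)"
      unfolding prod.case secn using Ai by (intro integrable_mult_left integrable_norm)
    show "AE \<zeta> in lborel. integrable lborel (\<lambda>lam. ?F (\<zeta>, lam))" using sec by simp
  qed
  have swap: "(\<lambda>(lam, \<zeta>). A \<zeta> * h (b \<zeta> * lam)) = (\<lambda>(x, y). ?F (y, x))" by auto
  show "integrable (lborel \<Otimes>\<^sub>M lborel) (\<lambda>(lam, \<zeta>). A \<zeta> * h (b \<zeta> * lam))"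
    unfolding swap using Fi by (rule lborel_pair.integrable_product_swap)
  have "(\<integral>z. (case z of (lam, \<zeta>) \<Rightarrow> A \<zeta> * h (b \<zeta> * lam)) \<partial>(lborel \<Otimes>\<^sub>M lborel)) = (\<integral>z. ?F z \<partial>(lborel \<Otimes>\<^sub>M lborel))"
    unfolding swap by (rule lborel_pair.integral_product_swap) measurable
  also have "\<dots> = (\<integral>\<zeta>. (\<integral>lam. ?F (\<zeta>, lam) \<partial>lborel) \<partial>lborel)"
    by (rule lborel_pair.integral_fst'[OF Fi, symmetric])
  also have "\<dots> = (\<integral>\<zeta>. A \<zeta> / of_real (b \<zeta>) \<partial>lborel) * (\<integral>u. h u \<partial>lborel)"
    unfolding prod.case secv by (rule integral_mult_left_zero)
  finally show "(\<integral>z. (case z of (lam, \<zeta>) \<Rightarrow> A \<zeta> * h (b \<zeta> * lam)) \<partial>(lborel \<Otimes>\<^sub>M lborel)) = (\<integral>\<zeta>. A \<zeta> / of_real (b \<zeta>) \<partial>lborel) * (\<integral>u. h u \<partial>lborel)" .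
qed

text \<open>By Fubini almost all sections are integrable. The interval (1, 2) is not a null set, so
  one of them has A(\<zeta>) nonzero, and undoing the scaling there returns h.\<close>

lemma separable_scaling_converse:
  fixes A h :: "real \<Rightarrow> complex" and b :: "real \<Rightarrow> real"
  assumes b: "\<And>\<zeta>. A \<zeta> \<noteq> 0 \<Longrightarrow> b \<zeta> > 0" and A: "\<And>\<zeta>. \<zeta> > 1 \<Longrightarrow> A \<zeta> \<noteq> 0"
    and i: "integrable (lborel \<Otimes>\<^sub>M lborel) (\<lambda>(lam, \<zeta>). A \<zeta> * h (b \<zeta> * lam))"
  shows "integrable lborel h"
proof -
  have "integrable (lborel \<Otimes>\<^sub>M lborel) (\<lambda>(x, y). (\<lambda>(lam, \<zeta>). A \<zeta> * h (b \<zeta> * lam)) (y, x))"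
    using i by (rule lborel_pair.integrable_product_swap)
  then have "AE \<zeta> in lborel. integrable lborel (\<lambda>lam. A \<zeta> * h (b \<zeta> * lam))"
    using lborel_pair.AE_integrable_fst' by fastforce
  then obtain N where N: "{\<zeta> \<in> space lborel. \<not> integrable lborel (\<lambda>lam. A \<zeta> * h (b \<zeta> * lam))} \<subseteq> N" "emeasure lborel N = 0" "N \<in> sets lborel"
    by (rule AE_E)
  have "\<not> {1<..<2::real} \<subseteq> N"
  proof
    assume "{1<..<2} \<subseteq> N"
    then have "emeasure lborel {1<..<2::real} \<le> 0" using N emeasure_mono[of "{1<..<2}" N lborel] by simp
    then show False by simp
  qed
  then obtain \<zeta> where "\<zeta> \<in> {1<..<2}" "\<zeta> \<notin> N" by blast
  then have z: "\<zeta> > 1" "\<zeta> \<notin> N" by auto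
  then have "integrable lborel (\<lambda>lam. A \<zeta> * h (b \<zeta> * lam))" using N by auto
  then have "integrable lborel (\<lambda>lam. inverse (A \<zeta>) * (A \<zeta> * h (b \<zeta> * lam)))" by (rule integrable_mult_right)
  then have "integrable lborel (\<lambda>lam. h (b \<zeta> * lam))" using A[OF z(1)] by (simp flip: mult.assoc)
  then show ?thesis using lborel_scale(1)[OF b[OF A[OF z(1)]]] by blast
qed

lemma complex_powr_pos: "y > 0 \<Longrightarrow> complex_of_real y powr z = exp (z * of_real (ln y))"
  by (simp add: powr_def Ln_of_real)

section \<open>The zeta integral in separated variables\<close>

locale zeta_integral = bessel_section a b p Dr l l1 l2 \<omega> W0 Wh q aplus s \<chi>0 W0x Wsharp +
    wh: whittaker_W "real_of_int l1 / 2" \<mu> Wh w1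
  for a b p Dr l l1 l2 \<omega> W0 Wh q aplus s \<chi>0 W0x Wsharp \<mu> w1 +
  assumes Re_s: "Re (6 * s + of_nat l + of_nat m - q - 1) > 0"
begin

text \<open>Here \<nu> + 1/2 + \<mu> and \<nu> + 1/2 - \<mu> become the arguments of the Gamma
  factors in the numerator, \<nu> + 1 - l1/2 that in the denominator, and \<open>e0\<close> - 1 the
  linear denominator of the result.\<close>

definition \<nu> :: complex where "\<nu> = 3 * s + of_nat l - q / 2 - 3 / 2"
definition e0 :: complex where "e0 = 6 * s + of_nat l + of_nat m - q"
definition dl :: real where "dl = ln (sqrt Dr)"
definition p4 :: real where "p4 = ln (4 * pi)"
text \<open>Collects the logarithms of sqrt Dr and 4 pi: from the modulus character, from \<omega>
  at the square root of u, and from expressing a power of lam through u = 4 pi sqrt(Dr) X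
  lam.\<close>

definition c0 :: complex where
  "c0 = - 3 * (s + 1/2) * of_real dl + q / 2 * (of_real p4 + of_real dl) - (\<nu> - 1) * (of_real p4 + of_real dl)"
definition cst :: complex where "cst = aplus * \<i> ^ m * exp c0"
definition mI :: "real \<Rightarrow> complex" where "mI u = indicator {0<..} u *\<^sub>R wh.mell \<nu> u"
text \<open>lam^4 is split off to meet the density lam^(-4) of the measure.\<close>

definition Psi :: "real \<Rightarrow> real \<Rightarrow> complex" where
  "Psi lam X = of_real lam ^ 4 * (cst * exp (- (e0 - 1) * of_real (ln X)) * mI (4 * pi * (sqrt Dr * X) * lam))"

lemma mI_measurable [measurable]: "mI \<in> borel_measurable borel"
  unfolding mI_def[abs_def] by (rule wh.mell_ok_borel)

text \<open>Once every power is an exponential of a logarithm, the claim is the identity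
  \<open>E\<close> between exponents.\<close>

lemma phi_Psi:
  assumes lam: "lam > 0" and X: "X > 0"
  shows "phi lam X = Psi lam X"
proof -
  define L x where "L = complex_of_real (ln lam)" and "x = complex_of_real (ln X)"
  define d4 dd where "d4 = complex_of_real p4" and "dd = complex_of_real dl"
  define u where "u = 4 * pi * (lam * (sqrt Dr * X))"
  have sD: "sqrt Dr > 0" using Dr by simp
  have u: "u > 0" using lam X sD by (simp add: u_def)
  have lnu: "complex_of_real (ln u) = d4 + L + dd + x"
    using lam X sD by (simp add: u_def ln_mult d4_def p4_def L_def dd_def dl_def x_def)
  have t1: "complex_of_real ((lam / (sqrt Dr * X)) ^ 3) powr (s + 1/2) = exp ((s + 1/2) * (3 * (L - dd - x)))"
    using lam X sD by (subst complex_powr_pos) (simp_all add: ln_realpow ln_div ln_mult L_def dd_def dl_def x_def algebra_simps)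
  have t2: "complex_of_real lam powr (- q) = exp (- q * L)" using lam by (simp add: complex_powr_pos L_def)
  have t3: "\<omega> (sqrt u) = exp (q * ((d4 + L + dd + x) / 2))"
    using u unfolding lnu[symmetric] by (simp add: omega complex_powr_pos ln_sqrt)
  have t4: "(\<i> / of_real X) ^ m = \<i> ^ m * exp (- of_nat m * x)"
  proof -
    have "complex_of_real X = exp x" using X by (simp add: x_def exp_of_real)
    then have "\<i> / of_real X = \<i> * exp (- x)" by (simp add: exp_minus divide_inverse)
    then show ?thesis by (simp add: power_mult_distrib exp_of_nat_mult[symmetric])
  qed
  have el: "complex_of_real lam = exp L" using lam by (simp add: L_def exp_of_real)
  have t5: "complex_of_real lam ^ l = exp (of_nat l * L)" "complex_of_real lam ^ 4 = exp (4 * L)"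
    using exp_of_nat_mult[of l L] exp_of_nat_mult[of 4 L] by (simp_all add: el)
  have t6: "exp (- 2 * complex_of_real pi * of_real (lam * (sqrt Dr * X))) = exp (- (of_real u / 2))"
    by (simp add: u_def mult_ac)
  have mI: "mI u = exp ((\<nu> - 1) * (d4 + L + dd + x)) * exp (- (of_real u / 2)) * Wh u"
    using u unfolding lnu[symmetric] by (simp add: mI_def wh.mell_def complex_powr_pos)
  have uu: "4 * pi * (sqrt Dr * X) * lam = u" by (simp add: u_def)
  have E: "(s + 1/2) * (3 * (L - dd - x)) + - q * L + q * ((d4 + L + dd + x) / 2) + - of_nat m * x + of_nat l * L
     = 4 * L + c0 + - (e0 - 1) * x + (\<nu> - 1) * (d4 + L + dd + x)"
    unfolding c0_def \<nu>_def e0_def d4_def[symmetric] dd_def[symmetric] by (simp add: field_simps)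
  have "phi lam X = aplus * \<i> ^ m * Wh u * exp (- (of_real u / 2)) *
     (exp ((s + 1/2) * (3 * (L - dd - x))) * exp (- q * L) * exp (q * ((d4 + L + dd + x) / 2)) * exp (- of_nat m * x) * exp (of_nat l * L))"
    unfolding phi_def t1 t2 u_def[symmetric] t3 t4 t5 t6 by (simp only: mult_ac)
  also have "\<dots> = aplus * \<i> ^ m * Wh u * exp (- (of_real u / 2)) * exp (4 * L + c0 + - (e0 - 1) * x + (\<nu> - 1) * (d4 + L + dd + x))"
    unfolding exp_add[symmetric] E ..
  also have "\<dots> = Psi lam X"
    unfolding Psi_def uu mI t5 cst_def x_def[symmetric] exp_add by (simp only: mult_ac)
  finally show ?thesis .
qed

text \<open>\<open>integrand_formula\<close> and the continuous invariants present the integrand as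
  the Borel function \<open>I\<close> on the whole space of matrices, with value 0 off
  H+(R).\<close>

lemma integrand_measurable: "integrand \<in> borel_measurable (restrict_space borel grpH)"
proof -
  note [measurable] = borel_measurable_continuous_onI[OF continuous_invariants(1)] borel_measurable_continuous_onI[OF continuous_invariants(2)]
    borel_measurable_continuous_onI[OF continuous_invariants(3)] grpH_borel(2)
  define I where "I = (\<lambda>h. indicator grpHplus h *\<^sub>R Psi (muf h / sqrt (dQ h)) (sQ h / (sqrt (dQ h) * sqrt Dr)))"
  have "I \<in> borel_measurable borel" unfolding I_def Psi_def by measurable
  moreover have "I = integrand"
    using integrand_formula integrand_not_Hplus by (auto simp: I_def fun_eq_iff indicator_def phi_Psi)
  ultimately show ?thesis by (auto intro: measurable_restrict_space1)
qed

definition gp :: "real \<times> real \<Rightarrow> complex" where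
  "gp = (\<lambda>(lam, \<zeta>). indicator {0<..} lam *\<^sub>R Psi lam (XX \<zeta>))"

lemma gp_measurable [measurable]: "gp \<in> borel_measurable (lborel \<Otimes>\<^sub>M lborel)"
  unfolding gp_def Psi_def XX_def by measurable

text \<open>All that depends on \<zeta> alone. Scaling lam by \<open>bb \<zeta>\<close> divides by
  one more power of X and raises the exponent from e0 - 1 to e0.\<close>

definition A :: "real \<Rightarrow> complex" where
  "A \<zeta> = indicator {1..} \<zeta> *\<^sub>R (of_real pi * cst * (of_real (\<zeta> - inverse (\<zeta> ^ 3)) * exp (- (e0 - 1) * of_real (ln (XX \<zeta>)))))"
definition bb :: "real \<Rightarrow> real" where "bb \<zeta> = 4 * pi * (sqrt Dr * XX \<zeta>)"

lemma XX_pos: "\<zeta> \<ge> 1 \<Longrightarrow> XX \<zeta> > 0"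
  by (simp add: XX_def add_pos_pos)

lemma A_measurable [measurable]: "A \<in> borel_measurable borel" "bb \<in> borel_measurable borel"
  unfolding A_def[abs_def] bb_def[abs_def] XX_def by measurable

lemma bb_pos: "A \<zeta> \<noteq> 0 \<Longrightarrow> bb \<zeta> > 0"
  using XX_pos[of \<zeta>] Dr by (auto simp: A_def bb_def indicator_def split: if_splits)

lemma wt_gp: "wt z *\<^sub>R gp z = (case z of (lam, \<zeta>) \<Rightarrow> A \<zeta> * mI (bb \<zeta> * lam))"
proof (cases z)
  case (Pair lam \<zeta>)
  consider "\<zeta> < 1" | "\<zeta> \<ge> 1" "lam \<le> 0" | "\<zeta> \<ge> 1" "lam > 0" by linarith
  then show ?thesis
  proof cases
    case 1 then show ?thesis by (simp add: Pair wt_def A_def)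
  next
    case 2
    then have "bb \<zeta> * lam \<le> 0" using XX_pos[OF 2(1)] Dr by (simp add: bb_def mult_nonneg_nonpos)
    then show ?thesis using 2 by (simp add: Pair gp_def mI_def)
  next
    case 3
    then show ?thesis by (simp add: Pair gp_def wt_def A_def bb_def Psi_def scaleR_conv_of_real field_simps)
  qed
qed

lemma A_over_bb: "A \<zeta> / of_real (bb \<zeta>) = indicator {1..} \<zeta> *\<^sub>R (cst / of_real (4 * sqrt Dr) *
   (of_real (\<zeta> - inverse (\<zeta> ^ 3)) * exp (- e0 * of_real (ln ((\<zeta>\<^sup>2 + 1 / \<zeta>\<^sup>2) / 2)))))"
proof (cases "\<zeta> \<ge> 1")
  case True
  have "- (e0 - 1) * of_real (ln (XX \<zeta>)) = - e0 * of_real (ln (XX \<zeta>)) + of_real (ln (XX \<zeta>))" by (simp add: algebra_simps)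
  moreover have "exp (complex_of_real (ln (XX \<zeta>))) = of_real (XX \<zeta>)" using XX_pos[OF True] by (simp add: exp_of_real)
  ultimately have e: "exp (- (e0 - 1) * of_real (ln (XX \<zeta>))) = exp (- e0 * of_real (ln (XX \<zeta>))) * of_real (XX \<zeta>)"
    by (simp only: exp_add)
  show ?thesis unfolding A_def e bb_def XX_def[symmetric] using True XX_pos[OF True] Dr by (simp add: field_simps)
qed (simp add: A_def)

lemma A_integral:
  "integrable lborel (\<lambda>\<zeta>. A \<zeta> / of_real (bb \<zeta>))"
  "(\<integral>\<zeta>. A \<zeta> / of_real (bb \<zeta>) \<partial>lborel) = cst / of_real (4 * sqrt Dr) * (1 / (e0 - 1))"
proof -
  have e: "Re e0 > 1" using Re_s by (simp add: e0_def)
  show "integrable lborel (\<lambda>\<zeta>. A \<zeta> / of_real (bb \<zeta>))"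
    unfolding A_over_bb using set_integrable_mult_right[OF XX_integral(1)[OF e], of "cst / of_real (4 * sqrt Dr)"] by (simp only: set_integrable_def)
  have "(\<integral>\<zeta>. A \<zeta> / of_real (bb \<zeta>) \<partial>lborel) = (LBINT \<zeta>:{1..}. cst / of_real (4 * sqrt Dr) * (of_real (\<zeta> - inverse (\<zeta> ^ 3)) * exp (- e0 * of_real (ln ((\<zeta>\<^sup>2 + 1 / \<zeta>\<^sup>2) / 2)))))"
    unfolding A_over_bb set_lebesgue_integral_def ..
  also have "\<dots> = cst / of_real (4 * sqrt Dr) * (1 / (e0 - 1))"
    unfolding set_integral_mult_right XX_integral(2)[OF e] ..
  finally show "(\<integral>\<zeta>. A \<zeta> / of_real (bb \<zeta>) \<partial>lborel) = cst / of_real (4 * sqrt Dr) * (1 / (e0 - 1))" .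
qed

context
  fixes t0 :: "real^2^2" and M :: "(complex^4^4) set measure"
  assumes t0: "conj_to_SO2 S t0" and M: "quot_measure S t0 M"
begin

lemma transfer:
  "integrable M (on_coset integrand) \<longleftrightarrow> integrable (lborel \<Otimes>\<^sub>M lborel) (\<lambda>(lam, \<zeta>). A \<zeta> * mI (bb \<zeta> * lam))"
  "(\<integral>X. on_coset integrand X \<partial>M) = (\<integral>z. (case z of (lam, \<zeta>) \<Rightarrow> A \<zeta> * mI (bb \<zeta> * lam)) \<partial>(lborel \<Otimes>\<^sub>M lborel))"
proof -
  have g: "integrand (hrep t0 lam \<zeta>) = gp (lam, \<zeta>)" if "lam \<noteq> 0" "\<zeta> \<ge> 1" for lam \<zeta>
    using integrand_hrep[OF t0 that(2), of lam] XX_pos[OF that(2)] that(1) by (cases "lam > 0") (simp_all add: gp_def phi_Psi)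
  note T = quot_measure_transfer[OF M integrand_measurable _ _ gp_measurable g, unfolded wt_gp]
  show "integrable M (on_coset integrand) \<longleftrightarrow> integrable (lborel \<Otimes>\<^sub>M lborel) (\<lambda>(lam, \<zeta>). A \<zeta> * mI (bb \<zeta> * lam))"
    by (rule T(1)) (auto simp: integrand_R_invariant integrand_K_invariant)
  show "(\<integral>X. on_coset integrand X \<partial>M) = (\<integral>z. (case z of (lam, \<zeta>) \<Rightarrow> A \<zeta> * mI (bb \<zeta> * lam)) \<partial>(lborel \<Otimes>\<^sub>M lborel))"
    by (rule T(2)) (auto simp: integrand_R_invariant integrand_K_invariant)
qed

lemma mI_integrable: "integrable lborel mI \<longleftrightarrow> wh.mell_ok \<nu>"
  by (simp add: mI_def[abs_def] set_integrable_def)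

lemma integral_mI: "(\<integral>u. mI u \<partial>lborel) = wh.M \<nu>"
  by (simp add: mI_def[abs_def] wh.M_def set_lebesgue_integral_def)

lemma integrable_if_mell_ok: "wh.mell_ok \<nu> \<Longrightarrow> integrable M (on_coset integrand)"
  unfolding transfer(1) by (rule separable_scaling(1)[OF _ _ _ bb_pos _ A_integral(1)]) (simp_all add: mI_integrable)

text \<open>The weight in \<zeta> is positive for \<zeta> > 1, so the Mellin integrand can be
  recovered from a section as long as the constant \<open>cst\<close>, which contains
  \<open>aplus\<close>, is nonzero.\<close>

lemma mell_ok_if_integrable:
  assumes i: "integrable M (on_coset integrand)" and ap: "aplus \<noteq> 0"
  shows "wh.mell_ok \<nu>"
proof -
  have "A \<zeta> \<noteq> 0" if "\<zeta> > 1" for \<zeta>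
  proof -
    have "\<zeta> - inverse (\<zeta> ^ 3) > 0" using that one_less_power[of \<zeta> 3] less_imp_inverse_less[of 1 "\<zeta> ^ 3"] by simp
    then show ?thesis using that ap by (simp add: A_def cst_def del: of_real_diff)
  qed
  then have "integrable lborel mI"
    using separable_scaling_converse[OF bb_pos _ i[unfolded transfer(1)]] by blast
  then show ?thesis by (simp add: mI_integrable)
qed

lemma integral_value:
  assumes ok: "wh.mell_ok \<nu>"
  shows "(\<integral>X. on_coset integrand X \<partial>M) = cst / of_real (4 * sqrt Dr) * (1 / (e0 - 1)) * wh.M \<nu>"
  unfolding transfer(2) A_integral(2)[symmetric] integral_mI[symmetric]
  by (rule separable_scaling(2)[OF _ _ _ bb_pos _ A_integral(1)]) (simp_all add: mI_integrable ok)

lemma integral_aplus_0: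
  assumes "aplus = 0"
  shows "(\<integral>X. on_coset integrand X \<partial>M) = 0"
proof -
  have "A \<zeta> = 0" for \<zeta> unfolding A_def cst_def using assms by simp
  then show ?thesis unfolding transfer(2) by (simp add: case_prod_unfold)
qed

end

text \<open>The factor pi comes from 1 / (4 sqrt Dr) = pi / (4 pi sqrt Dr), where 4 pi sqrt Dr has
  logarithm \<open>p4 + dl\<close>. As ln Dr = 2 \<open>dl\<close>, exponents of sqrt Dr are halved
  for Dr.\<close>

lemma constant_value:
  "cst / of_real (4 * sqrt Dr) = \<i> ^ m * aplus * of_real pi * of_real Dr powr (- 3 * s - of_nat l / 2 + q / 2) * of_real (4 * pi) powr (- 3 * s + 3/2 - of_nat l + q)"
proof -
  define d4 dd where "d4 = complex_of_real p4" and "dd = complex_of_real dl"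
  have sD: "sqrt Dr > 0" using Dr by simp
  have lD: "complex_of_real (ln Dr) = 2 * dd" using Dr by (simp add: dd_def dl_def ln_sqrt)
  have "4 * complex_of_real pi * of_real (sqrt Dr) = exp (d4 + dd)"
    using sD by (simp add: exp_add d4_def dd_def dl_def p4_def exp_of_real)
  then have "exp c0 / (4 * complex_of_real pi * of_real (sqrt Dr)) = exp (c0 - (d4 + dd))" by (simp add: exp_diff)
  also have "c0 - (d4 + dd) = (- 3 * s - of_nat l / 2 + q / 2) * (2 * dd) + (- 3 * s + 3/2 - of_nat l + q) * d4"
    unfolding c0_def \<nu>_def d4_def[symmetric] dd_def[symmetric] by (simp add: field_simps)
  also have "exp \<dots> = of_real Dr powr (- 3 * s - of_nat l / 2 + q / 2) * of_real (4 * pi) powr (- 3 * s + 3/2 - of_nat l + q)"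
    using Dr by (subst (1 2) complex_powr_pos) (simp_all add: exp_add lD d4_def p4_def)
  finally have "exp c0 / (4 * complex_of_real pi * of_real (sqrt Dr)) = of_real Dr powr (- 3 * s - of_nat l / 2 + q / 2) * of_real (4 * pi) powr (- 3 * s + 3/2 - of_nat l + q)" .
  moreover have "cst / of_real (4 * sqrt Dr) = \<i> ^ m * aplus * of_real pi * (exp c0 / (4 * complex_of_real pi * of_real (sqrt Dr)))"
    using sD by (simp add: cst_def)
  ultimately show ?thesis by (simp only: mult_ac)
qed

end

section \<open>Poles of the Gamma factors and the final formula\<close>

lemma eventually_not_nonpos_Int:
  fixes w :: complex
  shows "eventually (\<lambda>n. w + 3 / of_nat (Suc n) \<notin> \<int>\<^sub>\<le>\<^sub>0) sequentially"
proof -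
  \<comment> \<open>For n \<ge> 3 the offsets lie strictly between 0 and 1, so two terms that are
    both integers coincide. The 3 is the slope of the Gamma arguments in s.\<close>
  have "n = n'" if n: "n \<ge> 3" "w + 3 / of_nat (Suc n) \<in> \<int>\<^sub>\<le>\<^sub>0" and n': "n' \<ge> 3" "w + 3 / of_nat (Suc n') \<in> \<int>\<^sub>\<le>\<^sub>0" for n n'
  proof -
    obtain i j :: int where ij: "w + 3 / of_nat (Suc n) = of_int i" "w + 3 / of_nat (Suc n') = of_int j"
      using n n' by (auto elim!: nonpos_Ints_cases)
    have "(3 / of_nat (Suc n) - 3 / of_nat (Suc n') :: complex) = (w + 3 / of_nat (Suc n)) - (w + 3 / of_nat (Suc n'))" by simp
    also have "\<dots> = of_int (i - j)" unfolding ij by simp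
    finally have "(3 / of_nat (Suc n) - 3 / of_nat (Suc n') :: complex) = of_int (i - j)" .
    then have "complex_of_real (3 / real (Suc n) - 3 / real (Suc n')) = of_real (of_int (i - j))" by simp
    then have d: "3 / real (Suc n) - 3 / real (Suc n') = of_int (i - j)" by (simp only: of_real_eq_iff)
    have "3 / real (Suc n) < 1" "3 / real (Suc n') < 1" "3 / real (Suc n) > 0" "3 / real (Suc n') > 0"
      using n n' by (simp_all add: divide_simps)
    then have "\<bar>real_of_int (i - j)\<bar> < 1" unfolding d[symmetric] by linarith
    then have "i - j = 0" by linarith
    then have "3 / real (Suc n) = 3 / real (Suc n')" using d by simp
    then show ?thesis by (simp add: divide_simps)
  qed
  note u = this
  show ?thesis
  proof (cases "\<exists>n0\<ge>3. w + 3 / of_nat (Suc n0) \<in> \<int>\<^sub>\<le>\<^sub>0")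
    case True
    then obtain n0 where n0: "n0 \<ge> 3" "w + 3 / of_nat (Suc n0) \<in> \<int>\<^sub>\<le>\<^sub>0" by blast
    show ?thesis using eventually_gt_at_top[of n0]
      by eventually_elim (use u[OF _ _ n0] n0 in \<open>metis less_irrefl less_imp_le order_trans\<close>)
  next
    case False
    show ?thesis using eventually_ge_at_top[of 3] by eventually_elim (use False in blast)
  qed
qed

text \<open>A pole would drive the sequence to infinity; otherwise F has a limit at s, which the
  sequence determines.\<close>

lemma not_essential_sequence_limit:
  fixes F :: "complex \<Rightarrow> complex"
  assumes ne: "not_essential F s" and x: "filterlim x (at s) sequentially" and lim: "(\<lambda>n. F (x n)) \<longlonglongrightarrow> Z"
  shows "(F \<longlongrightarrow> Z) (at s)"
proof -
  consider c where "(F \<longlongrightarrow> c) (at s)" | "is_pole F s" using ne unfolding not_essential_def by blast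
  then show ?thesis
  proof cases
    case 1
    then have "(\<lambda>n. F (x n)) \<longlonglongrightarrow> c" by (rule filterlim_compose[OF _ x])
    then have "c = Z" using lim by (rule LIMSEQ_unique)
    then show ?thesis using 1 by simp
  next
    case 2
    then have "filterlim (\<lambda>n. F (x n)) at_infinity sequentially" unfolding is_pole_def by (rule filterlim_compose[OF _ x])
    then show ?thesis using lim not_tendsto_and_filterlim_at_infinity[of sequentially "\<lambda>n. F (x n)"] by auto
  qed
qed

lemma Smat_form:
  assumes "D > 0" "D mod 4 = 0 \<or> D mod 4 = 3"
  obtains a b :: real where "Smat D = mat2 a (b / 2) (b / 2) 1" "4 * a - b\<^sup>2 = real D"
proof (cases "D mod 4 = 0")
  case True
  then show ?thesis using that[of "real D / 4" 0] by (simp add: Smat_def)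
next
  case False
  then show ?thesis using that[of "(1 + real D) / 4" 1] by (simp add: Smat_def field_simps)
qed

theorem theorem4p4p1:
  fixes l D :: nat and l1 l2 :: int
    and S t0 :: "real^2^2"
    and \<tau> :: "(real^2^2 \<Rightarrow> complex) set"
    and \<omega> :: "real \<Rightarrow> complex"
    and W0 :: "real^2^2 \<Rightarrow> complex"
    and Wh :: "real \<Rightarrow> complex"
    and q r aplus s :: complex
    and \<chi>0 :: "complex \<Rightarrow> complex"
    and W0x :: "complex^2^2 \<Rightarrow> complex"
    and Wsharp :: "complex^4^4 \<Rightarrow> complex \<Rightarrow> complex"
    and M :: "(complex^4^4) set measure"
    and integrand :: "complex^4^4 \<Rightarrow> complex"
    and Z :: complex and F :: "complex \<Rightarrow> complex"
  assumes l: "l \<ge> 2"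
    and D: "D > 0" "D mod 4 = 0 \<or> D mod 4 = 3"
    and S: "S = Smat D"
    and l2: "l2 = weight2 l l1"
    and tau: "whittaker_model (\<lambda>x. psi (- (S$2$2) * x)) \<tau>"
    and omega: "central_character \<tau> \<omega>"
    and q: "\<And>y. y > 0 \<Longrightarrow> \<omega> y = of_real y powr q"
    and r: "\<And>W. W \<in> \<tau> \<Longrightarrow> casimir W = (\<lambda>g. - (1/4 + (r/2)^2) * W g)"
    and W0: "W0 \<in> \<tau>" "has_weight l1 W0"
    and Wh: "is_Whittaker_W (of_int l1 / 2) (\<i> * r / 2) Wh"
    and aplus: "\<And>t. t > 0 \<Longrightarrow> W0 (mat2 t 0 0 1) =
        aplus * \<omega> (sqrt (4 * pi * S$2$2 * t)) * Wh (4 * pi * S$2$2 * t)"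
    and chi0: "chi0_char \<omega> l2 \<chi>0"
    and W0x: "extends_to_GU11 \<chi>0 W0 W0x"
    and Wsharp: "is_section l l1 \<chi>0 W0x Wsharp"
    and t0: "conj_to_SO2 S t0"
    and M: "quot_measure S t0 M"
    and integrand: "integrand = (\<lambda>h. Wsharp (eta S ** h) s * Bessel_fun S l h)"
    and Z: "Z = (\<integral>X. on_coset integrand X \<partial>M)"
    and F: "F = (\<lambda>s. \<i> powi (int l + l2) * aplus * of_real pi
              * of_nat D powr (- 3 * s - of_nat l / 2 + q / 2)
              * (of_real (4 * pi) powr (- 3 * s + 3/2 - of_nat l + q)
                 / (6 * s + 2 * of_nat l + of_int l2 - q - 1))
              * (Gamma (3 * s + of_nat l - 1 + \<i> * r / 2 - q / 2)
                 * Gamma (3 * s + of_nat l - 1 - \<i> * r / 2 - q / 2)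
                 / Gamma (3 * s + of_nat l - of_int l1 / 2 - 1/2 - q / 2)))"
    and s: "Re (6 * s + 2 * of_nat l + of_int l2 - q - 1) > 0"
  shows
    "(\<forall>g\<in>grpR S. \<forall>h\<in>grpH. integrand (g ** h) = integrand h) \<and>
     (Re (3 * s + of_nat l - 1 + \<i> * r / 2 - q / 2) > 0 \<and>
      Re (3 * s + of_nat l - 1 - \<i> * r / 2 - q / 2) > 0 \<longrightarrow>
        integrable M (on_coset integrand)) \<and>
     \<comment> \<open>next: the case in which \<open>Wh\<close> is a polynomial times \<open>exp (-x/2) x\<^bsup>\<mu>+1/2\<^esup>\<close>\<close>
     (\<forall>\<mu>\<in>{\<i> * r / 2, - (\<i> * r / 2)}. (of_int l1 - 1) / 2 - \<mu> \<in> \<nat> \<and>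
      Re (3 * s + of_nat l - 1 + \<mu> - q / 2) > 0 \<longrightarrow>
        integrable M (on_coset integrand)) \<and>
     (integrable M (on_coset integrand) \<longrightarrow>
      3 * s + of_nat l - 1 + \<i> * r / 2 - q / 2 \<notin> \<int>\<^sub>\<le>\<^sub>0 \<and>
      3 * s + of_nat l - 1 - \<i> * r / 2 - q / 2 \<notin> \<int>\<^sub>\<le>\<^sub>0 \<longrightarrow> Z = F s) \<and>
     \<comment> \<open>next: also where a numerator Gamma factor has a pole and the quotient of Gamma
         functions has to be read as its continuous extension\<close>
     (integrable M (on_coset integrand) \<longrightarrow> (F \<longlongrightarrow> Z) (at s))"
proof -
  define \<mu> where "\<mu> = \<i> * r / 2"
  obtain a b :: real where ab: "S = mat2 a (b / 2) (b / 2) 1" "4 * a - b\<^sup>2 = real D"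
    using Smat_form[OF D] S by metis
  define Dr where "Dr = real D"
  define p where "p = sqrt (2 / sqrt Dr)"
  have Dr: "Dr > 0" "sqrt Dr > 0" using D by (simp_all add: Dr_def)
  have p: "p > 0" "p\<^sup>2 * sqrt Dr = 2" using Dr by (simp_all add: p_def)
  have S22: "S$2$2 = 1" by (simp add: ab)
  interpret f: form_data a b p Dr
    by unfold_locales (use Dr p ab in \<open>simp_all add: Dr_def\<close>)
  have fS: "f.S = S" by (simp add: f.S_def ab)
  obtain w1 where w1: "whittaker_W (real_of_int l1 / 2) \<mu> Wh w1"
    using is_Whittaker_W_imp[of "real_of_int l1 / 2" \<mu> Wh] Wh by (auto simp: \<mu>_def)
  interpret bs: bessel_section a b p Dr l l1 l2 \<omega> W0 Wh q aplus s \<chi>0 W0x Wsharp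
  proof
    fix x :: real and g :: "real^2^2"
    show "W0 (mat2 1 x 0 1 ** g) = psi (- x) * W0 g" using tau W0(1) unfolding whittaker_model_def S22 by simp
  next
    fix z :: real and g :: "real^2^2"
    assume "z \<noteq> 0"
    then show "W0 (mat z ** g) = \<omega> z * W0 g" using omega W0(1) unfolding central_character_def by blast
  next
    fix y :: real assume "y > 0" then show "\<omega> y = of_real y powr q" by (rule q)
  next
    fix t :: real assume "t > 0" then show "W0 (mat2 t 0 0 1) = aplus * \<omega> (sqrt (4 * pi * t)) * Wh (4 * pi * t)"
      using aplus[of t] by (simp add: S22)
  qed (fact chi0 W0x Wsharp)+
  \<comment> \<open>Both branches of \<open>weight2\<close> are made so that l + l2 is the exponent
    |l - l1| of \<open>f_K\<close>.\<close>
  have m: "int bs.m = int l + l2" unfolding bs.m_def l2 weight2_def by auto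
  have mc: "of_nat bs.m = (of_nat l + of_int l2 :: complex)" using arg_cong[OF m, of "of_int :: int \<Rightarrow> complex"] by simp
  have im: "\<i> powi (int l + l2) = \<i> ^ bs.m" unfolding m[symmetric] by simp
  have e: "6 * s' + of_nat l + of_nat bs.m - q - 1 = 6 * s' + 2 * of_nat l + of_int l2 - q - 1" for s' :: complex
    by (simp add: mc)
  interpret z: zeta_integral a b p Dr l l1 l2 \<omega> W0 Wh q aplus s \<chi>0 W0x Wsharp \<mu> w1
  proof -
    interpret W: whittaker_W "real_of_int l1 / 2" \<mu> Wh w1 by (rule w1)
    show "zeta_integral a b p Dr l l1 l2 \<omega> W0 Wh q aplus s \<chi>0 W0x Wsharp \<mu> w1"
      by unfold_locales (use s e[of s] in simp)
  qed
  have int: "integrand = bs.integrand" unfolding integrand bs.integrand_def[abs_def] fS ..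
  have M': "quot_measure f.S t0 M" and t0': "conj_to_SO2 f.S t0" using M t0 fS by simp_all
  define C where "C = (\<lambda>s. \<i> ^ bs.m * aplus * of_real pi * of_nat D powr (- 3 * s - of_nat l / 2 + q / 2)
      * (of_real (4 * pi) powr (- 3 * s + 3/2 - of_nat l + q) / (6 * s + 2 * of_nat l + of_int l2 - q - 1)))"
  define z1 z2 z3 where "z1 = (\<lambda>s. 3 * s + of_nat l - 1 + \<i> * r / 2 - q / 2)" and "z2 = (\<lambda>s. 3 * s + of_nat l - 1 - \<i> * r / 2 - q / 2)"
    and "z3 = (\<lambda>s. 3 * s + of_nat l - of_int l1 / 2 - 1/2 - q / 2)"
  have FC: "F s' = C s' * (Gamma (z1 s') * Gamma (z2 s') / Gamma (z3 s'))" for s'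
    unfolding F C_def im z1_def z2_def z3_def by simp
  \<comment> \<open>This holds at the poles, too, where Gamma takes the value 0, the inverse of 0.
    It presents F as a quotient of functions analytic at s.\<close>
  have FC': "F s' = C s' * (rGamma (z3 s') / (rGamma (z1 s') * rGamma (z2 s')))" for s'
    unfolding FC rGamma_inverse_Gamma by (simp add: field_simps)
  define \<nu> where "\<nu> = (\<lambda>s. 3 * s + of_nat l - q / 2 - 3 / 2 :: complex)"
  have nu: "\<nu> s = z.\<nu>" by (simp add: \<nu>_def z.\<nu>_def)
  have zz: "z1 s' = \<nu> s' + 1/2 + \<mu>" "z2 s' = \<nu> s' + 1/2 - \<mu>" "z3 s' = \<nu> s' + 1 - of_real (real_of_int l1 / 2)" for s'
    by (simp_all add: z1_def z2_def z3_def \<nu>_def \<mu>_def)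
  have ok_int: "integrable M (on_coset integrand)" if "z.wh.mell_ok (\<nu> s)"
    using z.integrable_if_mell_ok[OF t0' M'] that unfolding int nu by simp
  have int_ok: "z.wh.mell_ok (\<nu> s)" if "integrable M (on_coset integrand)" "aplus \<noteq> 0"
    using z.mell_ok_if_integrable[OF t0' M'] that unfolding int nu by simp
  have ZM: "Z = C s * z.wh.M (\<nu> s)" if "z.wh.mell_ok (\<nu> s)"
  proof -
    have "Z = z.cst / of_real (4 * sqrt Dr) * (1 / (z.e0 - 1)) * z.wh.M (\<nu> s)"
      unfolding Z int nu by (rule z.integral_value[OF t0' M']) (use that nu in simp)
    also have "z.e0 - 1 = 6 * s + 2 * of_nat l + of_int l2 - q - 1" using e[of s] by (simp add: z.e0_def)
    finally have Zc: "Z = z.cst / of_real (4 * sqrt Dr) * (1 / (6 * s + 2 * of_nat l + of_int l2 - q - 1)) * z.wh.M (\<nu> s)" .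
    show ?thesis unfolding Zc z.constant_value unfolding C_def Dr_def by (simp add: mult_ac)
  qed
  have Z0: "Z = 0" if "aplus = 0" unfolding Z int by (rule z.integral_aplus_0[OF t0' M' that])
  have F0: "F s' = 0" if "aplus = 0" for s' unfolding FC C_def using that by simp
  have FM: "F s' = C s' * z.wh.M (\<nu> s')" if "z.wh.mell_ok (\<nu> s')" "z1 s' \<notin> \<int>\<^sub>\<le>\<^sub>0" "z2 s' \<notin> \<int>\<^sub>\<le>\<^sub>0" for s'
  proof -
    have "rGamma (z1 s') * rGamma (z2 s') * z.wh.M (\<nu> s') = rGamma (z3 s')"
      unfolding zz by (rule z.wh.M_rGamma[OF that(1)])
    then show ?thesis unfolding FC' using that(2,3) by (simp add: rGamma_eq_zero_iff field_simps)
  qed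
  have 1: "\<forall>g\<in>grpR S. \<forall>h\<in>grpH. integrand (g ** h) = integrand h"
    using bs.integrand_R_invariant unfolding int fS by blast
  have 2: "integrable M (on_coset integrand)" if "Re (z1 s) > 0" "Re (z2 s) > 0"
  proof (rule ok_int, rule z.wh.mell_ok_Re)
    show "\<bar>Re \<mu>\<bar> < Re (\<nu> s) + 1/2" using that unfolding zz by (auto simp: abs_less_iff)
  qed
  have 3: "integrable M (on_coset integrand)"
    if mu': "\<mu>' \<in> {\<i> * r / 2, - (\<i> * r / 2)}" "(of_int l1 - 1) / 2 - \<mu>' \<in> \<nat>" "Re (3 * s + of_nat l - 1 + \<mu>' - q / 2) > 0" for \<mu>'
  proof (rule ok_int)
    \<comment> \<open>Whittaker's equation contains \<mu> only through its square, so
      \<open>Wh\<close> belongs to -\<mu> as well, and either sign may be the one with a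
      polynomial.\<close>
    have "\<mu>' = \<mu> \<or> \<mu>' = - \<mu>" using mu'(1) unfolding \<mu>_def by blast
    then have "\<mu>'\<^sup>2 = \<mu>\<^sup>2" by auto
    then have "whittaker_W (real_of_int l1 / 2) \<mu>' Wh w1"
      using w1 by (simp add: whittaker_W_def whittaker_equation_def)
    moreover obtain n where "(of_int l1 - 1) / 2 - \<mu>' = of_nat n" using mu'(2) by (auto elim: Nats_cases)
    then have "of_real (real_of_int l1 / 2) - 1/2 - \<mu>' = of_nat n" by (simp add: diff_divide_distrib)
    moreover have "Re (\<nu> s + 1/2 + \<mu>') > 0" using mu'(3) by (simp add: \<nu>_def)
    ultimately show "z.wh.mell_ok (\<nu> s)" by (rule whittaker_W.mell_ok_polynomial)
  qed
  have 4: "Z = F s" if "integrable M (on_coset integrand)" "z1 s \<notin> \<int>\<^sub>\<le>\<^sub>0" "z2 s \<notin> \<int>\<^sub>\<le>\<^sub>0"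
    using that Z0 F0 ZM FM int_ok by (cases "aplus = 0") simp_all
  have 5: "(F \<longlongrightarrow> Z) (at s)" if i: "integrable M (on_coset integrand)"
  proof (cases "aplus = 0")
    case True
    then have "F = (\<lambda>_. 0)" using F0 by (simp add: fun_eq_iff)
    then show ?thesis using Z0[OF True] by simp
  next
    case False
    have ok: "z.wh.mell_ok (\<nu> s)" by (rule int_ok[OF i False])
    \<comment> \<open>On this sequence, to the right of s, integrability persists and the Gamma
      arguments eventually avoid the poles, so F there is \<open>C\<close> times the Mellin
      transform.\<close>
    define x where "x = (\<lambda>n. s + 1 / of_nat (Suc n))"
    have xl: "x \<longlonglongrightarrow> s"
    proof -
      have "(\<lambda>n. s + 1 / of_nat (Suc n)) \<longlonglongrightarrow> s + 0" by (intro tendsto_intros LIMSEQ_Suc[OF lim_1_over_n])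
      then show ?thesis by (simp add: x_def)
    qed
    have nux: "\<nu> (x n) = \<nu> s + of_real 3 / of_nat (Suc n)" for n by (simp add: \<nu>_def x_def distrib_left)
    have den: "6 * s + 2 * of_nat l + of_int l2 - q - 1 \<noteq> 0"
      using s by (metis less_irrefl zero_complex.sel(1))
    have Ca: "C analytic_on {s}"
    proof -
      have "4 * complex_of_real pi \<notin> \<real>\<^sub>\<le>\<^sub>0" using pi_gt_zero by (simp add: complex_nonpos_Reals_iff not_le)
      then show ?thesis unfolding C_def using D(1) den by (intro analytic_intros) auto
    qed
    have "isCont C s" using Ca by (rule analytic_at_imp_isCont)
    then have Cx: "(\<lambda>n. C (x n)) \<longlonglongrightarrow> C s" using xl by (rule isCont_tendsto_compose)
    have Mx: "(\<lambda>n. z.wh.M (\<nu> (x n))) \<longlonglongrightarrow> z.wh.M (\<nu> s)"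
      unfolding nux by (rule z.wh.M_right_limit[OF ok]) simp
    have Fx: "eventually (\<lambda>n. C (x n) * z.wh.M (\<nu> (x n)) = F (x n)) sequentially"
      using eventually_not_nonpos_Int[of "z1 s"] eventually_not_nonpos_Int[of "z2 s"]
    proof eventually_elim
      case (elim n)
      have "z1 (x n) = z1 s + 3 / of_nat (Suc n)" "z2 (x n) = z2 s + 3 / of_nat (Suc n)"
        unfolding zz nux by simp_all
      moreover have "z.wh.mell_ok (\<nu> (x n))"
        by (rule z.wh.mell_ok_mono[OF ok]) (simp add: nux complex_Re_of_nat Re_divide_of_nat del: of_nat_Suc)
      ultimately show ?case using FM[of "x n"] elim by simp
    qed
    have lim: "(\<lambda>n. F (x n)) \<longlonglongrightarrow> Z"
      unfolding ZM[OF ok] by (rule Lim_transform_eventually[OF tendsto_mult[OF Cx Mx] Fx])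
    have "x n \<noteq> s" for n unfolding x_def by (simp del: of_nat_Suc)
    then have xat: "filterlim x (at s) sequentially"
      using xl by (simp add: filterlim_at)
    have rG: "(\<lambda>s. rGamma (z1 s)) analytic_on {s}" "(\<lambda>s. rGamma (z2 s)) analytic_on {s}" "(\<lambda>s. rGamma (z3 s)) analytic_on {s}"
      unfolding z1_def z2_def z3_def by (intro analytic_intros; simp)+
    have num: "(\<lambda>s. C s * rGamma (z3 s)) analytic_on {s}" and de: "(\<lambda>s. rGamma (z1 s) * rGamma (z2 s)) analytic_on {s}"
      by (intro analytic_intros Ca rG)+
    \<comment> \<open>A quotient of functions analytic at s has no essential singularity there, so
      the limit along one sequence is the limit.\<close>
    have "not_essential (\<lambda>s. (C s * rGamma (z3 s)) / (rGamma (z1 s) * rGamma (z2 s))) s"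
      using num de by (intro not_essential_divide not_essential_analytic isolated_singularity_at_analytic)
    then have "not_essential F s" unfolding FC'[abs_def] by simp
    then show ?thesis by (rule not_essential_sequence_limit[OF _ xat lim])
  qed
  show ?thesis
    using 1 2 3 4 5 unfolding z1_def z2_def by blast
qed

end
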